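(* Let $U,V\in\mathcal{L}_2(\mathbb{R}^m)$, $Y:=(U,V)$, $\nu:=\mathrm{Law}(Y)$, and let $S$ be the standard form on $\mathbb{R}^{2m}$. The following are equivalent: (a) there exists a $Y$-equilibrium $(R,f)$ with monotone pricing function $f$; (b) there exist an optimal map $X$ and an optimal set $G$ of the dual problem such that $\mathrm{Law}(X,Y)$ is an optimal plan and $\{u\in\mathbb{R}^m:(u,v)\in G\text{ for some }v\in\mathbb{R}^m\}=\mathbb{R}^m$. Under these conditions, for any optimal set $G$ of the dual problem whose projection on the first $m$ coordinates is $\mathbb{R}^m$, there exists a $Y$-equilibrium $(R,f)$ such that $\operatorname{graph} f\subset G$ and $X:=(R,f(R))$ is an optimal map.
   Context: The standard form on $\mathbb{R}^{2m}$ is $S((r,s),(u,v)):=\langle s,u\rangle+\langle r,v\rangle$, $r,s,u,v\in\mathbb{R}^m$ (with $d=2m$). $G\subset\mathbb{R}^{2m}$ is $S$-monotone if $S(x-y,x-y)\ge0$ for $x,y\in G$; maximal if not a strict subset of another $S$-monotone set; $\mathcal{M}(S)$ is the family of maximal $S$-monotone sets. $\psi_G(y):=\sup_{x\in G}(S(x,y)-\frac12S(x,x))$. $\mathcal{X}(Y):=\{X\in\mathcal{L}_2(\mathbb{R}^{2m}): X\ Y\text{-measurable},\ \mathbb{E}[Y|X]=X\}$; an optimal map maximizes $\frac12\mathbb{E}[S(X,Y)]$ over $\mathcal{X}(Y)$. $\Gamma(\nu)$: Borel probability measures on $\mathbb{R}^{2m}\times\mathbb{R}^{2m}$ (coordinates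 $(x,y)$) with finite second moments, second marginal $\nu$, conditional expectation of $y$ given $x$ equal to $x$; an optimal plan maximizes $\frac12\int S(x,y)d\gamma$ over $\Gamma(\nu)$. An optimal set of the dual problem minimizes $\int\psi_G d\nu$ over $G\in\mathcal{M}(S)$. A function $f:\mathbb{R}^m\to\mathbb{R}^m$ is monotone if $\langle u-r,f(u)-f(r)\rangle\ge0$ for all $u,r$. Given $U,V,R\in\mathcal{L}_2(\mathbb{R}^m)$ with $R$ $Y$-measurable ($Y=(U,V)$) and a Borel function $f:\mathbb{R}^m\to\mathbb{R}^m$, the pair $(R,f)$ is a $Y$-equilibrium if (i) $f(R)=\mathbb{E}[V\mid R]$ and (ii) a.s. $R\in\operatorname{argmax}_{r\in\mathbb{R}^m}\langle r-U,V-f(r)\rangle$. Relations hold a.s. *)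

theory Defs
  imports "HOL-Probability.Probability"
begin

text \<open>Points of R^{2m} are pairs (r,s) with r,s in R^m (type real^'m).\<close>

definition S :: "((real^'m) \<times> (real^'m)) \<Rightarrow> ((real^'m) \<times> (real^'m)) \<Rightarrow> real" where
  "S x y = snd x \<bullet> fst y + fst x \<bullet> snd y"

definition S_monotone :: "((real^'m) \<times> (real^'m)) set \<Rightarrow> bool" where
  "S_monotone G \<longleftrightarrow> (\<forall>x\<in>G. \<forall>y\<in>G. 0 \<le> S (x - y) (x - y))"

definition maximal_S_monotone :: "((real^'m) \<times> (real^'m)) set \<Rightarrow> bool" where
  "maximal_S_monotone G \<longleftrightarrow> S_monotone G \<and> (\<forall>G'. S_monotone G' \<and> G \<subseteq> G' \<longrightarrow> G' = G)"

definition psi :: "((real^'m) \<times> (real^'m)) set \<Rightarrow> ((real^'m) \<times> (real^'m)) \<Rightarrow> ereal" where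
  "psi G y = (SUP x\<in>G. ereal (S x y - S x x / 2))"

definition ext_integral :: "'a measure \<Rightarrow> ('a \<Rightarrow> ereal) \<Rightarrow> ereal" where
  "ext_integral M f = enn2ereal (\<integral>\<^sup>+x. e2ennreal (f x) \<partial>M) - enn2ereal (\<integral>\<^sup>+x. e2ennreal (- f x) \<partial>M)"

definition L2 :: "'a measure \<Rightarrow> ('a \<Rightarrow> 'b::euclidean_space) \<Rightarrow> bool" where
  "L2 M X \<longleftrightarrow> X \<in> borel_measurable M \<and> integrable M (\<lambda>\<omega>. (norm (X \<omega>))\<^sup>2)"

definition cond_exp_eq :: "'a measure \<Rightarrow> ('a \<Rightarrow> 'c::topological_space) \<Rightarrow> ('a \<Rightarrow> 'b::euclidean_space) \<Rightarrow> ('a \<Rightarrow> 'b) \<Rightarrow> bool" where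
  "cond_exp_eq M X Z W \<longleftrightarrow> integrable M Z \<and> integrable M W \<and>
     W \<in> measurable (vimage_algebra (space M) X borel) borel \<and>
     (\<forall>A\<in>sets borel. (\<integral>\<omega>. indicator (X -` A) \<omega> *\<^sub>R Z \<omega> \<partial>M) = (\<integral>\<omega>. indicator (X -` A) \<omega> *\<^sub>R W \<omega> \<partial>M))"

definition Xset :: "'a measure \<Rightarrow> ('a \<Rightarrow> 'b::euclidean_space) \<Rightarrow> ('a \<Rightarrow> 'b) set" where
  "Xset M Y = {X. L2 M X \<and> X \<in> measurable (vimage_algebra (space M) Y borel) borel \<and> cond_exp_eq M X Y X}"

definition optimal_map :: "'a measure \<Rightarrow> ('a \<Rightarrow> (real^'m) \<times> (real^'m)) \<Rightarrow> ('a \<Rightarrow> (real^'m) \<times> (real^'m)) \<Rightarrow> bool" where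
  "optimal_map M Y X \<longleftrightarrow> X \<in> Xset M Y \<and>
     (\<forall>X'\<in>Xset M Y. (\<integral>\<omega>. S (X' \<omega>) (Y \<omega>) \<partial>M) / 2 \<le> (\<integral>\<omega>. S (X \<omega>) (Y \<omega>) \<partial>M) / 2)"

definition Gamma :: "'b::euclidean_space measure \<Rightarrow> ('b \<times> 'b) measure set" where
  "Gamma \<nu> = {\<gamma>. prob_space \<gamma> \<and> sets \<gamma> = sets borel \<and> integrable \<gamma> (\<lambda>z. (norm z)\<^sup>2) \<and>
     distr \<gamma> borel snd = \<nu> \<and>
     (\<forall>A\<in>sets borel. (\<integral>z. indicator A (fst z) *\<^sub>R snd z \<partial>\<gamma>) = (\<integral>z. indicator A (fst z) *\<^sub>R fst z \<partial>\<gamma>))}"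

definition optimal_plan :: "((real^'m) \<times> (real^'m)) measure \<Rightarrow> (((real^'m) \<times> (real^'m)) \<times> ((real^'m) \<times> (real^'m))) measure \<Rightarrow> bool" where
  "optimal_plan \<nu> \<gamma> \<longleftrightarrow> \<gamma> \<in> Gamma \<nu> \<and>
     (\<forall>\<gamma>'\<in>Gamma \<nu>. (\<integral>z. S (fst z) (snd z) \<partial>\<gamma>') / 2 \<le> (\<integral>z. S (fst z) (snd z) \<partial>\<gamma>) / 2)"

definition optimal_dual_set :: "((real^'m) \<times> (real^'m)) measure \<Rightarrow> ((real^'m) \<times> (real^'m)) set \<Rightarrow> bool" where
  "optimal_dual_set \<nu> G \<longleftrightarrow> maximal_S_monotone G \<and>
     (\<forall>G'. maximal_S_monotone G' \<longrightarrow> ext_integral \<nu> (psi G) \<le> ext_integral \<nu> (psi G'))"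

definition monotone_fun :: "(real^'m \<Rightarrow> real^'m) \<Rightarrow> bool" where
  "monotone_fun f \<longleftrightarrow> (\<forall>u r. 0 \<le> (u - r) \<bullet> (f u - f r))"

definition Y_equilibrium :: "'a measure \<Rightarrow> ('a \<Rightarrow> real^'m) \<Rightarrow> ('a \<Rightarrow> real^'m) \<Rightarrow> ('a \<Rightarrow> real^'m) \<Rightarrow> (real^'m \<Rightarrow> real^'m) \<Rightarrow> bool" where
  "Y_equilibrium M U V R f \<longleftrightarrow> L2 M R \<and>
     R \<in> measurable (vimage_algebra (space M) (\<lambda>\<omega>. (U \<omega>, V \<omega>)) borel) borel \<and>
     f \<in> borel_measurable borel \<and>
     cond_exp_eq M R V (\<lambda>\<omega>. f (R \<omega>)) \<and>
     (AE \<omega> in M. \<forall>r. (r - U \<omega>) \<bullet> (V \<omega> - f r) \<le> (R \<omega> - U \<omega>) \<bullet> (V \<omega> - f (R \<omega>)))"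

end

theory Submission
  imports Defs
begin

text \<open>
  Write \<open>q x = S x x / 2\<close>. If \<open>E[Y | X] = X\<close> and \<open>G\<close> is maximal monotone, then conditional
  convexity and \<open>psi G \<ge> q\<close> give \<open>E[S X Y] / 2 = E[q X] \<le> E[psi G X] \<le> E[psi G Y]\<close>; when both ends agree,
  \<open>X \<in> G\<close> and \<open>psi G Y = S X Y - q X\<close> almost surely. The latter identity, read at the points
  \<open>(r, f r)\<close> of \<open>G\<close>, is exactly the maximality condition of an equilibrium.

  There is no gap at an optimal plan: collapsing a small fraction \<open>\<epsilon> g\<close> of the mass to its barycentre
  shows, to first order in \<open>\<epsilon>\<close>, that \<open>q (\<integral> g Y) \<le> \<integral> g (S X Y - q X)\<close> for every bounded probability
  density \<open>g\<close>. So the points \<open>(\<integral> g Y, \<integral> g (S X Y - q X))\<close> form a convex set above the graph of \<open>q\<close>. The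
  contact points with the graph of \<open>q\<close> of a maximal such convex set form a maximal monotone set \<open>G\<close>
  (Minty's criterion holds by minimising a strongly convex function), and \<open>psi G Y \<le> S X Y - q X\<close>.

  Given a full-domain \<open>G\<close> without gap and \<open>X = (R, F)\<close>, replace \<open>F\<close> by \<open>E[V | R] = f R\<close>; this keeps the value,
  hence stays in \<open>G\<close>, and off the range of \<open>R\<close> a Borel selection of \<open>G\<close> defines \<open>f\<close>. Conversely,
  an equilibrium \<open>(R, f)\<close> yields the optimal map \<open>E[Y | R]\<close> together with any maximal monotone
  extension of the graph of \<open>f\<close>.
\<close>

section \<open>The form and maximal monotone sets\<close>

text \<open>The form is indefinite, so \<open>q\<close> is not convex; convexity enters only through
  \<open>psi G\<close>, a supremum of tangents of \<open>q\<close>, since \<open>S x y - q x\<close>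
  is the tangent of \<open>q\<close> at \<open>x\<close> evaluated at \<open>y\<close>. Collapsing a
  fraction of the mass needs randomness beyond \<open>Y\<close>, so the competitor is a plan and in
  general not a map. This is why (b) asks that the law of \<open>(X, Y)\<close> be an optimal plan.
  The perturbation yields some set without gap, about whose projection nothing is known. The optimal
  set in (b) has no larger dual value, so it inherits the absence of a gap and contributes the full
  projection. Two obstacles shape the details. First, \<open>psi G\<close> may be infinite and need
  not be integrable, whence integrals in \<open>ereal\<close>, truncations and finite maxima.
  Second, an equilibrium compares \<open>R\<close> with every point of the space, so almost sure
  membership in \<open>G\<close> is not enough for \<open>f\<close>, and conditional expectations
  must be functions defined everywhere, not only random variables.\<close>

type_synonym 'm pt = "(real^'m) \<times> (real^'m)"

text \<open>The swap is a linear isometry, so Cauchy-Schwarz, integrability and conditional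
  expectation facts about the inner product carry over to \<open>S\<close>.\<close>

lemma S_eq_inner: "S x y = prod.swap x \<bullet> y"
  by (cases x; cases y) (simp add: S_def)

lemma S_commute: "S x y = S y x"
  by (simp add: S_def inner_commute)

lemma S_add_left: "S (x + y) z = S x z + S y z"
  and S_add_right: "S x (y + z) = S x y + S x z"
  and S_diff_left: "S (x - y) z = S x z - S y z"
  and S_diff_right: "S x (y - z) = S x y - S x z"
  and S_scaleR_left: "S (a *\<^sub>R x) z = a * S x z"
  and S_scaleR_right: "S x (a *\<^sub>R z) = a * S x z"
  and S_minus_left: "S (- x) z = - S x z"
  and S_minus_right: "S x (- z) = - S x z"
  by (simp_all add: S_def inner_add_left inner_add_right inner_diff_left inner_diff_right algebra_simps)

lemmas S_bilinear = S_add_left S_add_right S_diff_left S_diff_right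
  S_scaleR_left S_scaleR_right S_minus_left S_minus_right

lemma norm_swap_prod: "norm (prod.swap x) = norm (x :: 'a::real_normed_vector \<times> 'a)"
  by (cases x) (simp add: norm_Pair add.commute)

lemma S_swap_left: "S (prod.swap x) y = x \<bullet> y"
  by (simp add: S_eq_inner)

lemma S_swap_swap: "S (prod.swap x) (prod.swap y) = S x y"
  by (cases x; cases y) (simp add: S_def)

lemma abs_S_le: "\<bar>S x y\<bar> \<le> norm x * norm y"
  unfolding S_eq_inner using Cauchy_Schwarz_ineq2[of "prod.swap x" y] by (simp add: norm_swap_prod)

lemma continuous_on_S [continuous_intros]:
  "continuous_on A f \<Longrightarrow> continuous_on A g \<Longrightarrow> continuous_on A (\<lambda>x. S (f x) (g x))"
  unfolding S_def by (intro continuous_intros)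

lemma S_self_diff: "S (x - y) (x - y) = S x x + S y y - 2 * S x y"
  by (simp add: S_bilinear S_commute[of y x])

lemma subset_chain_common_member:
  assumes "subset.chain A C" "x \<in> \<Union>C" "y \<in> \<Union>C"
  obtains K where "K \<in> C" "x \<in> K" "y \<in> K"
proof -
  obtain K L where KL: "K \<in> C" "x \<in> K" "L \<in> C" "y \<in> L" using assms by auto
  then have "K \<subseteq> L \<or> L \<subseteq> K" using assms(1) unfolding subset_chain_def by auto
  then show ?thesis using KL that by blast
qed

lemma extend_to_maximal_S_monotone:
  assumes "S_monotone F"
  obtains G where "maximal_S_monotone G" "F \<subseteq> G"
proof -
  let ?A = "{G. S_monotone G \<and> F \<subseteq> G}"
  have "\<exists>G\<in>?A. \<forall>X\<in>?A. G \<subseteq> X \<longrightarrow> X = G"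
  proof (rule subset_Zorn_nonempty)
    show "?A \<noteq> {}" using assms by auto
    fix C assume C: "C \<noteq> {}" "subset.chain ?A C"
    have "S_monotone (\<Union>C)"
      unfolding S_monotone_def
    proof (intro ballI)
      fix x y assume "x \<in> \<Union>C" "y \<in> \<Union>C"
      then obtain K where "K \<in> C" "x \<in> K" "y \<in> K"
        using subset_chain_common_member[OF C(2)] by blast
      moreover have "S_monotone K" using \<open>K \<in> C\<close> C(2) unfolding subset_chain_def by auto
      ultimately show "0 \<le> S (x - y) (x - y)" unfolding S_monotone_def by auto
    qed
    moreover have "F \<subseteq> \<Union>C" using C unfolding subset_chain_def by blast
    ultimately show "\<Union>C \<in> ?A" by auto
  qed
  then obtain G where G: "G \<in> ?A" "\<forall>X\<in>?A. G \<subseteq> X \<longrightarrow> X = G" by (rule bexE)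
  show ?thesis
  proof (rule that)
    show "F \<subseteq> G" using G(1) by simp
    have "X = G" if "S_monotone X" "G \<subseteq> X" for X
      using bspec[OF G(2), of X] that \<open>F \<subseteq> G\<close> by (simp add: order_trans[of F G X])
    then show "maximal_S_monotone G" using G(1) unfolding maximal_S_monotone_def by simp
  qed
qed

text \<open>If \<open>x\<close> is monotonically related to all of \<open>G\<close>, then
  \<open>insert x G\<close> is still monotone. Membership thus becomes a family of closed
  conditions, which would be vacuous if \<open>G\<close> were empty.\<close>

lemma maximal_S_monotone_iff_mem:
  assumes "maximal_S_monotone G"
  shows "x \<in> G \<longleftrightarrow> (\<forall>y\<in>G. 0 \<le> S (x - y) (x - y))"
proof
  assume "x \<in> G" then show "\<forall>y\<in>G. 0 \<le> S (x - y) (x - y)"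
    using assms unfolding maximal_S_monotone_def S_monotone_def by auto
next
  assume *: "\<forall>y\<in>G. 0 \<le> S (x - y) (x - y)"
  have "S (y - x) (y - x) = S (x - y) (x - y)" for y
    by (simp add: S_self_diff S_commute)
  with * have "S_monotone (insert x G)"
    using assms unfolding maximal_S_monotone_def S_monotone_def by (auto simp: S_def)
  then show "x \<in> G"
    using assms unfolding maximal_S_monotone_def by blast
qed

lemma maximal_S_monotone_nonempty:
  assumes "maximal_S_monotone G" shows "G \<noteq> {}"
  using maximal_S_monotone_iff_mem[OF assms, of 0] by auto

lemma maximal_S_monotone_closed:
  assumes "maximal_S_monotone G" shows "closed G"
proof -
  have "G = (\<Inter>y\<in>G. {x. 0 \<le> S (x - y) (x - y)})"
    by (intro set_eqI, subst maximal_S_monotone_iff_mem[OF assms]) simp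
  moreover have "closed \<dots>"
    by (intro closed_INT ballI closed_Collect_le continuous_intros)
  ultimately show ?thesis by simp
qed

section \<open>Convex sets above the graph of the quadratic form\<close>

definition above_form :: "('m::finite pt \<times> real) set \<Rightarrow> bool" where
  "above_form D \<longleftrightarrow> convex D \<and> (\<forall>(p, a)\<in>D. S p p / 2 \<le> a)"

lemma above_formD: "above_form D \<Longrightarrow> (p, a) \<in> D \<Longrightarrow> S p p / 2 \<le> a"
  unfolding above_form_def by auto

lemma above_form_comb:
  assumes "above_form D" "(p, a) \<in> D" "(p', a') \<in> D" "0 \<le> u" "u \<le> 1"
  shows "((1 - u) *\<^sub>R p + u *\<^sub>R p', (1 - u) * a + u * a') \<in> D"
proof -
  have "(1 - u) *\<^sub>R (p, a) + u *\<^sub>R (p', a') \<in> D"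
    using assms unfolding above_form_def by (intro convexD) auto
  then show ?thesis by simp
qed

text \<open>The common end of all first-order arguments: move by a fraction \<open>t\<close>, divide
  by \<open>t\<close>, let \<open>t\<close> tend to 0.\<close>

lemma le_of_small_scale:
  fixes a b k :: real
  assumes "\<And>t. 0 < t \<Longrightarrow> t \<le> 1 \<Longrightarrow> a \<le> b + t * k"
  shows "a \<le> b"
proof (rule tendsto_lowerbound[of "\<lambda>t. b + t * k" _ "at_right 0"])
  show "((\<lambda>t. b + t * k) \<longlongrightarrow> b) (at_right 0)"
    by (auto intro!: tendsto_eq_intros)
  show "\<forall>\<^sub>F t in at_right 0. a \<le> b + t * k"
    unfolding eventually_at_right_field using assms by (auto intro!: exI[of _ 1])
qed simp

text \<open>On a segment in \<open>D\<close> starting at a contact point, \<open>q\<close> starts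
  equal to the height and stays below it, so the derivative of \<open>q\<close> there is at most the
  slope of the segment. Hence the tangent of \<open>q\<close> at \<open>w\<close> lies below
  \<open>D\<close>.\<close>

lemma above_form_contact:
  assumes "above_form D" "(w, S w w / 2) \<in> D" "(y, c) \<in> D"
  shows "S w y - S w w / 2 \<le> c"
proof (rule le_of_small_scale)
  fix t :: real assume t: "0 < t" "t \<le> 1"
  have "S ((1 - t) *\<^sub>R w + t *\<^sub>R y) ((1 - t) *\<^sub>R w + t *\<^sub>R y) / 2 \<le> (1 - t) * (S w w / 2) + t * c"
    using above_form_comb[OF assms, of t] t by (intro above_formD[OF assms(1)]) auto
  then have "((1-t)^2 * S w w + t^2 * S y y + 2 * t * (1-t) * S w y) / 2 \<le> (1 - t) * (S w w / 2) + t * c"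
    by (simp add: S_bilinear S_commute[of y w] power2_eq_square algebra_simps)
  then have "t * (S w y - S w w / 2) \<le> t * (c + t * (S w y - S w w / 2 - S y y / 2))"
    by (simp add: power2_eq_square algebra_simps diff_divide_distrib add_divide_distrib)
  then show "S w y - S w w / 2 \<le> c + t * (S w y - S w w / 2 - S y y / 2)"
    using t by simp
qed

text \<open>Converse of the contact inequality: in \<open>q\<close> of a convex combination the
  cross term is \<open>u * v * S w b\<close>, and the tangent condition bounds \<open>S w b\<close>
  by \<open>c + S w w / 2\<close>.\<close>

lemma above_form_insert:
  assumes D: "above_form D" "D \<noteq> {}"
    and w: "\<And>y c. (y, c) \<in> D \<Longrightarrow> S w y - S w w / 2 \<le> c"
  shows "above_form (convex hull (insert (w, S w w / 2) D))"
  unfolding above_form_def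
proof (intro conjI convex_convex_hull, clarify)
  fix p a assume "(p, a) \<in> convex hull (insert (w, S w w / 2) D)"
  moreover have "convex hull D = D" using D(1) unfolding above_form_def by (simp add: hull_same)
  ultimately obtain u v b c where uv: "0 \<le> u" "0 \<le> v" "u + v = 1" and bc: "(b, c) \<in> D"
    and pa: "(p, a) = u *\<^sub>R (w, S w w / 2) + v *\<^sub>R (b, c)"
    unfolding convex_hull_insert[OF D(2)] by auto
  have p: "p = u *\<^sub>R w + v *\<^sub>R b" and a: "a = u * (S w w / 2) + v * c" using pa by auto
  have v: "v = 1 - u" using uv by simp
  have "S p p / 2 = u * u * (S w w / 2) + v * v * (S b b / 2) + u * v * S w b"
    unfolding p by (simp add: S_bilinear S_commute[of b w] algebra_simps)
  also have "\<dots> \<le> u * u * (S w w / 2) + v * v * c + u * v * (c + S w w / 2)"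
    using above_formD[OF D(1) bc] w[OF bc] uv
    by (intro add_mono mult_left_mono order_refl) auto
  also have "\<dots> = a" unfolding a v by (simp add: algebra_simps diff_divide_distrib add_divide_distrib)
  finally show "S p p / 2 \<le> a" .
qed

text \<open>Ordering sets instead of convex functions avoids infinite values. A maximal set is the
  epigraph of a minimal convex function above \<open>q\<close>.\<close>

lemma above_form_maximal_exists:
  assumes "above_form D0"
  obtains D where "above_form D" "D0 \<subseteq> D" "\<And>D'. above_form D' \<Longrightarrow> D \<subseteq> D' \<Longrightarrow> D' = D"
proof -
  let ?A = "{D. above_form D \<and> D0 \<subseteq> D}"
  have "\<exists>G\<in>?A. \<forall>X\<in>?A. G \<subseteq> X \<longrightarrow> X = G"
  proof (rule subset_Zorn_nonempty)
    show "?A \<noteq> {}" using assms by auto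
    fix C assume C: "C \<noteq> {}" "subset.chain ?A C"
    have K: "\<And>K. K \<in> C \<Longrightarrow> above_form K \<and> D0 \<subseteq> K" using C(2) unfolding subset_chain_def by auto
    have "convex (\<Union>C)"
    proof (rule convexI)
      fix x y u v assume xy: "x \<in> \<Union>C" "y \<in> \<Union>C" and uv: "0 \<le> u" "0 \<le> (v::real)" "u + v = 1"
      then obtain L where L: "L \<in> C" "x \<in> L" "y \<in> L"
        using subset_chain_common_member[OF C(2)] by blast
      with K[OF L(1)] uv have "u *\<^sub>R x + v *\<^sub>R y \<in> L"
        unfolding above_form_def by (auto intro: convexD)
      then show "u *\<^sub>R x + v *\<^sub>R y \<in> \<Union>C" using L by auto
    qed
    then have "above_form (\<Union>C)"
      using K unfolding above_form_def by auto
    moreover have "D0 \<subseteq> \<Union>C" using C(1) K by blast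
    ultimately show "\<Union>C \<in> ?A" by auto
  qed
  then obtain D where D: "D \<in> ?A" "\<forall>X\<in>?A. D \<subseteq> X \<longrightarrow> X = D" by (rule bexE)
  show ?thesis
  proof (rule that)
    show "above_form D" "D0 \<subseteq> D" using D(1) by simp_all
    show "X = D" if "above_form X" "D \<subseteq> X" for X
      using bspec[OF D(2), of X] that \<open>D0 \<subseteq> D\<close> by (simp add: order_trans[of D0 D X])
  qed
qed

lemma above_form_closure:
  assumes "above_form D" shows "above_form (closure D)"
proof -
  have "closure D \<subseteq> {x. S (fst x) (fst x) / 2 \<le> snd x}"
    using assms unfolding above_form_def
    by (intro closure_minimal closed_Collect_le continuous_intros) auto
  then show ?thesis using assms unfolding above_form_def by (auto intro: convex_closure)
qed

text \<open>For a point \<open>(y, c)\<close> of \<open>D\<close>, \<open>c - S z y\<close> is at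
  least \<open>q (y - z) - q z\<close>, and \<open>q\<close> is bounded by half the squared norm; so
  adding half the squared distance to \<open>z\<close> makes the functional bounded below, and
  strongly convex in the first coordinate. The term with \<open>y - w\<close> in the conclusion
  records this strong convexity.\<close>

lemma above_form_minimiser:
  fixes z :: "'m::finite pt"
  assumes D: "above_form D" "closed D" "D \<noteq> {}"
  obtains w b where "(w, b) \<in> D"
    "\<And>y c. (y, c) \<in> D \<Longrightarrow>
       b - S z w + (norm (w - z))\<^sup>2 / 2 + (norm (y - w))\<^sup>2 / 2 \<le> c - S z y + (norm (y - z))\<^sup>2 / 2"
proof -
  define F where "F = (\<lambda>p :: 'm pt \<times> real. snd p - S z (fst p) + (norm (fst p - z))\<^sup>2 / 2)"
  have lower: "- S z z / 2 \<le> F p" if "p \<in> D" for p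
  proof -
    have "S (fst p) (fst p) / 2 \<le> snd p" using above_formD[OF D(1), of "fst p" "snd p"] that by simp
    moreover have "- ((norm (fst p - z))\<^sup>2) \<le> S (fst p - z) (fst p - z)"
      using abs_S_le[of "fst p - z" "fst p - z"] by (simp add: power2_eq_square)
    ultimately show ?thesis unfolding F_def S_self_diff by (simp add: S_commute)
  qed
  have bdd: "bdd_below (F ` D)" by (rule bdd_belowI2) (rule lower)
  define m where "m = Inf (F ` D)"
  have m: "m \<le> F p" if "p \<in> D" for p unfolding m_def using bdd that by (auto intro: cInf_lower)
  \<comment> \<open>Strong convexity as an identity: the affine part is exact on segments, only the
    square of the norm loses something.\<close>
  have par: "F ((1 - t) *\<^sub>R p + t *\<^sub>R p') = (1 - t) * F p + t * F p' - t * (1 - t) * (norm (fst p - fst p'))\<^sup>2 / 2"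
    for t p p'
  proof -
    define a b where "a = fst p - z" and "b = fst p' - z"
    have "fst ((1 - t) *\<^sub>R p + t *\<^sub>R p') - z = (1 - t) *\<^sub>R a + t *\<^sub>R b"
      by (simp add: a_def b_def algebra_simps)
    moreover have "(norm ((1 - t) *\<^sub>R a + t *\<^sub>R b))\<^sup>2
        = (1 - t) * (norm a)\<^sup>2 + t * (norm b)\<^sup>2 - t * (1 - t) * (norm (a - b))\<^sup>2"
      unfolding power2_norm_eq_inner
      by (simp add: inner_add_left inner_add_right inner_diff_left inner_diff_right
          inner_commute[of b a]) (simp add: algebra_simps)
    moreover have "a - b = fst p - fst p'" by (simp add: a_def b_def)
    moreover have "S z (fst ((1 - t) *\<^sub>R p + t *\<^sub>R p')) = (1 - t) * S z (fst p) + t * S z (fst p')"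
      by (simp add: S_add_right S_scaleR_right)
    moreover have "snd ((1 - t) *\<^sub>R p + t *\<^sub>R p') = (1 - t) * snd p + t * snd p'" by simp
    ultimately have "F ((1 - t) *\<^sub>R p + t *\<^sub>R p') = ((1 - t) * snd p + t * snd p')
        - ((1 - t) * S z (fst p) + t * S z (fst p'))
        + ((1 - t) * (norm a)\<^sup>2 + t * (norm b)\<^sup>2 - t * (1 - t) * (norm (fst p - fst p'))\<^sup>2) / 2"
      unfolding F_def by presburger
    then show ?thesis unfolding F_def a_def[symmetric] b_def[symmetric]
      by (simp add: algebra_simps add_divide_distrib diff_divide_distrib)
  qed
  have comb: "(1 - t) *\<^sub>R p + t *\<^sub>R p' \<in> D" if "p \<in> D" "p' \<in> D" "0 \<le> t" "t \<le> 1" for p p' t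
    using D(1) that unfolding above_form_def by (intro convexD) auto
  have "\<exists>p\<in>D. F p < m + inverse (Suc n)" for n
  proof -
    have "m < m + inverse (Suc n)" by simp
    then have "\<exists>y\<in>F ` D. y < m + inverse (Suc n)"
      unfolding m_def by (subst (asm) cInf_less_iff) (use D(3) bdd in auto)
    then show ?thesis by auto
  qed
  then obtain P where P: "\<And>n. P n \<in> D" "\<And>n. F (P n) < m + inverse (Suc n)" by metis
  \<comment> \<open>At the midpoint, where \<open>F\<close> is at least \<open>m\<close>, the
    identity bounds the squared distance by 8 times the excess of the mean value over
    \<open>m\<close>; this excess is at most half the sum of the two errors.\<close>
  have close: "(norm (fst (P i) - fst (P j)))\<^sup>2 \<le> 4 * (inverse (Suc i) + inverse (Suc j))" for i j
    using par[of "1/2" "P i" "P j"] m[OF comb[OF P(1)[of i] P(1)[of j], of "1/2"]] P(2)[of i] P(2)[of j]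
    by simp
  have "Cauchy (\<lambda>n. fst (P n))"
  proof (rule metric_CauchyI)
    fix e :: real assume e: "0 < e"
    obtain N where N: "inverse (real (Suc N)) < e\<^sup>2 / 8"
      using reals_Archimedean[of "e\<^sup>2/8"] e by auto
    show "\<exists>N. \<forall>i\<ge>N. \<forall>j\<ge>N. dist (fst (P i)) (fst (P j)) < e"
    proof (intro exI allI impI)
      fix i j assume "N \<le> i" "N \<le> j"
      then have "inverse (real (Suc i)) \<le> inverse (real (Suc N))" "inverse (real (Suc j)) \<le> inverse (real (Suc N))"
        by (auto intro!: le_imp_inverse_le)
      with N close[of i j] have "(norm (fst (P i) - fst (P j)))\<^sup>2 < e\<^sup>2" by argo
      then show "dist (fst (P i)) (fst (P j)) < e"
        using e by (simp add: dist_norm power_less_imp_less_base)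
    qed
  qed
  then obtain w where w: "(\<lambda>n. fst (P n)) \<longlonglongrightarrow> w"
    using Cauchy_convergent convergent_def by blast
  have Fm: "(\<lambda>n. F (P n)) \<longlonglongrightarrow> m"
  proof (rule tendsto_sandwich)
    show "\<forall>\<^sub>F n in sequentially. m \<le> F (P n)" using m P by auto
    show "\<forall>\<^sub>F n in sequentially. F (P n) \<le> m + inverse (Suc n)" 
      by (intro always_eventually allI less_imp_le P)
    show "(\<lambda>n. m + inverse (real (Suc n))) \<longlonglongrightarrow> m"
      using tendsto_add[OF tendsto_const LIMSEQ_inverse_real_of_nat, of m] by simp
  qed simp
  have St: "(\<lambda>n. S z (fst (P n))) \<longlonglongrightarrow> S z w"
    unfolding S_def by (intro tendsto_intros w)
  \<comment> \<open>Only the first coordinates are known to converge so far. \<open>b\<close> is the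
    height with \<open>F (w, b) = m\<close>; convergence of the values forces the heights to tend to
    it.\<close>
  define b where "b = m + S z w - (norm (w - z))\<^sup>2 / 2"
  have "(\<lambda>n. F (P n) + S z (fst (P n)) - (norm (fst (P n) - z))\<^sup>2 / 2) \<longlonglongrightarrow> b"
    unfolding b_def by (intro tendsto_intros Fm St w) simp
  then have "(\<lambda>n. snd (P n)) \<longlonglongrightarrow> b" by (simp add: F_def)
  from tendsto_Pair[OF w this] have "P \<longlonglongrightarrow> (w, b)" by simp
  then have wb: "(w, b) \<in> D" using closed_sequentially[OF D(2), of P] P(1) by blast
  have Fwb: "F (w, b) = m" by (simp add: F_def b_def)
  show ?thesis
  proof (rule that[OF wb])
    fix y c assume yc: "(y, c) \<in> D"
    have "F (w, b) + (norm (y - w))\<^sup>2 / 2 \<le> F (y, c)"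
    proof (rule le_of_small_scale)
      fix t :: real assume t: "0 < t" "t \<le> 1"
      have "m \<le> (1 - t) * m + t * F (y, c) - t * (1 - t) * (norm (w - y))\<^sup>2 / 2"
        using par[of t "(w,b)" "(y,c)"] m[OF comb[OF wb yc, of t]] t Fwb by simp
      then have "t * (m + (norm (y - w))\<^sup>2 / 2) \<le> t * (F (y, c) + t * ((norm (y - w))\<^sup>2 / 2))"
        by (simp add: algebra_simps norm_minus_commute diff_divide_distrib)
      then show "F (w, b) + (norm (y - w))\<^sup>2 / 2 \<le> F (y, c) + t * ((norm (y - w))\<^sup>2 / 2)"
        using t Fwb by simp
    qed
    then show "b - S z w + (norm (w - z))\<^sup>2 / 2 + (norm (y - w))\<^sup>2 / 2 \<le> c - S z y + (norm (y - z))\<^sup>2 / 2"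
      by (simp add: F_def)
  qed
qed

text \<open>The minimiser \<open>w\<close> attached to \<open>z\<close> has a mirror point \<open>w' = z - swap (w - z)\<close> which could be
  added to the maximal set \<open>D\<close>; comparing the two values forces \<open>w = w'\<close>.\<close>

lemma maximal_S_monotone_below:
  assumes D0: "above_form D0" "D0 \<noteq> {}"
  obtains G where "maximal_S_monotone G"
    "\<And>x y c. x \<in> G \<Longrightarrow> (y, c) \<in> D0 \<Longrightarrow> S x y - S x x / 2 \<le> c"
proof -
  obtain D where D: "above_form D" "D0 \<subseteq> D" and max: "\<And>D'. above_form D' \<Longrightarrow> D \<subseteq> D' \<Longrightarrow> D' = D"
    using above_form_maximal_exists[OF D0(1)] by blast
  have ne: "D \<noteq> {}" using D D0 by auto
  have cl: "closed D" using max[OF above_form_closure[OF D(1)] closure_subset] by (metis closed_closure)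
  define G where "G = {w. (w, S w w / 2) \<in> D}"
  have addable: "w \<in> G" if "\<And>y c. (y, c) \<in> D \<Longrightarrow> S w y - S w w / 2 \<le> c" for w
  proof -
    have "convex hull (insert (w, S w w / 2) D) = D"
      by (rule max[OF above_form_insert[OF D(1) ne that]]) (auto intro: hull_inc)
    then show ?thesis unfolding G_def using hull_inc[of "(w, S w w / 2)" "insert (w, S w w / 2) D" convex] by auto
  qed
  have mono: "S_monotone G"
    unfolding S_monotone_def
  proof (intro ballI)
    fix x y assume "x \<in> G" "y \<in> G"
    then have "S x y - S x x / 2 \<le> S y y / 2"
      unfolding G_def by (intro above_form_contact[OF D(1)]) auto
    then show "0 \<le> S (x - y) (x - y)" by (simp add: S_self_diff)
  qed
  \<comment> \<open>Minty's criterion: for such a \<open>w\<close>, \<open>S (w - z) (w - z)\<close>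
    is minus the squared norm of \<open>w - z\<close>, so a point \<open>z\<close> monotonically
    related to \<open>w\<close> must equal \<open>w\<close>.\<close>
  have minty: "\<exists>w\<in>G. w - z = - prod.swap (w - z)" for z
  proof -
    obtain w b where wb: "(w, b) \<in> D" and opt: "\<And>y c. (y, c) \<in> D \<Longrightarrow>
       b - S z w + (norm (w - z))\<^sup>2 / 2 + (norm (y - w))\<^sup>2 / 2 \<le> c - S z y + (norm (y - z))\<^sup>2 / 2"
      using above_form_minimiser[OF D(1) cl ne] by metis
    define e where "e = w - z"
    define w' where "w' = z - prod.swap e"
    have b: "S w w / 2 \<le> b" by (rule above_formD[OF D(1) wb])
    have diff: "w - w' = e + prod.swap e" by (simp add: w'_def e_def)
    \<comment> \<open>\<open>w - w'\<close> is invariant under the swap, and \<open>S x x\<close> is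
      the squared norm of \<open>x\<close> on invariant vectors. Being nonnegative, it puts the
      tangent of \<open>q\<close> at \<open>w'\<close> below \<open>q\<close> at the point
      \<open>w\<close>.\<close>
    have "S (w - w') (w - w') = (norm (e + prod.swap e))\<^sup>2"
      unfolding diff power2_norm_eq_inner
      by (cases e) (simp add: S_def inner_add_left inner_add_right inner_commute)
    then have rel: "S w' w - S w' w' / 2 \<le> S w w / 2"
      using zero_le_power2[of "norm (e + prod.swap e)"] unfolding S_self_diff S_commute[of w w'] by argo
    have w'G: "w' \<in> G"
    proof (rule addable)
      fix y c assume yc: "(y, c) \<in> D"
      \<comment> \<open>Expanding the square around \<open>w\<close> turns minimality into
        \<open>b - S w' w \<le> c - S w' y\<close>, so \<open>w'\<close> gives a supporting
        functional of \<open>D\<close> at \<open>(w, b)\<close>. Together with \<open>rel\<close>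
        and \<open>q w \<le> b\<close>, this makes \<open>w'\<close> addable.\<close>
      have "S w' y = S z y - e \<bullet> y" "S w' w = S z w - e \<bullet> w"
        unfolding w'_def by (simp_all add: S_bilinear S_swap_left)
      moreover have "(norm (y - z))\<^sup>2 = (norm (y - w))\<^sup>2 + (norm (w - z))\<^sup>2 + 2 * (e \<bullet> y - e \<bullet> w)"
        unfolding power2_norm_eq_inner e_def
        by (simp add: inner_diff_left inner_diff_right inner_commute algebra_simps)
      ultimately show "S w' y - S w' w' / 2 \<le> c" using opt[OF yc] rel b by argo
    qed
    then have "b - S z w + (norm (w - z))\<^sup>2 / 2 + (norm (w' - w))\<^sup>2 / 2 \<le> S w' w' / 2 - S z w' + (norm (w' - z))\<^sup>2 / 2"
      unfolding G_def by (intro opt) simp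
    \<comment> \<open>\<open>w - z\<close> and \<open>w' - z\<close> have the same norm and the same
      value of \<open>S\<close>. Hence testing minimality at \<open>w'\<close> leaves only
      \<open>b\<close>, \<open>q w\<close> and the distance from \<open>w\<close> to
      \<open>w'\<close>.\<close>
    moreover have "norm (w' - z) = norm (w - z)"
      unfolding w'_def by (simp add: norm_swap_prod e_def)
    moreover have "S (w' - z) (w' - z) = S (w - z) (w - z)"
      unfolding w'_def by (simp add: S_bilinear S_swap_swap e_def)
    ultimately have "b + (norm (w' - w))\<^sup>2 / 2 \<le> S w w / 2"
      by (simp add: S_self_diff S_commute)
    then have "w' = w" using b by (smt (verit) zero_less_norm_iff right_minus_eq zero_less_power half_gt_zero)
    then have "w - z = - prod.swap e" by (simp add: w'_def algebra_simps)
    then show ?thesis using w'G \<open>w' = w\<close> unfolding e_def by auto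
  qed
  have "maximal_S_monotone G"
    unfolding maximal_S_monotone_def
  proof (intro conjI mono allI impI, elim conjE)
    fix G' assume G': "S_monotone G'" "G \<subseteq> G'"
    show "G' = G"
    proof (rule antisym[OF subsetI G'(2)])
      fix z assume z: "z \<in> G'"
      obtain w where w: "w \<in> G" "w - z = - prod.swap (w - z)" using minty by blast
      have "0 \<le> S (w - z) (w - z)" using G' z w unfolding S_monotone_def by auto
      also have "S (w - z) (w - z) = S (- prod.swap (w - z)) (w - z)" using w(2) by metis
      also have "\<dots> = - ((norm (w - z))\<^sup>2)" 
        unfolding S_minus_left S_swap_left power2_norm_eq_inner ..
      finally have "w = z" by simp
      then show "z \<in> G" using w by simp
    qed
  qed
  moreover have "S x y - S x x / 2 \<le> c" if "x \<in> G" "(y, c) \<in> D0" for x y c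
    by (rule above_form_contact[OF D(1)]) (use that D(2) in \<open>auto simp: G_def\<close>)
  ultimately show ?thesis by (rule that)
qed

section \<open>Square integrable conditional expectations\<close>

lemma L2_D: assumes "L2 N X" shows "X \<in> borel_measurable N" "integrable N (\<lambda>\<omega>. (norm (X \<omega>))\<^sup>2)"
  using assms unfolding L2_def by auto

lemma L2_bound:
  assumes "L2 N Z" "X \<in> borel_measurable N" "AE \<omega> in N. norm (X \<omega>) \<le> norm (Z \<omega>)"
  shows "L2 N X"
  unfolding L2_def
proof
  show "integrable N (\<lambda>\<omega>. (norm (X \<omega>))\<^sup>2)"
    by (rule Bochner_Integration.integrable_bound[OF L2_D(2)[OF assms(1)]])
      (use assms in \<open>auto intro!: power_mono\<close>)
qed fact

lemma L2_cong_AE: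
  assumes "L2 N Z" "X \<in> borel_measurable N" "AE \<omega> in N. X \<omega> = Z \<omega>"
  shows "L2 N X"
  using assms(3) by (intro L2_bound[OF assms(1,2)]) auto

lemma L2_add:
  assumes "L2 N X" "L2 N Z" shows "L2 N (\<lambda>\<omega>. X \<omega> + Z \<omega>)"
proof -
  note [measurable] = L2_D(1)[OF assms(1)] L2_D(1)[OF assms(2)]
  have *: "(norm (x + z))\<^sup>2 \<le> 2 * (norm x)\<^sup>2 + 2 * (norm z)\<^sup>2" for x z :: 'b
    using zero_le_power2[of "norm (x - z)"] unfolding power2_norm_eq_inner
    by (simp add: inner_add_left inner_add_right inner_diff_left inner_diff_right)
  have "integrable N (\<lambda>\<omega>. 2 * (norm (X \<omega>))\<^sup>2 + 2 * (norm (Z \<omega>))\<^sup>2)"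
    using assms by (intro Bochner_Integration.integrable_add integrable_mult_right L2_D)
  then have "integrable N (\<lambda>\<omega>. (norm (X \<omega> + Z \<omega>))\<^sup>2)"
    by (rule Bochner_Integration.integrable_bound) (use * in \<open>auto intro!: AE_I2\<close>)
  then show ?thesis unfolding L2_def by simp
qed

lemma L2_scaleR: "L2 N X \<Longrightarrow> L2 N (\<lambda>\<omega>. c *\<^sub>R X \<omega>)"
  unfolding L2_def by (auto simp: power_mult_distrib)

lemma L2_diff: assumes "L2 N X" "L2 N Z" shows "L2 N (\<lambda>\<omega>. X \<omega> - Z \<omega>)"
  using L2_add[OF assms(1) L2_scaleR[OF assms(2), of "-1"]] by simp

lemma L2_Pair: assumes "L2 N X" "L2 N Z" shows "L2 N (\<lambda>\<omega>. (X \<omega>, Z \<omega>))"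
  using assms unfolding L2_def by (auto simp: norm_Pair)

lemma borel_measurable_fst_snd [measurable]:
  "(fst :: 'a::topological_space \<times> 'b::topological_space \<Rightarrow> 'a) \<in> borel_measurable borel"
  "(snd :: 'a \<times> 'b \<Rightarrow> 'b) \<in> borel_measurable borel"
  by (intro borel_measurable_continuous_onI continuous_intros)+

lemma L2_fst: assumes "L2 N X" shows "L2 N (\<lambda>\<omega>. fst (X \<omega>))"
  using measurable_compose[OF L2_D(1)[OF assms] borel_measurable_fst_snd(1)]
  by (intro L2_bound[OF assms]) (auto intro!: AE_I2 simp: norm_prod_def real_le_rsqrt)

lemma L2_snd: assumes "L2 N X" shows "L2 N (\<lambda>\<omega>. snd (X \<omega>))"
  using measurable_compose[OF L2_D(1)[OF assms] borel_measurable_fst_snd(2)]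
  by (intro L2_bound[OF assms]) (auto intro!: AE_I2 simp: norm_prod_def real_le_rsqrt)

lemma L2_swap: assumes "L2 N X" shows "L2 N (\<lambda>\<omega>. prod.swap (X \<omega>))"
  using L2_Pair[OF L2_snd[OF assms] L2_fst[OF assms]] by (simp add: prod.swap_def)

lemma L2_bounded:
  assumes "finite_measure N" "X \<in> borel_measurable N" "\<And>\<omega>. norm (X \<omega>) \<le> B"
  shows "L2 N X"
  unfolding L2_def
proof
  show "integrable N (\<lambda>\<omega>. (norm (X \<omega>))\<^sup>2)"
    by (rule finite_measure.integrable_const_bound[OF assms(1), of _ "B\<^sup>2"])
      (use assms in \<open>auto intro!: AE_I2 power_mono\<close>)
qed fact

lemma L2_integrable:
  assumes "finite_measure N" "L2 N X" shows "integrable N X"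
proof -
  interpret finite_measure N by fact
  have *: "x \<le> 1 + x\<^sup>2" for x :: real
    using zero_le_power2[of "x - 1/2"] by (simp add: power2_eq_square field_simps)
  have "integrable N (\<lambda>\<omega>. 1 + (norm (X \<omega>))\<^sup>2)"
    using assms by (intro Bochner_Integration.integrable_add integrable_const L2_D)
  then show ?thesis
    by (rule Bochner_Integration.integrable_bound) (use L2_D(1)[OF assms(2)] * in \<open>auto intro!: AE_I2\<close>)
qed

lemma L2_integrable_norm_mult:
  assumes "L2 N X" "L2 N Z" shows "integrable N (\<lambda>\<omega>. norm (X \<omega>) * norm (Z \<omega>))"
proof -
  note [measurable] = L2_D(1)[OF assms(1)] L2_D(1)[OF assms(2)]
  have *: "x * z \<le> x\<^sup>2 + z\<^sup>2" if "0 \<le> x" "0 \<le> z" for x z :: real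
    using zero_le_power2[of "x - z"] mult_nonneg_nonneg[OF that] by (simp add: power2_eq_square algebra_simps)
  have "integrable N (\<lambda>\<omega>. (norm (X \<omega>))\<^sup>2 + (norm (Z \<omega>))\<^sup>2)"
    using assms by (intro Bochner_Integration.integrable_add L2_D)
  then show ?thesis
    by (rule Bochner_Integration.integrable_bound) (use * in \<open>auto intro!: AE_I2\<close>)
qed

lemma L2_integrable_inner:
  assumes "L2 N X" "L2 N Z" shows "integrable N (\<lambda>\<omega>. X \<omega> \<bullet> Z \<omega>)"
  using L2_D(1)[OF assms(1)] L2_D(1)[OF assms(2)]
  by (intro Bochner_Integration.integrable_bound[OF L2_integrable_norm_mult[OF assms]])
    (auto intro!: AE_I2 Cauchy_Schwarz_ineq2)

lemma L2_integrable_S: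
  assumes "L2 N X" "L2 N Z" shows "integrable N (\<lambda>\<omega>. S (X \<omega>) (Z \<omega>))"
  unfolding S_eq_inner by (intro L2_integrable_inner L2_swap assms)

lemma borel_measurable_S [measurable]:
  assumes "f \<in> borel_measurable N" "g \<in> borel_measurable N"
  shows "(\<lambda>x. S (f x) (g x)) \<in> borel_measurable N"
proof -
  have [measurable]: "f \<in> N \<rightarrow>\<^sub>M borel \<Otimes>\<^sub>M borel" "g \<in> N \<rightarrow>\<^sub>M borel \<Otimes>\<^sub>M borel"
    using assms by (simp_all add: borel_prod)
  show ?thesis unfolding S_def by measurable
qed

text \<open>\<open>f (Q)\<close> is a square integrable version of the conditional expectation of \<open>Y\<close> given \<open>Q\<close>.\<close>

definition cond_mean ::
  "'a measure \<Rightarrow> ('a \<Rightarrow> 'c::euclidean_space) \<Rightarrow> ('a \<Rightarrow> 'b::euclidean_space) \<Rightarrow> ('c \<Rightarrow> 'b) \<Rightarrow> bool" where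
  "cond_mean N Q Y f \<longleftrightarrow> f \<in> borel_measurable borel \<and> L2 N (\<lambda>\<omega>. f (Q \<omega>)) \<and>
     (\<forall>A\<in>sets borel. (\<integral>\<omega>. indicator A (Q \<omega>) *\<^sub>R Y \<omega> \<partial>N) = (\<integral>\<omega>. indicator A (Q \<omega>) *\<^sub>R f (Q \<omega>) \<partial>N))"

lemma integrable_indicator_comp:
  fixes Y :: "'a \<Rightarrow> 'b::{banach, second_countable_topology}"
  assumes "integrable N Y" "Q \<in> borel_measurable N" "A \<in> sets borel"
  shows "integrable N (\<lambda>\<omega>. indicator A (Q \<omega>) *\<^sub>R Y \<omega>)"
proof (rule Bochner_Integration.integrable_bound[OF assms(1)])
  have [measurable]: "Y \<in> borel_measurable N" using assms(1) by auto
  note assms(2,3)[measurable]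
  show "(\<lambda>\<omega>. indicator A (Q \<omega>) *\<^sub>R Y \<omega>) \<in> borel_measurable N" by measurable
qed (auto intro!: AE_I2 simp: indicator_def)

lemma vimage_algebra_subalgebra:
  assumes "Q \<in> measurable N K" shows "subalgebra N (vimage_algebra (space N) Q K)"
  unfolding subalgebra_def using assms measurable_space[OF assms] by (auto simp: sets_vimage_algebra2 measurable_sets)

text \<open>Coordinatewise bridge to the real conditional expectation given the sigma-algebra of
  \<open>Q\<close>, from which uniqueness and the pull-out property are inherited.
  \<open>f (Q)\<close> is only assumed integrable because an equilibrium does not say more about its
  price.\<close>

lemma cond_mean_real_cond_exp:
  fixes Q :: "'a \<Rightarrow> 'c::euclidean_space" and Y :: "'a \<Rightarrow> 'b::euclidean_space"
  assumes N: "prob_space N" and Q: "Q \<in> borel_measurable N" and Y: "integrable N Y"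
    and fb: "f \<in> borel_measurable borel" and fi: "integrable N (\<lambda>\<omega>. f (Q \<omega>))"
    and f: "\<And>A. A \<in> sets borel \<Longrightarrow>
      (\<integral>\<omega>. indicator A (Q \<omega>) *\<^sub>R Y \<omega> \<partial>N) = (\<integral>\<omega>. indicator A (Q \<omega>) *\<^sub>R f (Q \<omega>) \<partial>N)"
  shows "AE \<omega> in N. real_cond_exp N (vimage_algebra (space N) Q borel) (\<lambda>\<omega>. Y \<omega> \<bullet> b) \<omega> = f (Q \<omega>) \<bullet> b"
proof -
  interpret prob_space N by fact
  let ?F = "vimage_algebra (space N) Q borel"
  interpret finite_measure_subalgebra N ?F
    by standard (rule vimage_algebra_subalgebra[OF Q])
  have QF: "Q \<in> measurable ?F borel" by (rule measurable_vimage_algebra1) simp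
  show ?thesis
  proof (rule real_cond_exp_charact)
    fix A assume "A \<in> sets ?F"
    then obtain B where B: "B \<in> sets borel" "A = Q -` B \<inter> space N"
      by (auto simp: sets_vimage_algebra2)
    have ind: "indicator A \<omega> *\<^sub>R (Z \<omega> \<bullet> b) = (indicator B (Q \<omega>) *\<^sub>R Z \<omega>) \<bullet> b" if "\<omega> \<in> space N" for \<omega> and Z :: "_ \<Rightarrow> 'b"
      using that B by (auto simp: indicator_def)
    have "(\<integral>\<omega>\<in>A. Y \<omega> \<bullet> b \<partial>N) = (\<integral>\<omega>. (indicator B (Q \<omega>) *\<^sub>R Y \<omega>) \<bullet> b \<partial>N)"
      unfolding set_lebesgue_integral_def by (intro Bochner_Integration.integral_cong refl ind)
    also have "\<dots> = (\<integral>\<omega>. indicator B (Q \<omega>) *\<^sub>R Y \<omega> \<partial>N) \<bullet> b"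
      using integrable_indicator_comp[OF Y Q B(1)] by (rule integral_inner_left)
    also have "\<dots> = (\<integral>\<omega>. indicator B (Q \<omega>) *\<^sub>R f (Q \<omega>) \<partial>N) \<bullet> b"
      using f[OF B(1)] by simp
    also have "\<dots> = (\<integral>\<omega>. (indicator B (Q \<omega>) *\<^sub>R f (Q \<omega>)) \<bullet> b \<partial>N)"
      using integrable_indicator_comp[OF fi Q B(1)] by (rule integral_inner_left[symmetric])
    also have "\<dots> = (\<integral>\<omega>\<in>A. f (Q \<omega>) \<bullet> b \<partial>N)"
      unfolding set_lebesgue_integral_def by (intro Bochner_Integration.integral_cong refl ind[symmetric])
    finally show "(\<integral>\<omega>\<in>A. Y \<omega> \<bullet> b \<partial>N) = (\<integral>\<omega>\<in>A. f (Q \<omega>) \<bullet> b \<partial>N)" .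
  next
    show "integrable N (\<lambda>\<omega>. Y \<omega> \<bullet> b)" "integrable N (\<lambda>\<omega>. f (Q \<omega>) \<bullet> b)" using Y fi by auto
    show "(\<lambda>\<omega>. f (Q \<omega>) \<bullet> b) \<in> borel_measurable ?F"
      using measurable_compose[OF QF fb] by measurable
  qed
qed

text \<open>Extends indicator tests to square integrable ones: each coordinate of
  \<open>h (Q)\<close> can be pulled out of a real conditional expectation, and the coordinates are
  summed.\<close>

lemma cond_mean_test:
  assumes N: "prob_space N" and Q: "Q \<in> borel_measurable N" and Y: "L2 N Y" and f: "cond_mean N Q Y f"
    and h: "h \<in> borel_measurable borel" and hL: "L2 N (\<lambda>\<omega>. h (Q \<omega>))"
  shows "(\<integral>\<omega>. h (Q \<omega>) \<bullet> Y \<omega> \<partial>N) = (\<integral>\<omega>. h (Q \<omega>) \<bullet> f (Q \<omega>) \<partial>N)"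
proof -
  interpret prob_space N by fact
  let ?F = "vimage_algebra (space N) Q borel"
  interpret finite_measure_subalgebra N ?F
    by standard (rule vimage_algebra_subalgebra[OF Q])
  have fb: "f \<in> borel_measurable borel" and fL: "L2 N (\<lambda>\<omega>. f (Q \<omega>))" using f unfolding cond_mean_def by auto
  have QF: "Q \<in> measurable ?F borel" by (rule measurable_vimage_algebra1) simp
  have comp: "L2 N (\<lambda>\<omega>. Z \<omega> \<bullet> b)" if "L2 N Z" "b \<in> Basis" for Z b
    using L2_D(1)[OF that(1)] that by (intro L2_bound[OF that(1)]) (auto simp: Basis_le_norm)
  have int: "integrable N (\<lambda>\<omega>. (h (Q \<omega>) \<bullet> b) * (Z \<omega> \<bullet> b))" if "L2 N Z" "b \<in> Basis" for Z b
    using L2_integrable_inner[OF comp[OF hL that(2)] comp[OF that]] by simp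
  have "(\<integral>\<omega>. (h (Q \<omega>) \<bullet> b) * (Y \<omega> \<bullet> b) \<partial>N) = (\<integral>\<omega>. (h (Q \<omega>) \<bullet> b) * (f (Q \<omega>) \<bullet> b) \<partial>N)" if b: "b \<in> Basis" for b
  proof -
    have hF: "(\<lambda>\<omega>. h (Q \<omega>) \<bullet> b) \<in> borel_measurable ?F"
      using measurable_compose[OF QF h] by measurable
    have [measurable]: "(\<lambda>\<omega>. Y \<omega> \<bullet> b) \<in> borel_measurable N" "(\<lambda>\<omega>. h (Q \<omega>) \<bullet> b) \<in> borel_measurable N"
      "(\<lambda>\<omega>. f (Q \<omega>) \<bullet> b) \<in> borel_measurable N"
      using comp[OF Y b, THEN L2_D(1)] comp[OF hL b, THEN L2_D(1)] comp[OF fL b, THEN L2_D(1)] by auto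
    have "(\<integral>\<omega>. (h (Q \<omega>) \<bullet> b) * (Y \<omega> \<bullet> b) \<partial>N)
        = (\<integral>\<omega>. (h (Q \<omega>) \<bullet> b) * real_cond_exp N ?F (\<lambda>\<omega>. Y \<omega> \<bullet> b) \<omega> \<partial>N)"
      using int[OF Y b] hF by (intro real_cond_exp_intg(2)[symmetric]) auto
    also have "\<dots> = (\<integral>\<omega>. (h (Q \<omega>) \<bullet> b) * (f (Q \<omega>) \<bullet> b) \<partial>N)"
      using cond_mean_real_cond_exp[OF N Q L2_integrable[OF finite_measure_axioms Y] fb L2_integrable[OF finite_measure_axioms fL], of b] f
      by (intro integral_cong_AE) (auto simp: cond_mean_def)
    finally show ?thesis .
  qed
  moreover have "(\<integral>\<omega>. h (Q \<omega>) \<bullet> Z \<omega> \<partial>N) = (\<Sum>b\<in>Basis. \<integral>\<omega>. (h (Q \<omega>) \<bullet> b) * (Z \<omega> \<bullet> b) \<partial>N)" if "L2 N Z" for Z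
  proof -
    have "(\<integral>\<omega>. h (Q \<omega>) \<bullet> Z \<omega> \<partial>N) = (\<integral>\<omega>. (\<Sum>b\<in>Basis. (h (Q \<omega>) \<bullet> b) * (Z \<omega> \<bullet> b)) \<partial>N)"
      by (rule Bochner_Integration.integral_cong[OF refl euclidean_inner])
    also have "\<dots> = (\<Sum>b\<in>Basis. \<integral>\<omega>. (h (Q \<omega>) \<bullet> b) * (Z \<omega> \<bullet> b) \<partial>N)"
      by (rule Bochner_Integration.integral_sum) (rule int[OF that])
    finally show ?thesis .
  qed
  ultimately show ?thesis using Y fL by simp
qed

text \<open>Used for an equilibrium, where \<open>f (R)\<close> is an integrable version of the
  conditional expectation; agreement with a square integrable version makes it available as a test
  function.\<close>

lemma cond_mean_integrable_version:
  fixes Q :: "'a \<Rightarrow> 'c::euclidean_space" and Y :: "'a \<Rightarrow> 'b::euclidean_space"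
  assumes N: "prob_space N" and Q: "Q \<in> borel_measurable N" and Y: "L2 N Y"
    and gb: "g \<in> borel_measurable borel" and gi: "integrable N (\<lambda>\<omega>. g (Q \<omega>))"
    and g: "\<And>A. A \<in> sets borel \<Longrightarrow>
      (\<integral>\<omega>. indicator A (Q \<omega>) *\<^sub>R Y \<omega> \<partial>N) = (\<integral>\<omega>. indicator A (Q \<omega>) *\<^sub>R g (Q \<omega>) \<partial>N)"
    and f: "cond_mean N Q Y f"
  shows "AE \<omega> in N. g (Q \<omega>) = f (Q \<omega>)"
proof -
  interpret prob_space N by fact
  have Yi: "integrable N Y" by (rule L2_integrable[OF finite_measure_axioms Y])
  have f': "f \<in> borel_measurable borel" "integrable N (\<lambda>\<omega>. f (Q \<omega>))"
    using f L2_integrable[OF finite_measure_axioms] by (auto simp: cond_mean_def)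
  have "AE \<omega> in N. \<forall>b\<in>Basis. g (Q \<omega>) \<bullet> b = f (Q \<omega>) \<bullet> b"
    unfolding AE_ball_countable[OF countable_finite[OF finite_Basis]]
  proof
    fix b :: 'b
    have "AE \<omega> in N. real_cond_exp N (vimage_algebra (space N) Q borel) (\<lambda>\<omega>. Y \<omega> \<bullet> b) \<omega> = f (Q \<omega>) \<bullet> b"
      by (rule cond_mean_real_cond_exp[OF N Q Yi f']) (use f in \<open>auto simp: cond_mean_def\<close>)
    then show "AE \<omega> in N. g (Q \<omega>) \<bullet> b = f (Q \<omega>) \<bullet> b"
      using cond_mean_real_cond_exp[OF N Q Yi gb gi g, of b] by auto
  qed
  then show ?thesis by (rule eventually_mono) (rule euclidean_eqI, auto)
qed

text \<open>The difficulty is to obtain a function of the value of \<open>Q\<close>, defined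
  everywhere. Under the law of \<open>(Q, Z)\<close> on the product space the conditioning variable
  becomes the projection \<open>fst\<close>, which is onto, so nothing has to be extended from the
  range of \<open>Q\<close>.\<close>

lemma cond_mean_real_exists:
  fixes Q :: "'a \<Rightarrow> 'c::euclidean_space" and Z :: "'a \<Rightarrow> real"
  assumes N: "prob_space N" and Q: "Q \<in> borel_measurable N" and Z: "L2 N Z"
  obtains f where "cond_mean N Q Z f"
proof -
  interpret N: prob_space N by fact
  note [measurable] = Q L2_D(1)[OF Z]
  define P where "P = distr N borel (\<lambda>\<omega>. (Q \<omega>, Z \<omega>))"
  have PM: "(\<lambda>\<omega>. (Q \<omega>, Z \<omega>)) \<in> measurable N borel" by measurable
  have [measurable_cong, simp]: "sets P = sets borel" by (simp add: P_def)
  have spP [simp]: "space P = UNIV" by (simp add: P_def)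
  interpret P: prob_space P unfolding P_def using PM by (rule N.prob_space_distr)
  let ?F = "vimage_algebra (space P) (fst :: 'c \<times> real \<Rightarrow> 'c) borel"
  have fstP: "fst \<in> borel_measurable P" by (simp cong: measurable_cong_sets)
  interpret finite_measure_subalgebra P ?F
    by standard (rule vimage_algebra_subalgebra[OF fstP])
  define t where "t = real_cond_exp P ?F snd"
  have tF: "t \<in> borel_measurable ?F" unfolding t_def by (rule borel_measurable_cond_exp)
  have tP: "t \<in> borel_measurable borel" using measurable_from_subalg[OF subalg tF] by simp
  have sndL: "integrable P (\<lambda>p. (snd p)\<^sup>2)"
    unfolding P_def using L2_D(2)[OF Z] PM by (subst integrable_distr_eq) auto
  have sndi: "integrable P snd"
    using L2_integrable[OF P.finite_measure_axioms, of snd] sndL unfolding L2_def by auto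
  define f where "f = (\<lambda>q. t (q, 0))"
  \<comment> \<open>Level sets of a function measurable for the sigma-algebra of \<open>fst\<close>
    are cylinders, so \<open>t\<close> is constant on fibres; the base point 0 is arbitrary.\<close>
  have ft: "t (q, z) = f q" for q z
  proof -
    have "t -` {t (q, z)} \<inter> space ?F \<in> sets ?F" using tF by (rule measurable_sets) simp
    then obtain B where "t -` {t (q, z)} = fst -` B" by (auto simp: sets_vimage_algebra2)
    then have "(q, 0) \<in> t -` {t (q, z)}" by (metis fst_conv vimage_eq singletonI)
    then show ?thesis by (simp add: f_def)
  qed
  have fb: "f \<in> borel_measurable borel"
    unfolding f_def by (rule measurable_compose[OF _ tP]) measurable
  \<comment> \<open>Conditional Jensen for the square keeps the conditional expectation square
    integrable.\<close>
  have "integrable P (\<lambda>p. (t p)\<^sup>2)"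
    unfolding t_def
    by (rule integrable_convex_cond_exp[of snd UNIV 0 0 "\<lambda>x. x\<^sup>2"])
      (use sndi sndL in \<open>auto intro!: convex_power_even\<close>)
  then have fL: "L2 N (\<lambda>\<omega>. f (Q \<omega>))"
    unfolding P_def L2_def using PM tP fb by (subst (asm) integrable_distr_eq) (auto simp: ft)
  have "(\<integral>\<omega>. indicator A (Q \<omega>) *\<^sub>R Z \<omega> \<partial>N) = (\<integral>\<omega>. indicator A (Q \<omega>) *\<^sub>R f (Q \<omega>) \<partial>N)"
    if A [measurable]: "A \<in> sets borel" for A
  proof -
    have AF: "fst -` A \<inter> space P \<in> sets ?F" using A by (auto simp: sets_vimage_algebra2)
    have IA: "(\<lambda>p. indicator A (fst p) :: real) \<in> borel_measurable (borel :: ('c \<times> real) measure)"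
      by (rule measurable_compose[OF borel_measurable_fst_snd(1) borel_measurable_indicator[OF A]])
    have ind: "(indicator (fst -` A \<inter> space P) p :: real) = indicator A (fst p)" for p
      by (simp add: indicator_def)
    have "(\<integral>\<omega>. indicator A (Q \<omega>) *\<^sub>R Z \<omega> \<partial>N) = (\<integral>p. indicator A (fst p) *\<^sub>R snd p \<partial>P)"
      unfolding P_def by (subst integral_distr[OF PM]) (auto intro!: borel_measurable_scaleR IA borel_measurable_fst_snd)
    also have "\<dots> = (\<integral>p. indicator A (fst p) *\<^sub>R t p \<partial>P)"
      using real_cond_exp_intA[OF sndi AF] unfolding set_lebesgue_integral_def t_def ind by simp
    also have "\<dots> = (\<integral>\<omega>. indicator A (Q \<omega>) *\<^sub>R f (Q \<omega>) \<partial>N)"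
      unfolding P_def by (subst integral_distr[OF PM]) (auto intro!: borel_measurable_times IA tP simp: ft)
    finally show ?thesis .
  qed
  then show ?thesis using that[of f] fb fL unfolding cond_mean_def by auto
qed

lemma cond_mean_exists:
  fixes Q :: "'a \<Rightarrow> 'c::euclidean_space" and Y :: "'a \<Rightarrow> 'b::euclidean_space"
  assumes N: "prob_space N" and Q: "Q \<in> borel_measurable N" and Y: "L2 N Y"
  obtains f where "cond_mean N Q Y f"
proof -
  interpret N: prob_space N by fact
  have Yb: "L2 N (\<lambda>\<omega>. Y \<omega> \<bullet> b)" if "b \<in> Basis" for b
    using L2_D(1)[OF Y] that by (intro L2_bound[OF Y]) (auto simp: Basis_le_norm)
  have "\<exists>g. \<forall>b\<in>Basis. cond_mean N Q (\<lambda>\<omega>. Y \<omega> \<bullet> b) (g b)"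
    by (rule bchoice) (use cond_mean_real_exists[OF N Q Yb] in metis)
  then obtain g where g: "\<And>b. b \<in> Basis \<Longrightarrow> cond_mean N Q (\<lambda>\<omega>. Y \<omega> \<bullet> b) (g b)" by blast
  have gb: "g b \<in> borel_measurable borel" if "b \<in> Basis" for b using g[OF that] unfolding cond_mean_def by auto
  have gL: "L2 N (\<lambda>\<omega>. g b (Q \<omega>))" if "b \<in> Basis" for b using g[OF that] unfolding cond_mean_def by auto
  define f where "f = (\<lambda>q. \<Sum>b\<in>Basis. g b q *\<^sub>R b)"
  have fcomp: "f q \<bullet> b = g b q" if "b \<in> Basis" for q b
    using that by (simp add: f_def inner_sum_left inner_Basis if_distrib cong: if_cong)
  have fb: "f \<in> borel_measurable borel" unfolding f_def using gb by (intro borel_measurable_sum) auto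
  have "(norm (f q))\<^sup>2 = (\<Sum>b\<in>Basis. (g b q)\<^sup>2)" for q
    unfolding power2_norm_eq_inner by (subst euclidean_inner) (simp add: fcomp power2_eq_square)
  then have fL: "L2 N (\<lambda>\<omega>. f (Q \<omega>))"
    unfolding L2_def using L2_D(2)[OF gL] measurable_compose[OF Q fb] by auto
  have Yi: "integrable N Y" by (rule L2_integrable[OF _ Y]) unfold_locales
  have fi: "integrable N (\<lambda>\<omega>. f (Q \<omega>))" by (rule L2_integrable[OF _ fL]) unfold_locales
  have "(\<integral>\<omega>. indicator A (Q \<omega>) *\<^sub>R Y \<omega> \<partial>N) = (\<integral>\<omega>. indicator A (Q \<omega>) *\<^sub>R f (Q \<omega>) \<partial>N)"
    if A: "A \<in> sets borel" for A
  proof (rule euclidean_eqI)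
    fix b :: 'b assume b: "b \<in> Basis"
    have "(\<integral>\<omega>. indicator A (Q \<omega>) *\<^sub>R Y \<omega> \<partial>N) \<bullet> b = (\<integral>\<omega>. indicator A (Q \<omega>) *\<^sub>R (Y \<omega> \<bullet> b) \<partial>N)"
      using integral_inner_left[OF integrable_indicator_comp[OF Yi Q A], of b] by simp
    also have "\<dots> = (\<integral>\<omega>. indicator A (Q \<omega>) *\<^sub>R (f (Q \<omega>) \<bullet> b) \<partial>N)"
      using g[OF b] A unfolding cond_mean_def fcomp[OF b] by auto
    also have "\<dots> = (\<integral>\<omega>. indicator A (Q \<omega>) *\<^sub>R f (Q \<omega>) \<partial>N) \<bullet> b"
      using integral_inner_left[OF integrable_indicator_comp[OF fi Q A], of b] by simp
    finally show "(\<integral>\<omega>. indicator A (Q \<omega>) *\<^sub>R Y \<omega> \<partial>N) \<bullet> b = (\<integral>\<omega>. indicator A (Q \<omega>) *\<^sub>R f (Q \<omega>) \<partial>N) \<bullet> b" .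
  qed
  then show ?thesis using that[of f] fb fL unfolding cond_mean_def by auto
qed

lemma cond_mean_cong_AE:
  assumes f: "cond_mean N Q Y f" and g: "g \<in> borel_measurable borel" and Q: "Q \<in> borel_measurable N"
    and eq: "AE \<omega> in N. g (Q \<omega>) = f (Q \<omega>)"
  shows "cond_mean N Q Y g"
proof -
  have fb: "f \<in> borel_measurable borel" and fL: "L2 N (\<lambda>\<omega>. f (Q \<omega>))" using f by (auto simp: cond_mean_def)
  have m: "(\<lambda>\<omega>. g (Q \<omega>)) \<in> borel_measurable N" "(\<lambda>\<omega>. f (Q \<omega>)) \<in> borel_measurable N"
    using measurable_compose[OF Q g] measurable_compose[OF Q fb] by auto
  have "(\<integral>\<omega>. indicator A (Q \<omega>) *\<^sub>R g (Q \<omega>) \<partial>N) = (\<integral>\<omega>. indicator A (Q \<omega>) *\<^sub>R f (Q \<omega>) \<partial>N)"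
    if "A \<in> sets borel" for A
    by (rule integral_cong_AE)
      (use eq m measurable_compose[OF Q borel_measurable_indicator[OF that]] in \<open>auto intro!: borel_measurable_scaleR\<close>)
  then show ?thesis
    using f g L2_cong_AE[OF fL m(1) eq] unfolding cond_mean_def by auto
qed

lemma cond_mean_Pair:
  fixes Q :: "'a \<Rightarrow> 'e::euclidean_space" and U :: "'a \<Rightarrow> 'c::euclidean_space" and V :: "'a \<Rightarrow> 'd::euclidean_space"
  assumes N: "finite_measure N" and Q: "Q \<in> borel_measurable N" and U: "integrable N U" and V: "integrable N V"
    and f: "cond_mean N Q U f" and g: "cond_mean N Q V g"
  shows "cond_mean N Q (\<lambda>\<omega>. (U \<omega>, V \<omega>)) (\<lambda>q. (f q, g q))"
proof -
  have fi: "integrable N (\<lambda>\<omega>. f (Q \<omega>))" and gi: "integrable N (\<lambda>\<omega>. g (Q \<omega>))"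
    using f g L2_integrable[OF N] by (auto simp: cond_mean_def)
  have pair: "(\<integral>\<omega>. indicator A (Q \<omega>) *\<^sub>R (u \<omega>, v \<omega>) \<partial>N)
      = (\<integral>\<omega>. indicator A (Q \<omega>) *\<^sub>R u \<omega> \<partial>N, \<integral>\<omega>. indicator A (Q \<omega>) *\<^sub>R v \<omega> \<partial>N)"
    if "integrable N u" "integrable N v" "A \<in> sets borel" for A and u :: "_ \<Rightarrow> 'c" and v :: "_ \<Rightarrow> 'd"
  proof -
    have "integrable N (\<lambda>\<omega>. (u \<omega>, 0 :: 'd) + (0 :: 'c, v \<omega>))"
      using integrable_bounded_linear[OF bounded_linear_Pair[OF bounded_linear_ident bounded_linear_zero] that(1)]
        integrable_bounded_linear[OF bounded_linear_Pair[OF bounded_linear_zero bounded_linear_ident] that(2)]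
      by (rule Bochner_Integration.integrable_add)
    then have "integrable N (\<lambda>\<omega>. (u \<omega>, v \<omega>))" by simp
    from integrable_indicator_comp[OF this Q that(3)]
    have "integrable N (\<lambda>\<omega>. indicator A (Q \<omega>) *\<^sub>R (u \<omega>, v \<omega>))" .
    from integral_bounded_linear[OF bounded_linear_fst this] integral_bounded_linear[OF bounded_linear_snd this]
    show ?thesis by (simp add: prod_eq_iff)
  qed
  show ?thesis
    unfolding cond_mean_def
  proof (intro conjI ballI)
    show "(\<lambda>q. (f q, g q)) \<in> borel_measurable borel"
      using f g unfolding cond_mean_def by (intro borel_measurable_Pair) auto
    show "L2 N (\<lambda>\<omega>. (f (Q \<omega>), g (Q \<omega>)))" using f g unfolding cond_mean_def by (intro L2_Pair) auto
    show "(\<integral>\<omega>. indicator A (Q \<omega>) *\<^sub>R (U \<omega>, V \<omega>) \<partial>N) = (\<integral>\<omega>. indicator A (Q \<omega>) *\<^sub>R (f (Q \<omega>), g (Q \<omega>)) \<partial>N)"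
      if "A \<in> sets borel" for A
      unfolding pair[OF U V that] pair[OF fi gi that] using f g that by (simp add: cond_mean_def)
  qed
qed

section \<open>Fitzpatrick functions and weak duality\<close>

text \<open>No integrability is involved: the positive part grows, the negative part shrinks, and
  subtraction in \<open>ereal\<close> is monotone.\<close>

lemma ext_integral_mono_AE:
  assumes "AE x in M. f x \<le> g x" shows "ext_integral M f \<le> ext_integral M g"
proof -
  have "(\<integral>\<^sup>+x. e2ennreal (f x) \<partial>M) \<le> (\<integral>\<^sup>+x. e2ennreal (g x) \<partial>M)"
    using assms by (intro nn_integral_mono_AE) (auto elim!: eventually_mono intro: e2ennreal_mono)
  moreover have "(\<integral>\<^sup>+x. e2ennreal (- g x) \<partial>M) \<le> (\<integral>\<^sup>+x. e2ennreal (- f x) \<partial>M)"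
    using assms by (intro nn_integral_mono_AE) (auto elim!: eventually_mono intro!: e2ennreal_mono)
  ultimately show ?thesis
    unfolding ext_integral_def by (intro ereal_minus_mono) (simp_all add: less_eq_ennreal.rep_eq)
qed

lemma ext_integral_real:
  assumes "integrable M h" shows "ext_integral M (\<lambda>x. ereal (h x)) = ereal (\<integral>x. h x \<partial>M)"
proof -
  have "(\<integral>\<^sup>+x. ennreal (h x) \<partial>M) \<noteq> \<infinity>" "(\<integral>\<^sup>+x. ennreal (- h x) \<partial>M) \<noteq> \<infinity>"
    using assms by (auto simp: real_integrable_def)
  then show ?thesis
    unfolding ext_integral_def real_lebesgue_integral_def[OF assms]
    by (cases "\<integral>\<^sup>+x. ennreal (h x) \<partial>M"; cases "\<integral>\<^sup>+x. ennreal (- h x) \<partial>M")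
      (auto simp: e2ennreal_ereal enn2ereal_ennreal)
qed

lemma ext_integral_distr:
  assumes "T \<in> measurable M N" "f \<in> borel_measurable N"
  shows "ext_integral (distr M N T) f = ext_integral M (\<lambda>x. f (T x))"
  unfolding ext_integral_def using assms by (simp add: nn_integral_distr)

text \<open>Truncating at \<open>h + 1\<close> keeps the comparison within integrable real functions.\<close>

lemma ext_integral_le_imp_AE_eq:
  assumes h: "integrable M h" and f: "f \<in> borel_measurable M" and le: "AE x in M. ereal (h x) \<le> f x"
    and int: "ext_integral M f \<le> ereal (\<integral>x. h x \<partial>M)" and M: "finite_measure M"
  shows "AE x in M. f x = ereal (h x)"
proof -
  interpret finite_measure M by fact
  note [measurable] = f
  have [measurable]: "h \<in> borel_measurable M" using h by auto
  define k where "k = (\<lambda>x. real_of_ereal (min (f x) (ereal (h x + 1))))"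
  have k: "AE x in M. ereal (k x) = min (f x) (ereal (h x + 1))"
    using le
  proof eventually_elim
    case (elim x)
    then show ?case unfolding k_def by (cases "f x") (auto simp: min_def)
  qed
  have kb: "AE x in M. h x \<le> k x \<and> k x \<le> h x + 1"
    using k le
  proof eventually_elim
    case (elim x)
    then have "ereal (h x) \<le> ereal (k x)" "ereal (k x) \<le> ereal (h x + 1)" by (auto simp: min_def)
    then show ?case by simp
  qed
  have km [measurable]: "k \<in> borel_measurable M" unfolding k_def by measurable
  have ki: "integrable M k"
  proof (rule Bochner_Integration.integrable_bound)
    show "integrable M (\<lambda>x. \<bar>h x\<bar> + 1)" using h by auto
    show "AE x in M. norm (k x) \<le> norm (\<bar>h x\<bar> + 1)" using kb by eventually_elim auto
  qed fact
  have "ext_integral M (\<lambda>x. ereal (k x)) \<le> ext_integral M f"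
    by (rule ext_integral_mono_AE) (use k in \<open>eventually_elim, simp\<close>)
  then have "(\<integral>x. k x \<partial>M) \<le> (\<integral>x. h x \<partial>M)"
    using int unfolding ext_integral_real[OF ki] by (metis order_trans ereal_less_eq(3))
  then have "(\<integral>x. k x - h x \<partial>M) \<le> 0" using ki h by simp
  moreover have "0 \<le> (\<integral>x. k x - h x \<partial>M)" by (rule integral_nonneg_AE) (use kb in auto)
  ultimately have "(\<integral>x. k x - h x \<partial>M) = 0" by simp
  then have "AE x in M. k x - h x = 0"
    by (subst (asm) integral_nonneg_eq_0_iff_AE) (use ki h kb in auto)
  with k show ?thesis
  proof eventually_elim
    case (elim x)
    then show ?case by (cases "f x") (auto simp: min_def split: if_splits)
  qed
qed

section \<open>The Fitzpatrick function: measurability and contact set\<close>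

lemma dense_sequence:
  fixes G :: "'a::{metric_space, second_countable_topology} set"
  assumes "G \<noteq> {}"
  obtains z :: "nat \<Rightarrow> 'a" where "range z \<subseteq> G" "G \<subseteq> closure (range z)"
proof -
  obtain T where T: "countable T" "T \<subseteq> G" "G \<subseteq> closure T" using separable by metis
  have "T \<noteq> {}" using T assms by auto
  then show ?thesis using that[of "from_nat_into T"] T by (simp add: range_from_nat_into)
qed

text \<open>For fixed \<open>y\<close> the tangent value is continuous in \<open>x\<close>. A
  countable supremum is measurable and costs only countably many null sets.\<close>

lemma psi_eq_SUP_sequence:
  fixes z :: "nat \<Rightarrow> _"
  assumes "range z \<subseteq> G" "G \<subseteq> closure (range z)"
  shows "psi G y = (SUP n. ereal (S (z n) y - S (z n) (z n) / 2))" (is "_ = ?B")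
proof (rule antisym)
  have le: "ereal (S (z n) y - S (z n) (z n) / 2) \<le> ?B" for n by (rule SUP_upper) simp
  show "psi G y \<le> ?B"
    unfolding psi_def
  proof (rule SUP_least)
    fix x assume "x \<in> G"
    then have x: "x \<in> closure (range z)" using assms by auto
    show "ereal (S x y - S x x / 2) \<le> ?B"
    proof (cases ?B)
      case (real b)
      have "closure (range z) \<subseteq> {x. S x y - S x x / 2 \<le> b}"
        by (intro closure_minimal closed_Collect_le continuous_intros) (use le[unfolded real] in auto)
      then show ?thesis using x real by auto
    qed (use le[of 0] in auto)
  qed
  show "?B \<le> psi G y"
    unfolding psi_def using assms(1) by (intro SUP_mono) auto
qed

lemma borel_measurable_psi [measurable]: "psi G \<in> borel_measurable borel"
proof (cases "G = {}")
  case True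
  then have "psi G = (\<lambda>y. bot)" by (auto simp: psi_def)
  then show ?thesis by simp
next
  case False
  then obtain z :: "nat \<Rightarrow> _" where z: "range z \<subseteq> G" "G \<subseteq> closure (range z)" by (rule dense_sequence)
  show ?thesis unfolding psi_eq_SUP_sequence[OF z, abs_def] by measurable
qed

lemma psi_upper: "x \<in> G \<Longrightarrow> ereal (S x y - S x x / 2) \<le> psi G y"
  unfolding psi_def by (rule SUP_upper)

text \<open>\<open>x\<close> and \<open>g\<close> are monotonically related exactly when the tangent
  of \<open>q\<close> at \<open>g\<close> stays below \<open>q\<close> at \<open>x\<close>; the
  hypothesis says this for all \<open>g\<close> in \<open>G\<close> at once. Together with
  \<open>psi_ge\<close>, \<open>G\<close> is the set where \<open>psi G\<close> touches
  \<open>q\<close>.\<close>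

lemma psi_le_imp_mem:
  assumes "maximal_S_monotone G" "psi G x \<le> ereal (S x x / 2)" shows "x \<in> G"
proof (subst maximal_S_monotone_iff_mem[OF assms(1)], intro ballI)
  fix g assume "g \<in> G"
  then have "ereal (S g x - S g g / 2) \<le> ereal (S x x / 2)"
    using psi_upper assms(2) order_trans by blast
  then show "0 \<le> S (x - g) (x - g)" by (simp add: S_self_diff S_commute[of x g])
qed

lemma psi_ge: "maximal_S_monotone G \<Longrightarrow> ereal (S x x / 2) \<le> psi G x"
  using psi_le_imp_mem[of G x] psi_upper[of x G x] by fastforce

text \<open>One notion for three situations, so that duality is proved once: a map on the given
  space, a plan viewed as the coordinates \<open>fst\<close>, \<open>snd\<close> on itself, and the
  competitor on the marked space.\<close>

definition martingale_pair ::
  "'a measure \<Rightarrow> ('a \<Rightarrow> 'b::euclidean_space) \<Rightarrow> ('a \<Rightarrow> 'b) \<Rightarrow> bool" where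
  "martingale_pair N X Y \<longleftrightarrow> prob_space N \<and> L2 N X \<and> L2 N Y \<and> cond_mean N X Y (\<lambda>x. x)"

lemma martingale_pair_test:
  assumes m: "martingale_pair N X Y" and h: "h \<in> borel_measurable borel" "L2 N (\<lambda>\<omega>. h (X \<omega>))"
  shows "(\<integral>\<omega>. S (h (X \<omega>)) (Y \<omega>) \<partial>N) = (\<integral>\<omega>. S (h (X \<omega>)) (X \<omega>) \<partial>N)"
  unfolding S_eq_inner
proof (rule cond_mean_test[where h = "\<lambda>x. prod.swap (h x)"])
  show "(\<lambda>x. prod.swap (h x)) \<in> borel_measurable borel"
    by (intro measurable_compose[OF h(1)] borel_measurable_continuous_onI) (auto simp: prod.swap_def intro!: continuous_intros)
  show "L2 N (\<lambda>\<omega>. prod.swap (h (X \<omega>)))" by (rule L2_swap[OF h(2)])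
qed (use m in \<open>auto simp: martingale_pair_def L2_def\<close>)

lemma martingale_pair_value:
  assumes "martingale_pair N X Y"
  shows "(\<integral>\<omega>. S (X \<omega>) (Y \<omega>) \<partial>N) = (\<integral>\<omega>. S (X \<omega>) (X \<omega>) \<partial>N)"
  by (rule martingale_pair_test[OF assms, of "\<lambda>x. x"]) (use assms in \<open>auto simp: martingale_pair_def\<close>)

text \<open>A maximiser of the tangent values at \<open>x\<close> among the first
  \<open>k + 1\<close> points of the sequence. It is Borel in \<open>x\<close> with finitely many
  values, hence an admissible bounded test in the martingale property.\<close>

primrec best_among :: "(nat \<Rightarrow> 'm::finite pt) \<Rightarrow> nat \<Rightarrow> 'm pt \<Rightarrow> 'm pt" where
  "best_among z 0 = (\<lambda>x. z 0)"
| "best_among z (Suc k) = (\<lambda>x.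
     if S (best_among z k x) x - S (best_among z k x) (best_among z k x) / 2
          < S (z (Suc k)) x - S (z (Suc k)) (z (Suc k)) / 2
     then z (Suc k) else best_among z k x)"

lemma borel_measurable_best_among [measurable]: "best_among z k \<in> borel_measurable borel"
  by (induction k) simp_all

lemma best_among_mem: "best_among z k x \<in> range z"
  by (induction k) simp_all

lemma norm_best_among_le: "norm (best_among z k x) \<le> (\<Sum>n\<le>k. norm (z n))"
  by (induction k) (auto intro: add_increasing2 add_increasing sum_nonneg)

lemma best_among_mono:
  "incseq (\<lambda>k. S (best_among z k x) x - S (best_among z k x) (best_among z k x) / 2)"
  by (rule incseq_SucI) simp

lemma best_among_ge:
  "S (z k) x - S (z k) (z k) / 2 \<le> S (best_among z k x) x - S (best_among z k x) (best_among z k x) / 2"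
  by (cases k) simp_all

lemma best_among_tendsto_psi:
  assumes z: "range z \<subseteq> G" "G \<subseteq> closure (range z)"
  shows "(\<lambda>k. ereal (S (best_among z k x) x - S (best_among z k x) (best_among z k x) / 2)) \<longlonglongrightarrow> psi G x"
proof -
  let ?\<phi> = "\<lambda>k. S (best_among z k x) x - S (best_among z k x) (best_among z k x) / 2"
  have "(SUP k. ereal (?\<phi> k)) = psi G x"
  proof (rule antisym)
    show "(SUP k. ereal (?\<phi> k)) \<le> psi G x"
      by (rule SUP_least, rule psi_upper) (use best_among_mem z in blast)
    show "psi G x \<le> (SUP k. ereal (?\<phi> k))"
      unfolding psi_eq_SUP_sequence[OF z] by (rule SUP_mono) (use best_among_ge[of z _ x] in auto)
  qed
  moreover have "incseq (\<lambda>k. ereal (?\<phi> k))"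
    using best_among_mono[of z x] unfolding mono_def by simp
  ultimately show ?thesis using LIMSEQ_SUP[of "\<lambda>k. ereal (?\<phi> k)"] by simp
qed

text \<open>The cap \<open>q + 1\<close> yields real values while preserving both the bound
  \<open>psi G \<ge> q\<close> and the set where equality holds.\<close>

definition psi_trunc :: "'m::finite pt set \<Rightarrow> 'm pt \<Rightarrow> real" where
  "psi_trunc G x = real_of_ereal (min (psi G x) (ereal (S x x / 2 + 1)))"

lemma borel_measurable_psi_trunc [measurable]: "psi_trunc G \<in> borel_measurable borel"
  unfolding psi_trunc_def by measurable

lemma psi_trunc_ge:
  assumes "maximal_S_monotone G" shows "S x x / 2 \<le> psi_trunc G x"
  unfolding psi_trunc_def using psi_ge[OF assms, of x] by (cases "psi G x") (auto simp: min_def)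

text \<open>Jensen's inequality for \<open>psi G\<close> by hand. With
  \<open>Z = best_among z k (X)\<close>, the mean of \<open>S Z Y - q Z\<close> is at most
  \<open>v\<close> and, by the martingale property, equals the mean of \<open>S Z X - q Z\<close>,
  whose integrand increases to \<open>psi G X\<close>.\<close>

lemma weak_duality_aux:
  assumes m: "martingale_pair N X Y" and G: "maximal_S_monotone G"
    and v: "ext_integral N (\<lambda>\<omega>. psi G (Y \<omega>)) \<le> ereal v"
  shows "integrable N (\<lambda>\<omega>. psi_trunc G (X \<omega>))"
    and "(\<integral>\<omega>. psi_trunc G (X \<omega>) \<partial>N) \<le> v"
proof -
  let ?L = "\<lambda>\<omega>. psi_trunc G (X \<omega>)"
  have X: "L2 N X" and Y: "L2 N Y" using m by (auto simp: martingale_pair_def)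
  interpret prob_space N using m by (auto simp: martingale_pair_def)
  note [measurable] = L2_D(1)[OF X] L2_D(1)[OF Y]
  obtain z :: "nat \<Rightarrow> _" where z: "range z \<subseteq> G" "G \<subseteq> closure (range z)"
    by (rule dense_sequence[OF maximal_S_monotone_nonempty[OF G]])
  let ?Z = "\<lambda>k \<omega>. best_among z k (X \<omega>)"
  define \<phi> where "\<phi> = (\<lambda>k \<omega>. S (?Z k \<omega>) (X \<omega>) - S (?Z k \<omega>) (?Z k \<omega>) / 2)"
  have ZL: "L2 N (?Z k)" for k
    by (rule L2_bounded[OF finite_measure_axioms _ norm_best_among_le]) measurable
  have \<phi>i: "integrable N (\<phi> k)" for k
    unfolding \<phi>_def by (intro Bochner_Integration.integrable_diff integrable_divide L2_integrable_S X ZL)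
  have \<phi>v: "(\<integral>\<omega>. \<phi> k \<omega> \<partial>N) \<le> v" for k
  proof -
    let ?h = "\<lambda>\<omega>. S (?Z k \<omega>) (Y \<omega>) - S (?Z k \<omega>) (?Z k \<omega>) / 2"
    have hi: "integrable N ?h"
      by (intro Bochner_Integration.integrable_diff integrable_divide L2_integrable_S Y ZL)
    have "ext_integral N (\<lambda>\<omega>. ereal (?h \<omega>)) \<le> ext_integral N (\<lambda>\<omega>. psi G (Y \<omega>))"
      by (intro ext_integral_mono_AE AE_I2 psi_upper) (use best_among_mem z in blast)
    from order_trans[OF this v] have "(\<integral>\<omega>. ?h \<omega> \<partial>N) \<le> v"
      unfolding ext_integral_real[OF hi] by simp
    moreover have "(\<integral>\<omega>. ?h \<omega> \<partial>N) = (\<integral>\<omega>. \<phi> k \<omega> \<partial>N)"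
      unfolding \<phi>_def
      using martingale_pair_test[OF m borel_measurable_best_among ZL, of k]
      by (simp add: L2_integrable_S X Y ZL)
    ultimately show ?thesis by simp
  qed
  let ?h = "\<lambda>k \<omega>. min (\<phi> k \<omega>) (S (X \<omega>) (X \<omega>) / 2 + 1)"
  have qi: "integrable N (\<lambda>\<omega>. S (X \<omega>) (X \<omega>) / 2 + 1)" using L2_integrable_S[OF X X] by auto
  have lim: "(\<lambda>k. ?h k \<omega>) \<longlonglongrightarrow> ?L \<omega>" for \<omega>
  proof -
    have "(\<lambda>k. min (ereal (\<phi> k \<omega>)) (ereal (S (X \<omega>) (X \<omega>) / 2 + 1)))
        \<longlonglongrightarrow> min (psi G (X \<omega>)) (ereal (S (X \<omega>) (X \<omega>) / 2 + 1))"
      unfolding \<phi>_def by (intro tendsto_min best_among_tendsto_psi[OF z] tendsto_const)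
    moreover have "\<bar>min (psi G (X \<omega>)) (ereal (S (X \<omega>) (X \<omega>) / 2 + 1))\<bar> \<noteq> \<infinity>"
      using psi_ge[OF G, of "X \<omega>"] by (cases "psi G (X \<omega>)") (auto simp: min_def)
    ultimately have "(\<lambda>k. real_of_ereal (min (ereal (\<phi> k \<omega>)) (ereal (S (X \<omega>) (X \<omega>) / 2 + 1)))) \<longlonglongrightarrow> ?L \<omega>"
      unfolding psi_trunc_def by (intro tendsto_intros) auto
    then show ?thesis by (simp add: min_def if_distrib cong: if_cong)
  qed
  \<comment> \<open>Domination from both sides: \<open>\<phi> 0\<close> bounds the increasing
    sequence from below, the cap from above.\<close>
  have dom: "integrable N (\<lambda>\<omega>. \<bar>\<phi> 0 \<omega>\<bar> + \<bar>S (X \<omega>) (X \<omega>) / 2 + 1\<bar>)"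
    using \<phi>i[of 0] qi by auto
  have \<phi>0: "\<phi> 0 \<omega> \<le> \<phi> k \<omega>" for k \<omega>
    using incseqD[OF best_among_mono[of z "X \<omega>"], of 0 k] unfolding \<phi>_def by simp
  have bound: "AE \<omega> in N. norm (?h k \<omega>) \<le> \<bar>\<phi> 0 \<omega>\<bar> + \<bar>S (X \<omega>) (X \<omega>) / 2 + 1\<bar>" for k
  proof (rule AE_I2)
    fix \<omega>
    have "\<bar>min b c\<bar> \<le> \<bar>a\<bar> + \<bar>c\<bar>" if "a \<le> b" for a b c :: real using that by linarith
    from this[OF \<phi>0] show "norm (?h k \<omega>) \<le> \<bar>\<phi> 0 \<omega>\<bar> + \<bar>S (X \<omega>) (X \<omega>) / 2 + 1\<bar>" by simp
  qed
  have meas: "?L \<in> borel_measurable N" "?h k \<in> borel_measurable N" for k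
    unfolding \<phi>_def by measurable
  show "integrable N ?L"
    by (rule integrable_dominated_convergence[OF meas dom AE_I2[OF lim] bound])
  have "(\<lambda>k. \<integral>\<omega>. ?h k \<omega> \<partial>N) \<longlonglongrightarrow> (\<integral>\<omega>. ?L \<omega> \<partial>N)"
    by (rule integral_dominated_convergence[OF meas dom AE_I2[OF lim] bound])
  moreover have "(\<integral>\<omega>. ?h k \<omega> \<partial>N) \<le> v" for k
  proof -
    have "(\<integral>\<omega>. ?h k \<omega> \<partial>N) \<le> (\<integral>\<omega>. \<phi> k \<omega> \<partial>N)"
      using \<phi>i qi by (intro integral_mono integrable_min) auto
    then show ?thesis using \<phi>v[of k] by simp
  qed
  ultimately show "(\<integral>\<omega>. ?L \<omega> \<partial>N) \<le> v" by (intro LIMSEQ_le_const2) auto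
qed

lemma weak_duality:
  assumes m: "martingale_pair N X Y" and G: "maximal_S_monotone G"
  shows "ereal ((\<integral>\<omega>. S (X \<omega>) (X \<omega>) \<partial>N) / 2) \<le> ext_integral N (\<lambda>\<omega>. psi G (Y \<omega>))"
proof -
  have X: "L2 N X" using m by (auto simp: martingale_pair_def)
  show ?thesis
  \<comment> \<open>Only real upper bounds \<open>v\<close> have to be tested, so an infinite right
    side needs no separate case.\<close>
  proof (rule ereal_le_real)
    fix v assume v: "ext_integral N (\<lambda>\<omega>. psi G (Y \<omega>)) \<le> ereal v"
    note aux = weak_duality_aux[OF m G v]
    have "(\<integral>\<omega>. S (X \<omega>) (X \<omega>) / 2 \<partial>N) \<le> v"
      by (rule order_trans[OF integral_mono[OF _ aux(1) psi_trunc_ge[OF G]] aux(2)])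
        (use L2_integrable_S[OF X X] in auto)
    then show "ereal ((\<integral>\<omega>. S (X \<omega>) (X \<omega>) \<partial>N) / 2) \<le> ereal v" by simp
  qed
qed

lemma no_gap_imp:
  assumes m: "martingale_pair N X Y" and G: "maximal_S_monotone G"
    and v: "ext_integral N (\<lambda>\<omega>. psi G (Y \<omega>)) \<le> ereal ((\<integral>\<omega>. S (X \<omega>) (X \<omega>) \<partial>N) / 2)"
  shows "AE \<omega> in N. X \<omega> \<in> G"
    and "AE \<omega> in N. psi G (Y \<omega>) = ereal (S (X \<omega>) (Y \<omega>) - S (X \<omega>) (X \<omega>) / 2)"
proof -
  have X: "L2 N X" and Y: "L2 N Y" using m by (auto simp: martingale_pair_def)
  interpret prob_space N using m by (auto simp: martingale_pair_def)
  note [measurable] = L2_D(1)[OF X] L2_D(1)[OF Y]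
  let ?L = "\<lambda>\<omega>. psi_trunc G (X \<omega>)"
  note aux = weak_duality_aux[OF m G v]
  have qi: "integrable N (\<lambda>\<omega>. S (X \<omega>) (X \<omega>) / 2)" using L2_integrable_S[OF X X] by auto
  have "(\<integral>\<omega>. ?L \<omega> - S (X \<omega>) (X \<omega>) / 2 \<partial>N) \<le> 0"
    using aux qi by simp
  moreover have "0 \<le> (\<integral>\<omega>. ?L \<omega> - S (X \<omega>) (X \<omega>) / 2 \<partial>N)"
    by (rule integral_nonneg_AE) (use psi_trunc_ge[OF G] in auto)
  ultimately have "(\<integral>\<omega>. ?L \<omega> - S (X \<omega>) (X \<omega>) / 2 \<partial>N) = 0" by simp
  then have "AE \<omega> in N. ?L \<omega> - S (X \<omega>) (X \<omega>) / 2 = 0"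
    by (subst (asm) integral_nonneg_eq_0_iff_AE) (use aux(1) qi psi_trunc_ge[OF G] in auto)
  then show XG: "AE \<omega> in N. X \<omega> \<in> G"
  proof eventually_elim
    case (elim \<omega>)
    have "psi G (X \<omega>) \<le> ereal (S (X \<omega>) (X \<omega>) / 2)"
      using elim psi_ge[OF G, of "X \<omega>"] unfolding psi_trunc_def by (cases "psi G (X \<omega>)") (auto simp: min_def split: if_splits)
    then show ?case by (rule psi_le_imp_mem[OF G])
  qed
  show "AE \<omega> in N. psi G (Y \<omega>) = ereal (S (X \<omega>) (Y \<omega>) - S (X \<omega>) (X \<omega>) / 2)"
  proof (rule ext_integral_le_imp_AE_eq)
    show "AE \<omega> in N. ereal (S (X \<omega>) (Y \<omega>) - S (X \<omega>) (X \<omega>) / 2) \<le> psi G (Y \<omega>)"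
      using XG by eventually_elim (rule psi_upper)
    show "ext_integral N (\<lambda>\<omega>. psi G (Y \<omega>)) \<le> ereal (\<integral>\<omega>. S (X \<omega>) (Y \<omega>) - S (X \<omega>) (X \<omega>) / 2 \<partial>N)"
      using v martingale_pair_value[OF m] by (simp add: L2_integrable_S X Y)
  qed (use L2_integrable_S[OF X X] L2_integrable_S[OF X Y] in \<open>auto intro: finite_measure_axioms\<close>)
qed

section \<open>Perturbation of an optimal plan\<close>

text \<open>Tower property: a test set for \<open>f (Q)\<close> pulls back to a test set for
  \<open>Q\<close>. All competitors and all modified maps arise this way.\<close>

lemma martingale_pair_of_cond_mean:
  assumes "prob_space N" "Q \<in> borel_measurable N" "L2 N Y" "cond_mean N Q Y f"
  shows "martingale_pair N (\<lambda>\<omega>. f (Q \<omega>)) Y"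
proof -
  have f: "f \<in> borel_measurable borel" "L2 N (\<lambda>\<omega>. f (Q \<omega>))" using assms(4) by (auto simp: cond_mean_def)
  have "(\<integral>\<omega>. indicator A (f (Q \<omega>)) *\<^sub>R Y \<omega> \<partial>N) = (\<integral>\<omega>. indicator A (f (Q \<omega>)) *\<^sub>R f (Q \<omega>) \<partial>N)"
    if "A \<in> sets borel" for A
  proof -
    have "f -` A \<in> sets borel" using measurable_sets[OF f(1) that] by simp
    then have "(\<integral>\<omega>. indicator (f -` A) (Q \<omega>) *\<^sub>R Y \<omega> \<partial>N) = (\<integral>\<omega>. indicator (f -` A) (Q \<omega>) *\<^sub>R f (Q \<omega>) \<partial>N)"
      using assms(4) by (auto simp: cond_mean_def)
    then show ?thesis by (simp add: indicator_def)
  qed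
  then show ?thesis using assms f by (auto simp: martingale_pair_def cond_mean_def)
qed

lemma martingale_pair_imp_Gamma:
  fixes X Y :: "'a \<Rightarrow> 'b::euclidean_space"
  assumes m: "martingale_pair N X Y"
  shows "distr N borel (\<lambda>\<omega>. (X \<omega>, Y \<omega>)) \<in> Gamma (distr N borel Y)"
proof -
  interpret prob_space N using m by (auto simp: martingale_pair_def)
  have X: "L2 N X" and Y: "L2 N Y" using m by (auto simp: martingale_pair_def)
  note [measurable] = L2_D(1)[OF X] L2_D(1)[OF Y]
  have XY: "(\<lambda>\<omega>. (X \<omega>, Y \<omega>)) \<in> measurable N borel" by measurable
  have "integrable (distr N borel (\<lambda>\<omega>. (X \<omega>, Y \<omega>))) (\<lambda>z. (norm z)\<^sup>2)"
    using L2_D(2)[OF L2_Pair[OF X Y]] XY by (subst integrable_distr_eq) auto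
  moreover have "distr (distr N borel (\<lambda>\<omega>. (X \<omega>, Y \<omega>))) borel snd = distr N borel Y"
    using XY by (subst distr_distr) (auto simp: comp_def)
  moreover have "(\<integral>z. indicator A (fst z) *\<^sub>R snd z \<partial>distr N borel (\<lambda>\<omega>. (X \<omega>, Y \<omega>)))
      = (\<integral>z. indicator A (fst z) *\<^sub>R fst z \<partial>distr N borel (\<lambda>\<omega>. (X \<omega>, Y \<omega>)))"
    if A: "A \<in> sets borel" for A
  proof -
    have IA: "(\<lambda>p. indicator A (fst p) :: real) \<in> borel_measurable (borel :: ('b \<times> 'b) measure)"
      by (rule measurable_compose[OF borel_measurable_fst_snd(1) borel_measurable_indicator[OF A]])
    have "(\<integral>\<omega>. indicator A (X \<omega>) *\<^sub>R Y \<omega> \<partial>N) = (\<integral>\<omega>. indicator A (X \<omega>) *\<^sub>R X \<omega> \<partial>N)"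
      using m A by (auto simp: martingale_pair_def cond_mean_def)
    then show ?thesis
      using XY by (subst (1 2) integral_distr) (auto intro!: borel_measurable_scaleR IA)
  qed
  ultimately show ?thesis unfolding Gamma_def using prob_space_distr[OF XY] by auto
qed

lemma integral_S_distr:
  assumes "X \<in> borel_measurable N" "Y \<in> borel_measurable N"
  shows "(\<integral>z. S (fst z) (snd z) \<partial>distr N borel (\<lambda>\<omega>. (X \<omega>, Y \<omega>))) = (\<integral>\<omega>. S (X \<omega>) (Y \<omega>) \<partial>N)"
proof -
  note [measurable] = assms
  have "(\<lambda>z. S (fst z) (snd z)) \<in> borel_measurable borel"
    by (intro borel_measurable_continuous_onI continuous_intros)
  then show ?thesis by (subst integral_distr) auto
qed

lemma Gamma_imp_martingale_pair:
  assumes "\<gamma> \<in> Gamma \<nu>"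
  shows "martingale_pair \<gamma> fst snd" "distr \<gamma> borel snd = \<nu>"
proof -
  have g: "prob_space \<gamma>" "sets \<gamma> = sets borel" "integrable \<gamma> (\<lambda>z. (norm z)\<^sup>2)"
    using assms unfolding Gamma_def by auto
  have "L2 \<gamma> (\<lambda>z. z)" unfolding L2_def using g by (auto cong: measurable_cong_sets)
  from L2_fst[OF this] L2_snd[OF this] show "martingale_pair \<gamma> fst snd"
    using assms g unfolding martingale_pair_def cond_mean_def Gamma_def by auto
  show "distr \<gamma> borel snd = \<nu>" using assms unfolding Gamma_def by auto
qed

text \<open>A point \<open>\<omega>\<close> of \<open>N\<close> is given the mark \<open>True\<close> with probability \<open>p \<omega>\<close>.\<close>

definition marked :: "'a measure \<Rightarrow> ('a \<Rightarrow> real) \<Rightarrow> ('a \<times> bool) measure" where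
  "marked N p = density (N \<Otimes>\<^sub>M count_space UNIV) (\<lambda>x. ennreal (if snd x then p (fst x) else 1 - p (fst x)))"

lemma sets_marked [measurable_cong, simp]: "sets (marked N p) = sets (N \<Otimes>\<^sub>M count_space UNIV)"
  by (simp add: marked_def)

lemma nn_integral_marked:
  assumes [measurable]: "p \<in> borel_measurable N" "F \<in> borel_measurable (N \<Otimes>\<^sub>M count_space UNIV)"
  shows "(\<integral>\<^sup>+x. F x \<partial>marked N p)
    = (\<integral>\<^sup>+\<omega>. ennreal (p \<omega>) * F (\<omega>, True) + ennreal (1 - p \<omega>) * F (\<omega>, False) \<partial>N)"
proof -
  interpret C: sigma_finite_measure "count_space (UNIV :: bool set)"
    by (rule sigma_finite_measure_count_space_finite) simp
  have "(\<integral>\<^sup>+x. F x \<partial>marked N p)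
      = (\<integral>\<^sup>+x. ennreal (if snd x then p (fst x) else 1 - p (fst x)) * F x \<partial>(N \<Otimes>\<^sub>M count_space UNIV))"
    unfolding marked_def by (rule nn_integral_density) measurable
  also have "\<dots> = (\<integral>\<^sup>+\<omega>. \<integral>\<^sup>+b. ennreal (if b then p \<omega> else 1 - p \<omega>) * F (\<omega>, b) \<partial>count_space UNIV \<partial>N)"
    by (subst C.nn_integral_fst[symmetric]) (measurable, simp only: fst_conv snd_conv)
  also have "\<dots> = (\<integral>\<^sup>+\<omega>. ennreal (p \<omega>) * F (\<omega>, True) + ennreal (1 - p \<omega>) * F (\<omega>, False) \<partial>N)"
    by (simp add: nn_integral_count_space_finite UNIV_bool add.commute)
  finally show ?thesis .
qed

lemma nn_integral_marked_fst:
  assumes [measurable]: "p \<in> borel_measurable N" "F \<in> borel_measurable N" and p: "\<And>\<omega>. 0 \<le> p \<omega>" "\<And>\<omega>. p \<omega> \<le> 1"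
  shows "(\<integral>\<^sup>+x. F (fst x) \<partial>marked N p) = (\<integral>\<^sup>+\<omega>. F \<omega> \<partial>N)"
proof -
  have "ennreal (p \<omega>) + ennreal (1 - p \<omega>) = 1" for \<omega>
    using p[of \<omega>] by (subst ennreal_plus[symmetric]) auto
  then show ?thesis
    by (subst nn_integral_marked) (auto simp: distrib_right[symmetric])
qed

text \<open>The two mark probabilities add up to 1. Hence marking does not change the law of
  \<open>Y\<close>, and plans built on the marked space keep the second marginal.\<close>

lemma distr_marked_fst:
  assumes "p \<in> borel_measurable N" "\<And>\<omega>. 0 \<le> p \<omega>" "\<And>\<omega>. p \<omega> \<le> 1"
  shows "distr (marked N p) N fst = N"
proof (rule measure_eqI)
  fix A assume "A \<in> sets (distr (marked N p) N fst)"
  then have A [measurable]: "A \<in> sets N" by simp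
  have [measurable]: "fst \<in> measurable (marked N p) N" by simp
  have "emeasure (distr (marked N p) N fst) A = (\<integral>\<^sup>+x. indicator A x \<partial>distr (marked N p) N fst)"
    by simp
  also have "\<dots> = (\<integral>\<^sup>+x. indicator A (fst x) \<partial>marked N p)"
    by (rule nn_integral_distr) measurable
  also have "\<dots> = emeasure N A" using assms by (subst nn_integral_marked_fst) auto
  finally show "emeasure (distr (marked N p) N fst) A = emeasure N A" .
qed simp

lemma prob_space_marked:
  assumes "prob_space N" "p \<in> borel_measurable N" "\<And>\<omega>. 0 \<le> p \<omega>" "\<And>\<omega>. p \<omega> \<le> 1"
  shows "prob_space (marked N p)"
proof -
  interpret prob_space N by fact
  show ?thesis
    by (rule prob_space_distrD[of fst _ N]) (use distr_marked_fst[OF assms(2-4)] assms(1) in auto)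
qed

lemma
  fixes f g :: "'a \<Rightarrow> real"
  assumes N: "prob_space N" and p: "p \<in> borel_measurable N" "\<And>\<omega>. 0 \<le> p \<omega>" "\<And>\<omega>. p \<omega> \<le> 1"
    and f: "integrable N f" and g: "integrable N g"
  shows integrable_marked: "integrable (marked N p) (\<lambda>x. if snd x then f (fst x) else g (fst x))" (is ?A)
    and integral_marked: "(\<integral>x. (if snd x then f (fst x) else g (fst x)) \<partial>marked N p)
      = (\<integral>\<omega>. p \<omega> * f \<omega> + (1 - p \<omega>) * g \<omega> \<partial>N)" (is ?B)
proof -
  interpret prob_space N by fact
  interpret C: finite_measure "count_space (UNIV :: bool set)"
    by (rule finite_measure_count_space) simp
  interpret pair_sigma_finite N "count_space (UNIV :: bool set)" ..
  note [measurable] = p(1)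
  have [measurable]: "f \<in> borel_measurable N" "g \<in> borel_measurable N" using f g by auto
  let ?F = "\<lambda>x. if snd x then f (fst x) else g (fst x)"
  let ?w = "\<lambda>x. if snd x then p (fst x) else 1 - p (fst x)"
  have Fm [measurable]: "?F \<in> borel_measurable (N \<Otimes>\<^sub>M count_space UNIV)" by measurable
  show A: ?A
  proof (rule Bochner_Integration.integrable_bound)
    have "integrable (distr (marked N p) N fst) (\<lambda>\<omega>. \<bar>f \<omega>\<bar> + \<bar>g \<omega>\<bar>)"
      unfolding distr_marked_fst[OF p] using f g by auto
    then show "integrable (marked N p) (\<lambda>x. \<bar>f (fst x)\<bar> + \<bar>g (fst x)\<bar>)"
      by (subst (asm) integrable_distr_eq) auto
    show "?F \<in> borel_measurable (marked N p)" using Fm by (simp cong: measurable_cong_sets)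
  qed (auto intro!: AE_I2)
  have w: "AE x in N \<Otimes>\<^sub>M count_space UNIV. 0 \<le> ?w x" using p by (auto intro!: AE_I2)
  have wi: "integrable (N \<Otimes>\<^sub>M count_space UNIV) (\<lambda>x. ?w x *\<^sub>R ?F x)"
    using A unfolding marked_def by (subst (asm) integrable_density[OF _ _ w]) auto
  have "(\<integral>x. ?F x \<partial>marked N p) = (\<integral>x. ?w x *\<^sub>R ?F x \<partial>(N \<Otimes>\<^sub>M count_space UNIV))"
    unfolding marked_def by (rule integral_density[OF _ _ w]) measurable
  also have "\<dots> = (\<integral>\<omega>. \<integral>b. ?w (\<omega>, b) *\<^sub>R ?F (\<omega>, b) \<partial>count_space UNIV \<partial>N)"
    using integral_fst'[OF wi] by simp
  also have "\<dots> = (\<integral>\<omega>. p \<omega> * f \<omega> + (1 - p \<omega>) * g \<omega> \<partial>N)"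
    by (simp add: lebesgue_integral_count_space_finite UNIV_bool add.commute)
  finally show ?B .
qed

lemma L2_marked:
  assumes N: "prob_space N" and p: "p \<in> borel_measurable N" "\<And>\<omega>. 0 \<le> p \<omega>" "\<And>\<omega>. p \<omega> \<le> 1"
    and f: "L2 N f" and g: "L2 N g"
  shows "L2 (marked N p) (\<lambda>x. if snd x then f (fst x) else g (fst x))"
proof -
  note [measurable] = L2_D(1)[OF f] L2_D(1)[OF g]
  have "integrable (marked N p) (\<lambda>x. if snd x then (norm (f (fst x)))\<^sup>2 else (norm (g (fst x)))\<^sup>2)"
    by (rule integrable_marked[OF N p L2_D(2)[OF f] L2_D(2)[OF g]])
  moreover have "(\<lambda>x. (norm (if snd x then f (fst x) else g (fst x)))\<^sup>2)
      = (\<lambda>x. if snd x then (norm (f (fst x)))\<^sup>2 else (norm (g (fst x)))\<^sup>2)" by auto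
  moreover have "(\<lambda>x. if snd x then f (fst x) else g (fst x)) \<in> borel_measurable (marked N p)" by measurable
  ultimately show ?thesis unfolding L2_def by simp
qed

lemma integrable_bounded_mult:
  fixes f g :: "'a \<Rightarrow> real"
  assumes "integrable N f" "g \<in> borel_measurable N" "\<And>\<omega>. \<bar>g \<omega>\<bar> \<le> B"
  shows "integrable N (\<lambda>\<omega>. g \<omega> * f \<omega>)"
proof (rule Bochner_Integration.integrable_bound)
  show "integrable N (\<lambda>\<omega>. B * f \<omega>)" using assms by simp
  show "(\<lambda>\<omega>. g \<omega> * f \<omega>) \<in> borel_measurable N" using assms by auto
  have "\<bar>g \<omega>\<bar> \<le> \<bar>B\<bar>" for \<omega> using assms(3)[of \<omega>] by simp
  then show "AE \<omega> in N. norm (g \<omega> * f \<omega>) \<le> norm (B * f \<omega>)"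
    by (intro AE_I2) (simp add: abs_mult mult_right_mono)
qed

text \<open>The competitor is \<open>E[Y' | Q]\<close> on the marked space, where \<open>Q\<close> forgets \<open>X\<close> at the marked points and the
  mark has probability \<open>e * g\<close>. Unmarked points move by \<open>d\<close>, and \<open>E|d|\<^sup>2 = O(e\<^sup>2)\<close>.\<close>

lemma perturbation_step:
  fixes X Y :: "'a \<Rightarrow> 'm::finite pt"
  assumes m: "martingale_pair N X Y"
    and g: "g \<in> borel_measurable N" "\<And>\<omega>. 0 \<le> g \<omega>" "\<And>\<omega>. g \<omega> \<le> B" "(\<integral>\<omega>. g \<omega> \<partial>N) = 1"
    and opt: "\<And>\<gamma>. \<gamma> \<in> Gamma (distr N borel Y) \<Longrightarrow> (\<integral>z. S (fst z) (snd z) \<partial>\<gamma>) \<le> (\<integral>\<omega>. S (X \<omega>) (X \<omega>) \<partial>N)"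
    and e: "0 < e" "e * B \<le> 1/2"
  defines "z \<equiv> (\<integral>\<omega>. g \<omega> *\<^sub>R Y \<omega> \<partial>N)"
  shows "S z z / 2 \<le> (\<integral>\<omega>. g \<omega> * (S (X \<omega>) (Y \<omega>) - S (X \<omega>) (X \<omega>) / 2) \<partial>N)
    + e * (2 * B\<^sup>2 * (\<integral>\<omega>. (norm (Y \<omega> - X \<omega>))\<^sup>2 \<partial>N))"
proof -
  interpret prob_space N using m by (auto simp: martingale_pair_def)
  have N: "prob_space N" by unfold_locales
  have X: "L2 N X" and Y: "L2 N Y" using m by (auto simp: martingale_pair_def)
  note [measurable] = L2_D(1)[OF X] L2_D(1)[OF Y] g(1)
  define p where "p = (\<lambda>\<omega>. e * g \<omega>)"
  have p [measurable]: "p \<in> borel_measurable N" unfolding p_def by measurable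
  have p0: "0 \<le> p \<omega>" and peB: "p \<omega> \<le> e * B" for \<omega>
    unfolding p_def using g e by (auto intro: mult_left_mono)
  have ph: "p \<omega> \<le> 1/2" for \<omega> using peB[of \<omega>] e by linarith
  have p1: "p \<omega> \<le> 1" for \<omega> using ph[of \<omega>] by linarith
  have pint: "integrable N (\<lambda>\<omega>. p \<omega> * f \<omega>)" if "integrable N f" for f :: "_ \<Rightarrow> real"
    by (rule integrable_bounded_mult[OF that p, of 1]) (use p0 p1 in auto)
  have p'int: "integrable N (\<lambda>\<omega>. (1 - p \<omega>) * f \<omega>)" if "integrable N f" for f :: "_ \<Rightarrow> real"
    by (rule integrable_bounded_mult[OF that, of _ 1]) (use p0 p1 in auto)
  define N' where "N' = marked N p"
  interpret N': prob_space N' unfolding N'_def by (rule prob_space_marked[OF N p p0 p1])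
  have N': "prob_space N'" by unfold_locales
  have [measurable_cong]: "sets N' = sets (N \<Otimes>\<^sub>M count_space UNIV)" by (simp add: N'_def)
  \<comment> \<open>The real coordinate carries the mark, so all marked points merge into the single
    value \<open>(0, 1)\<close>, which stays separate from the unmarked ones even where
    \<open>X\<close> is 0.\<close>
  define Q :: "'a \<times> bool \<Rightarrow> 'm pt \<times> real" where "Q = (\<lambda>x. if snd x then (0, 1) else (X (fst x), 0))"
  define Y' where "Y' = (\<lambda>x :: 'a \<times> bool. Y (fst x))"
  have Qm [measurable]: "Q \<in> borel_measurable N'" unfolding Q_def by measurable
  have L2': "L2 N' (\<lambda>x. if snd x then f (fst x) else h (fst x))" if "L2 N f" "L2 N h" for f h :: "_ \<Rightarrow> 'm pt"
    unfolding N'_def by (rule L2_marked[OF N p p0 p1 that])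
  have L2c: "L2 N (\<lambda>_. c)" for c :: "'m pt"
    by (rule L2_bounded[OF finite_measure_axioms, of _ "norm c"]) auto
  have Y'L: "L2 N' Y'" using L2'[OF Y Y] by (simp add: Y'_def)
  obtain f where f: "cond_mean N' Q Y' f" by (rule cond_mean_exists[OF N' Qm Y'L])
  have fb [measurable]: "f \<in> borel_measurable borel" and fL: "L2 N' (\<lambda>x. f (Q x))"
    using f by (auto simp: cond_mean_def)
  define T where "T = (\<lambda>x. f (x, 0))"
  define z' where "z' = f (0, 1)"
  have Tb [measurable]: "T \<in> borel_measurable borel"
    unfolding T_def by (rule measurable_compose[OF _ fb]) measurable
  have fQ: "f (Q x) = (if snd x then z' else T (X (fst x)))" for x by (simp add: Q_def T_def z'_def)
  have TX [measurable]: "(\<lambda>\<omega>. T (X \<omega>)) \<in> borel_measurable N" by measurable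
  \<comment> \<open>Unmarked points keep weight \<open>1 - p \<ge> 1/2\<close>, so integrals under
    \<open>N\<close> are at most twice those over the unmarked part of \<open>N'\<close>.\<close>
  have TL: "L2 N (\<lambda>\<omega>. T (X \<omega>))"
    unfolding L2_def
  proof
    have "(\<integral>\<^sup>+\<omega>. ennreal ((norm (T (X \<omega>)))\<^sup>2) \<partial>N)
        \<le> (\<integral>\<^sup>+\<omega>. 2 * (ennreal (p \<omega>) * ennreal ((norm z')\<^sup>2) + ennreal (1 - p \<omega>) * ennreal ((norm (T (X \<omega>)))\<^sup>2)) \<partial>N)"
    proof (rule nn_integral_mono)
      fix \<omega>
      have "(norm (T (X \<omega>)))\<^sup>2 \<le> 2 * ((1 - p \<omega>) * (norm (T (X \<omega>)))\<^sup>2)"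
        using mult_right_mono[of 1 "2 * (1 - p \<omega>)" "(norm (T (X \<omega>)))\<^sup>2"] ph[of \<omega>]
        by (simp add: algebra_simps)
      then have "ennreal ((norm (T (X \<omega>)))\<^sup>2) \<le> ennreal (2 * ((1 - p \<omega>) * (norm (T (X \<omega>)))\<^sup>2))"
        by (rule ennreal_leI)
      also have "\<dots> = 2 * (ennreal (1 - p \<omega>) * ennreal ((norm (T (X \<omega>)))\<^sup>2))"
        using p1[of \<omega>] by (simp add: ennreal_mult)
      also have "\<dots> \<le> 2 * (ennreal (p \<omega>) * ennreal ((norm z')\<^sup>2) + ennreal (1 - p \<omega>) * ennreal ((norm (T (X \<omega>)))\<^sup>2))"
        by (intro mult_left_mono) auto
      finally show "ennreal ((norm (T (X \<omega>)))\<^sup>2)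
        \<le> 2 * (ennreal (p \<omega>) * ennreal ((norm z')\<^sup>2) + ennreal (1 - p \<omega>) * ennreal ((norm (T (X \<omega>)))\<^sup>2))" .
    qed
    also have "\<dots> = 2 * (\<integral>\<^sup>+\<omega>. ennreal (p \<omega>) * ennreal ((norm z')\<^sup>2) + ennreal (1 - p \<omega>) * ennreal ((norm (T (X \<omega>)))\<^sup>2) \<partial>N)"
      by (rule nn_integral_cmult) measurable
    also have "\<dots> = 2 * (\<integral>\<^sup>+x. ennreal ((norm (f (Q x)))\<^sup>2) \<partial>N')"
      unfolding N'_def fQ by (subst nn_integral_marked) auto
    also have "\<dots> < \<infinity>"
      using L2_D(2)[OF fL] by (auto simp: integrable_iff_bounded ennreal_mult_less_top)
    finally show "integrable N (\<lambda>\<omega>. (norm (T (X \<omega>)))\<^sup>2)"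
      by (intro integrableI_bounded) auto
  qed simp
  define \<delta> where "\<delta> = (\<lambda>x. T x - x)"
  have \<delta>b [measurable]: "\<delta> \<in> borel_measurable borel" unfolding \<delta>_def by measurable
  define d where "d = (\<lambda>\<omega>. \<delta> (X \<omega>))"
  have dL: "L2 N d" unfolding d_def \<delta>_def by (rule L2_diff[OF TL X])
  have T: "T (X \<omega>) = X \<omega> + d \<omega>" for \<omega> by (simp add: d_def \<delta>_def)
  note inti = L2_integrable_inner L2_integrable_S X Y TL dL L2_diff[OF Y X]
  \<comment> \<open>\<open>Q\<close> separates marked from unmarked points, so one may test with a
    constant \<open>c\<close> on the former and independently with \<open>h (X)\<close> on the
    latter.\<close>
  have test: "(\<integral>\<omega>. p \<omega> * (c \<bullet> Y \<omega>) + (1 - p \<omega>) * (h (X \<omega>) \<bullet> Y \<omega>) \<partial>N)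
      = (\<integral>\<omega>. p \<omega> * (c \<bullet> z') + (1 - p \<omega>) * (h (X \<omega>) \<bullet> T (X \<omega>)) \<partial>N)"
    if [measurable]: "h \<in> borel_measurable borel" and hL: "L2 N (\<lambda>\<omega>. h (X \<omega>))" for h :: "'m pt \<Rightarrow> 'm pt" and c
  proof -
    define k where "k = (\<lambda>q :: 'm pt \<times> real. if snd q = 0 then h (fst q) else c)"
    have hf: "(\<lambda>q. h (fst q)) \<in> borel_measurable (borel :: ('m pt \<times> real) measure)"
      by (rule measurable_compose[OF borel_measurable_fst_snd(1) that(1)])
    have "closed {q :: 'm pt \<times> real. snd q = 0}" by (intro closed_Collect_eq continuous_intros)
    then have "{q :: 'm pt \<times> real. snd q = 0} \<in> sets borel" by (rule borel_closed)
    then have kb: "k \<in> borel_measurable borel"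
      unfolding k_def using hf by (intro measurable_If) auto
    have kQ: "k (Q x) = (if snd x then c else h (X (fst x)))" for x by (simp add: k_def Q_def)
    have kL: "L2 N' (\<lambda>x. k (Q x))" unfolding kQ by (rule L2'[OF L2c hL])
    have "(\<integral>x. k (Q x) \<bullet> Y' x \<partial>N') = (\<integral>x. k (Q x) \<bullet> f (Q x) \<partial>N')"
      by (rule cond_mean_test[OF N' Qm Y'L f kb kL])
    moreover have "k (Q x) \<bullet> Y' x = (if snd x then c \<bullet> Y (fst x) else h (X (fst x)) \<bullet> Y (fst x))"
      "k (Q x) \<bullet> f (Q x) = (if snd x then c \<bullet> z' else h (X (fst x)) \<bullet> T (X (fst x)))" for x
      unfolding kQ fQ Y'_def by auto
    ultimately show ?thesis
      unfolding N'_def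
      using integral_marked[OF N p p0 p1, of "\<lambda>\<omega>. c \<bullet> Y \<omega>" "\<lambda>\<omega>. h (X \<omega>) \<bullet> Y \<omega>"]
        integral_marked[OF N p p0 p1, of "\<lambda>\<omega>. c \<bullet> z'" "\<lambda>\<omega>. h (X \<omega>) \<bullet> T (X \<omega>)"]
      by (simp add: inti hL L2c)
  qed
  have Yi: "integrable N Y" by (rule L2_integrable[OF finite_measure_axioms Y])
  have gY: "integrable N (\<lambda>\<omega>. g \<omega> *\<^sub>R Y \<omega>)"
  proof (rule Bochner_Integration.integrable_bound)
    show "integrable N (\<lambda>\<omega>. B *\<^sub>R Y \<omega>)" using Yi by simp
    show "AE \<omega> in N. norm (g \<omega> *\<^sub>R Y \<omega>) \<le> norm (B *\<^sub>R Y \<omega>)"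
      using g(2,3) by (intro AE_I2) (auto intro!: mult_right_mono simp: abs_of_nonneg order_trans[OF g(2) g(3)])
  qed measurable
  \<comment> \<open>Tests vanishing on unmarked points see only the marked atom, whose mean is the
    \<open>g\<close>-average of \<open>Y\<close>; the total mark mass \<open>e\<close>
    cancels.\<close>
  have z': "z' = z"
  proof (rule euclidean_eqI)
    fix b :: "'m pt"
    have "e * (\<integral>\<omega>. (g \<omega> *\<^sub>R Y \<omega>) \<bullet> b \<partial>N) = (\<integral>\<omega>. p \<omega> * (b \<bullet> Y \<omega>) \<partial>N)"
      unfolding p_def by (simp add: inner_commute mult.assoc)
    also have "\<dots> = (\<integral>\<omega>. p \<omega> * (b \<bullet> z') \<partial>N)"
      using test[of "\<lambda>_. 0" b] L2c by simp
    also have "\<dots> = e * (b \<bullet> z')"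
      unfolding p_def using g(4) by (simp add: mult.assoc)
    finally have "(\<integral>\<omega>. (g \<omega> *\<^sub>R Y \<omega>) \<bullet> b \<partial>N) = b \<bullet> z'" using e by simp
    moreover have "(\<integral>\<omega>. (g \<omega> *\<^sub>R Y \<omega>) \<bullet> b \<partial>N) = z \<bullet> b"
      unfolding z_def using gY by (rule integral_inner_left)
    ultimately show "z' \<bullet> b = z \<bullet> b" by (simp only: inner_commute[of z' b])
  qed
  let ?K = "\<integral>\<omega>. (norm (Y \<omega> - X \<omega>))\<^sup>2 \<partial>N"
  let ?D = "\<integral>\<omega>. (norm (d \<omega>))\<^sup>2 \<partial>N"
  \<comment> \<open>Testing both conditional mean identities with \<open>d\<close> and subtracting
    gives E[(1 - p) |d|^2] = - E[p d \<bullet> (Y - X)]. As \<open>p\<close> is at most 1/2 and at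
    most \<open>e * B\<close>, Young's inequality absorbs a quarter of E|d|^2 on the left.\<close>
  have D: "?D \<le> 4 * (e * B)\<^sup>2 * ?K"
  proof -
    have nd: "integrable N (\<lambda>\<omega>. (norm (d \<omega>))\<^sup>2)" "integrable N (\<lambda>\<omega>. (norm (Y \<omega> - X \<omega>))\<^sup>2)"
      using dL L2_diff[OF Y X] by (auto simp: L2_def)
    have t1: "(\<integral>\<omega>. (1 - p \<omega>) * (d \<omega> \<bullet> Y \<omega>) \<partial>N) = (\<integral>\<omega>. (1 - p \<omega>) * (d \<omega> \<bullet> T (X \<omega>)) \<partial>N)"
      using test[of \<delta> 0] dL by (simp add: d_def)
    have t2: "(\<integral>\<omega>. d \<omega> \<bullet> Y \<omega> \<partial>N) = (\<integral>\<omega>. d \<omega> \<bullet> X \<omega> \<partial>N)"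
      unfolding d_def by (rule cond_mean_test[OF N _ Y]) (use m dL in \<open>auto simp: martingale_pair_def d_def\<close>)
    have "?D / 2 = (\<integral>\<omega>. 1/2 * (norm (d \<omega>))\<^sup>2 \<partial>N)" by simp
    also have "\<dots> \<le> (\<integral>\<omega>. (1 - p \<omega>) * (norm (d \<omega>))\<^sup>2 \<partial>N)"
      by (intro integral_mono integrable_mult_right p'int nd mult_right_mono) (use ph in \<open>auto simp: field_simps\<close>)
    also have "\<dots> = (\<integral>\<omega>. (1 - p \<omega>) * (d \<omega> \<bullet> T (X \<omega>)) - (1 - p \<omega>) * (d \<omega> \<bullet> X \<omega>) \<partial>N)"
      unfolding T power2_norm_eq_inner by (simp add: inner_add_right algebra_simps)
    also have "\<dots> = (\<integral>\<omega>. (1 - p \<omega>) * (d \<omega> \<bullet> Y \<omega>) - (1 - p \<omega>) * (d \<omega> \<bullet> X \<omega>) \<partial>N)"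
      using t1 by (simp add: p'int inti)
    also have "\<dots> = (\<integral>\<omega>. (d \<omega> \<bullet> Y \<omega> - d \<omega> \<bullet> X \<omega>) - p \<omega> * (d \<omega> \<bullet> (Y \<omega> - X \<omega>)) \<partial>N)"
      by (simp add: inner_diff_right algebra_simps)
    also have "\<dots> = (\<integral>\<omega>. - (p \<omega> * (d \<omega> \<bullet> (Y \<omega> - X \<omega>))) \<partial>N)"
      using t2 by (simp add: pint inti)
    also have "\<dots> \<le> (\<integral>\<omega>. 1/4 * (norm (d \<omega>))\<^sup>2 + (e * B)\<^sup>2 * (norm (Y \<omega> - X \<omega>))\<^sup>2 \<partial>N)"
    proof (rule integral_mono)
      fix \<omega>
      let ?a = "norm (d \<omega>)" and ?b = "norm (Y \<omega> - X \<omega>)"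
      have "- (p \<omega> * (d \<omega> \<bullet> (Y \<omega> - X \<omega>))) \<le> p \<omega> * (?a * ?b)"
        using mult_left_mono[OF Cauchy_Schwarz_ineq2[of "d \<omega>" "Y \<omega> - X \<omega>"] p0[of \<omega>]]
          mult_left_mono[OF abs_ge_minus_self[of "d \<omega> \<bullet> (Y \<omega> - X \<omega>)"] p0[of \<omega>]] by simp
      also have "\<dots> \<le> (e * B) * (?a * ?b)" by (rule mult_right_mono[OF peB]) simp
      also have "\<dots> \<le> 1/4 * ?a\<^sup>2 + (e * B)\<^sup>2 * ?b\<^sup>2"
        using zero_le_power2[of "?a / 2 - (e * B) * ?b"]
        by (simp add: power2_eq_square algebra_simps)
      finally show "- (p \<omega> * (d \<omega> \<bullet> (Y \<omega> - X \<omega>))) \<le> 1/4 * ?a\<^sup>2 + (e * B)\<^sup>2 * ?b\<^sup>2" .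
    next
      show "integrable N (\<lambda>\<omega>. - (p \<omega> * (d \<omega> \<bullet> (Y \<omega> - X \<omega>))))"
        by (intro Bochner_Integration.integrable_minus pint inti)
    qed (use nd in auto)
    also have "\<dots> = ?D / 4 + (e * B)\<^sup>2 * ?K" using nd by simp
    finally show ?thesis by simp
  qed
  \<comment> \<open>Expansion around \<open>X\<close>: the linear term can be traded for
    \<open>S X Y\<close> by \<open>test\<close> with the swap, and the remainder in \<open>d\<close>
    is of second order in \<open>e\<close>.\<close>
  have ST: "S (T (X \<omega>)) (T (X \<omega>)) = 2 * S (X \<omega>) (T (X \<omega>)) - S (X \<omega>) (X \<omega>) + S (d \<omega>) (d \<omega>)" for \<omega>
    unfolding T using S_commute[of "d \<omega>" "X \<omega>"] by (simp add: S_bilinear)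
  have "(\<integral>x. S (f (Q x)) (Y' x) \<partial>N') \<le> (\<integral>\<omega>. S (X \<omega>) (X \<omega>) \<partial>N)"
  proof -
    have mp: "martingale_pair N' (\<lambda>x. f (Q x)) Y'" by (rule martingale_pair_of_cond_mean[OF N' Qm Y'L f])
    have "distr N' borel Y' = distr (distr N' N fst) borel Y"
      by (subst distr_distr) (auto simp: Y'_def comp_def)
    then have law: "distr N' borel Y' = distr N borel Y" unfolding N'_def distr_marked_fst[OF p p0 p1] .
    show ?thesis
      using opt[OF martingale_pair_imp_Gamma[OF mp, unfolded law]]
      unfolding integral_S_distr[OF L2_D(1)[OF fL] L2_D(1)[OF Y'L]] .
  qed
  also have "(\<integral>x. S (f (Q x)) (Y' x) \<partial>N') = (\<integral>x. S (f (Q x)) (f (Q x)) \<partial>N')"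
    by (rule martingale_pair_value[OF martingale_pair_of_cond_mean[OF N' Qm Y'L f]])
  also have "\<dots> = (\<integral>x. (if snd x then S z z else S (T (X (fst x))) (T (X (fst x)))) \<partial>N')"
    unfolding fQ z' by (intro Bochner_Integration.integral_cong) auto
  also have "\<dots> = (\<integral>\<omega>. p \<omega> * S z z + (1 - p \<omega>) * S (T (X \<omega>)) (T (X \<omega>)) \<partial>N)"
    unfolding N'_def by (rule integral_marked[OF N p p0 p1]) (auto intro: inti)
  also have "\<dots> = e * S z z + (\<integral>\<omega>. (1 - p \<omega>) * S (T (X \<omega>)) (T (X \<omega>)) \<partial>N)"
    using g(4) pint[of "\<lambda>_. S z z"] p'int[of "\<lambda>\<omega>. S (T (X \<omega>)) (T (X \<omega>))"]
    by (simp add: inti) (simp add: p_def mult.assoc)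
  also have "(\<integral>\<omega>. (1 - p \<omega>) * S (T (X \<omega>)) (T (X \<omega>)) \<partial>N)
      = (\<integral>\<omega>. 2 * ((1 - p \<omega>) * S (X \<omega>) (T (X \<omega>))) - (1 - p \<omega>) * S (X \<omega>) (X \<omega>) + (1 - p \<omega>) * S (d \<omega>) (d \<omega>) \<partial>N)"
    unfolding ST by (rule Bochner_Integration.integral_cong) (simp_all add: algebra_simps)
  also have "\<dots> = 2 * (\<integral>\<omega>. (1 - p \<omega>) * S (X \<omega>) (T (X \<omega>)) \<partial>N) - (\<integral>\<omega>. (1 - p \<omega>) * S (X \<omega>) (X \<omega>) \<partial>N)
      + (\<integral>\<omega>. (1 - p \<omega>) * S (d \<omega>) (d \<omega>) \<partial>N)"
    by (simp add: p'int inti)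
  also have "(\<integral>\<omega>. (1 - p \<omega>) * S (X \<omega>) (T (X \<omega>)) \<partial>N) = (\<integral>\<omega>. (1 - p \<omega>) * S (X \<omega>) (Y \<omega>) \<partial>N)"
    using test[of prod.swap 0] L2_swap[OF X] unfolding S_eq_inner
    by (simp add: borel_measurable_continuous_onI continuous_on_swap)
  also have "2 * (\<integral>\<omega>. (1 - p \<omega>) * S (X \<omega>) (Y \<omega>) \<partial>N) - (\<integral>\<omega>. (1 - p \<omega>) * S (X \<omega>) (X \<omega>) \<partial>N)
      = (\<integral>\<omega>. S (X \<omega>) (X \<omega>) \<partial>N) - 2 * e * (\<integral>\<omega>. g \<omega> * (S (X \<omega>) (Y \<omega>) - S (X \<omega>) (X \<omega>) / 2) \<partial>N)"
  proof -
    have *: "(\<integral>\<omega>. (1 - p \<omega>) * h \<omega> \<partial>N) = (\<integral>\<omega>. h \<omega> \<partial>N) - e * (\<integral>\<omega>. g \<omega> * h \<omega> \<partial>N)"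
      and gi: "integrable N (\<lambda>\<omega>. g \<omega> * h \<omega>)"
      if "integrable N h" for h :: "_ \<Rightarrow> real"
    proof -
      show gi: "integrable N (\<lambda>\<omega>. g \<omega> * h \<omega>)"
        by (rule integrable_bounded_mult[OF that, of _ B]) (use g in auto)
      have "(\<integral>\<omega>. (1 - p \<omega>) * h \<omega> \<partial>N) = (\<integral>\<omega>. h \<omega> - e * (g \<omega> * h \<omega>) \<partial>N)"
        unfolding p_def by (simp add: algebra_simps)
      then show "(\<integral>\<omega>. (1 - p \<omega>) * h \<omega> \<partial>N) = (\<integral>\<omega>. h \<omega> \<partial>N) - e * (\<integral>\<omega>. g \<omega> * h \<omega> \<partial>N)"
        using that gi by simp
    qed
    have i: "integrable N (\<lambda>\<omega>. S (X \<omega>) (X \<omega>))" "integrable N (\<lambda>\<omega>. S (X \<omega>) (Y \<omega>))" 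
      by (rule L2_integrable_S[OF X X], rule L2_integrable_S[OF X Y])
    have "(\<integral>\<omega>. g \<omega> * (S (X \<omega>) (Y \<omega>) - S (X \<omega>) (X \<omega>) / 2) \<partial>N)
        = (\<integral>\<omega>. g \<omega> * S (X \<omega>) (Y \<omega>) - g \<omega> * S (X \<omega>) (X \<omega>) / 2 \<partial>N)"
      by (simp add: right_diff_distrib)
    also have "\<dots> = (\<integral>\<omega>. g \<omega> * S (X \<omega>) (Y \<omega>) \<partial>N) - (\<integral>\<omega>. g \<omega> * S (X \<omega>) (X \<omega>) \<partial>N) / 2"
      using gi[OF i(1)] gi[OF i(2)] by simp
    finally have split: "(\<integral>\<omega>. g \<omega> * (S (X \<omega>) (Y \<omega>) - S (X \<omega>) (X \<omega>) / 2) \<partial>N)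
        = (\<integral>\<omega>. g \<omega> * S (X \<omega>) (Y \<omega>) \<partial>N) - (\<integral>\<omega>. g \<omega> * S (X \<omega>) (X \<omega>) \<partial>N) / 2" .
    show ?thesis
      unfolding *[OF i(1)] *[OF i(2)] martingale_pair_value[OF m] split by (simp add: algebra_simps)
  qed
  finally have main: "e * S z z - 2 * e * (\<integral>\<omega>. g \<omega> * (S (X \<omega>) (Y \<omega>) - S (X \<omega>) (X \<omega>) / 2) \<partial>N)
      \<le> - (\<integral>\<omega>. (1 - p \<omega>) * S (d \<omega>) (d \<omega>) \<partial>N)" by simp
  also have "\<dots> = (\<integral>\<omega>. - ((1 - p \<omega>) * S (d \<omega>) (d \<omega>)) \<partial>N)" by simp
  also have "\<dots> \<le> ?D"
  proof (rule integral_mono)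
    show "integrable N (\<lambda>\<omega>. - ((1 - p \<omega>) * S (d \<omega>) (d \<omega>)))"
      by (rule Bochner_Integration.integrable_minus[OF p'int[OF L2_integrable_S[OF dL dL]]])
    show "integrable N (\<lambda>\<omega>. (norm (d \<omega>))\<^sup>2)" using dL by (simp add: L2_def)
    fix \<omega>
    have "- S (d \<omega>) (d \<omega>) \<le> (norm (d \<omega>))\<^sup>2" using abs_S_le[of "d \<omega>" "d \<omega>"] by (simp add: power2_eq_square)
    then have "(1 - p \<omega>) * (- S (d \<omega>) (d \<omega>)) \<le> (1 - p \<omega>) * (norm (d \<omega>))\<^sup>2"
      using p1[of \<omega>] by (intro mult_left_mono) auto
    also have "\<dots> \<le> 1 * (norm (d \<omega>))\<^sup>2" using p0[of \<omega>] by (intro mult_right_mono) auto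
    finally show "- ((1 - p \<omega>) * S (d \<omega>) (d \<omega>)) \<le> (norm (d \<omega>))\<^sup>2" by simp
  qed
  also have "\<dots> \<le> 4 * (e * B)\<^sup>2 * ?K" by (rule D)
  finally have "(2 * e) * (S z z / 2) \<le> (2 * e) * ((\<integral>\<omega>. g \<omega> * (S (X \<omega>) (Y \<omega>) - S (X \<omega>) (X \<omega>) / 2) \<partial>N) + e * (2 * B\<^sup>2 * ?K))"
    by (simp add: power2_eq_square algebra_simps)
  then show ?thesis using e by simp
qed

section \<open>Strong duality and Borel selections\<close>

lemma perturbation_ineq:
  fixes X Y :: "'a \<Rightarrow> 'm::finite pt"
  assumes m: "martingale_pair N X Y"
    and g: "g \<in> borel_measurable N" "\<And>\<omega>. 0 \<le> g \<omega>" "\<And>\<omega>. g \<omega> \<le> B" "(\<integral>\<omega>. g \<omega> \<partial>N) = 1"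
    and opt: "\<And>\<gamma>. \<gamma> \<in> Gamma (distr N borel Y) \<Longrightarrow> (\<integral>z. S (fst z) (snd z) \<partial>\<gamma>) \<le> (\<integral>\<omega>. S (X \<omega>) (X \<omega>) \<partial>N)"
  shows "S (\<integral>\<omega>. g \<omega> *\<^sub>R Y \<omega> \<partial>N) (\<integral>\<omega>. g \<omega> *\<^sub>R Y \<omega> \<partial>N) / 2
    \<le> (\<integral>\<omega>. g \<omega> * (S (X \<omega>) (Y \<omega>) - S (X \<omega>) (X \<omega>) / 2) \<partial>N)"
proof (rule le_of_small_scale)
  fix t :: real assume t: "0 < t" "t \<le> 1"
  define B' where "B' = \<bar>B\<bar> + 1"
  have B': "B \<le> B'" "0 < B'" by (auto simp: B'_def)
  have gB: "g \<omega> \<le> B'" for \<omega> using g(3)[of \<omega>] B' by linarith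
  \<comment> \<open>The step size \<open>t / (2 * B')\<close> makes marks have probability at most
    1/2 and turns the error of \<open>perturbation_step\<close> into \<open>t\<close> times a
    constant; \<open>B'\<close> is enlarged to be positive.\<close>
  have e: "0 < t / (2 * B')" "t / (2 * B') * B' \<le> 1 / 2" using t B' by auto
  have "t / (2 * B') * (2 * B'\<^sup>2 * K) = t * (B' * K)" for K
    using B' by (simp add: power2_eq_square)
  then show "S (\<integral>\<omega>. g \<omega> *\<^sub>R Y \<omega> \<partial>N) (\<integral>\<omega>. g \<omega> *\<^sub>R Y \<omega> \<partial>N) / 2
    \<le> (\<integral>\<omega>. g \<omega> * (S (X \<omega>) (Y \<omega>) - S (X \<omega>) (X \<omega>) / 2) \<partial>N)
      + t * (B' * (\<integral>\<omega>. (norm (Y \<omega> - X \<omega>))\<^sup>2 \<partial>N))"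
    using perturbation_step[OF m g(1,2) gB g(4) opt e] by simp
qed

text \<open>Boundedness makes \<open>e * g\<close> a marking probability for small
  \<open>e\<close>.\<close>

definition bounded_density :: "'a measure \<Rightarrow> ('a \<Rightarrow> real) \<Rightarrow> bool" where
  "bounded_density N g \<longleftrightarrow> g \<in> borel_measurable N \<and> (\<forall>\<omega>. 0 \<le> g \<omega>) \<and> (\<exists>B. \<forall>\<omega>. g \<omega> \<le> B) \<and> (\<integral>\<omega>. g \<omega> \<partial>N) = 1"

lemma integrable_bounded_density_scaleR:
  fixes f :: "'a \<Rightarrow> 'b::euclidean_space"
  assumes "bounded_density N g" "integrable N f"
  shows "integrable N (\<lambda>\<omega>. g \<omega> *\<^sub>R f \<omega>)"
proof -
  obtain B where B: "\<And>\<omega>. g \<omega> \<le> B" and g: "g \<in> borel_measurable N" "\<And>\<omega>. 0 \<le> g \<omega>"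
    using assms(1) unfolding bounded_density_def by auto
  show ?thesis
  proof (rule Bochner_Integration.integrable_bound)
    show "integrable N (\<lambda>\<omega>. B *\<^sub>R f \<omega>)" using assms(2) by simp
    show "(\<lambda>\<omega>. g \<omega> *\<^sub>R f \<omega>) \<in> borel_measurable N" using assms(2) g(1) by auto
    have "\<bar>g \<omega>\<bar> \<le> \<bar>B\<bar>" for \<omega> using B[of \<omega>] g(2)[of \<omega>] by simp
    then show "AE \<omega> in N. norm (g \<omega> *\<^sub>R f \<omega>) \<le> norm (B *\<^sub>R f \<omega>)"
      unfolding norm_scaleR by (intro AE_I2 mult_right_mono) simp_all
  qed
qed

lemma bounded_density_mix:
  assumes N: "finite_measure N" and g: "bounded_density N g" and h: "bounded_density N h"
    and u: "0 \<le> u" "0 \<le> v" "u + v = 1"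
  shows "bounded_density N (\<lambda>\<omega>. u * g \<omega> + v * h \<omega>)"
proof -
  interpret finite_measure N by fact
  obtain B where B: "\<And>\<omega>. g \<omega> \<le> B" using g unfolding bounded_density_def by auto
  obtain C where C: "\<And>\<omega>. h \<omega> \<le> C" using h unfolding bounded_density_def by auto
  have "u * g \<omega> + v * h \<omega> \<le> u * B + v * C" for \<omega>
    using B[of \<omega>] C[of \<omega>] u by (intro add_mono mult_left_mono) auto
  moreover have "integrable N g" "integrable N h"
    using integrable_bounded_density_scaleR[OF g, of "\<lambda>_. 1 :: real"]
      integrable_bounded_density_scaleR[OF h, of "\<lambda>_. 1 :: real"] by auto
  ultimately show ?thesis
    using g h u unfolding bounded_density_def by auto
qed

text \<open>The set \<open>G\<close> is obtained from inequalities between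
  \<open>g\<close>-averages. Since all bounded densities are allowed, they localise to almost sure
  inequalities, and these bound \<open>psi G Y\<close> itself.\<close>

lemma strong_duality:
  fixes X Y :: "'a \<Rightarrow> 'm::finite pt"
  assumes m: "martingale_pair N X Y"
    and opt: "\<And>\<gamma>. \<gamma> \<in> Gamma (distr N borel Y) \<Longrightarrow> (\<integral>z. S (fst z) (snd z) \<partial>\<gamma>) \<le> (\<integral>\<omega>. S (X \<omega>) (X \<omega>) \<partial>N)"
  obtains G where "maximal_S_monotone G"
    "ext_integral N (\<lambda>\<omega>. psi G (Y \<omega>)) \<le> ereal ((\<integral>\<omega>. S (X \<omega>) (X \<omega>) \<partial>N) / 2)"
proof -
  interpret prob_space N using m by (auto simp: martingale_pair_def)
  have X: "L2 N X" and Y: "L2 N Y" using m by (auto simp: martingale_pair_def)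
  note [measurable] = L2_D(1)[OF X] L2_D(1)[OF Y]
  have Yi: "integrable N Y" by (rule L2_integrable[OF finite_measure_axioms Y])
  define c where "c = (\<lambda>\<omega>. S (X \<omega>) (Y \<omega>) - S (X \<omega>) (X \<omega>) / 2)"
  have ci: "integrable N c" unfolding c_def using L2_integrable_S[OF X X] L2_integrable_S[OF X Y] by auto
  define bar where "bar = (\<lambda>g. (\<integral>\<omega>. g \<omega> *\<^sub>R Y \<omega> \<partial>N, \<integral>\<omega>. g \<omega> *\<^sub>R c \<omega> \<partial>N))"
  have bar: "S (fst (bar g)) (fst (bar g)) / 2 \<le> snd (bar g)" if g: "bounded_density N g" for g
  proof -
    obtain B where B: "\<And>\<omega>. g \<omega> \<le> B" using g unfolding bounded_density_def by auto
    show ?thesis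
      unfolding bar_def c_def using perturbation_ineq[OF m _ _ B _ opt] g by (auto simp: bounded_density_def)
  qed
  define D where "D = bar ` {g. bounded_density N g}"
  have "convex D"
  proof (rule convexI)
    fix x y u v assume x: "x \<in> D" and y: "y \<in> D" and uv: "0 \<le> u" "0 \<le> (v :: real)" "u + v = 1"
    obtain g where g: "bounded_density N g" "x = bar g" using x by (auto simp: D_def)
    obtain h where h: "bounded_density N h" "y = bar h" using y by (auto simp: D_def)
    note i = integrable_bounded_density_scaleR[OF g(1) Yi] integrable_bounded_density_scaleR[OF h(1) Yi]
      integrable_bounded_density_scaleR[OF g(1) ci] integrable_bounded_density_scaleR[OF h(1) ci]
    have "bar (\<lambda>\<omega>. u * g \<omega> + v * h \<omega>) = u *\<^sub>R x + v *\<^sub>R y"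
      unfolding g h bar_def using i by (simp add: scaleR_left_distrib distrib_right mult.assoc flip: scaleR_scaleR)
    then show "u *\<^sub>R x + v *\<^sub>R y \<in> D"
      using bounded_density_mix[OF finite_measure_axioms g(1) h(1) uv] unfolding D_def by force
  qed
  then have Dab: "above_form D" using bar by (auto simp: above_form_def D_def case_prod_beta)
  have "bounded_density N (\<lambda>_. 1)" by (auto simp: bounded_density_def prob_space)
  then have "D \<noteq> {}" by (auto simp: D_def)
  then obtain G where G: "maximal_S_monotone G"
    and below: "\<And>x y a. x \<in> G \<Longrightarrow> (y, a) \<in> D \<Longrightarrow> S x y - S x x / 2 \<le> a"
    using maximal_S_monotone_below[OF Dab] by metis
  have AEx: "AE \<omega> in N. S x (Y \<omega>) - S x x / 2 \<le> c \<omega>" if x: "x \<in> G" for x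
  proof -
    define w where "w = (\<lambda>\<omega>. c \<omega> - (S x (Y \<omega>) - S x x / 2))"
    have Sxi: "integrable N (\<lambda>\<omega>. S x (Y \<omega>))" unfolding S_eq_inner using Yi by simp
    have wi: "integrable N w" unfolding w_def using ci Sxi by auto
    define A where "A = {\<omega> \<in> space N. w \<omega> < 0}"
    have A [measurable]: "A \<in> sets N" unfolding A_def using wi by measurable
    have iA: "integrable N (\<lambda>\<omega>. indicator A \<omega> * w \<omega>)"
      by (rule integrable_bounded_mult[OF wi, of _ 1]) (auto simp: indicator_def)
    have "0 \<le> (\<integral>\<omega>. indicator A \<omega> * w \<omega> \<partial>N)"
    proof (cases "prob A = 0")
      case True
      then have "AE \<omega> in N. \<omega> \<notin> A" using A by (simp add: prob_eq_0)
      then have "(\<integral>\<omega>. indicator A \<omega> * w \<omega> \<partial>N) = (\<integral>\<omega>. 0 \<partial>N)"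
        using iA by (intro integral_cong_AE) (auto elim: eventually_mono)
      then show ?thesis by simp
    next
      case False
      then have P: "0 < prob A" using zero_less_measure_iff by blast
      \<comment> \<open>Conditioning on the set where the inequality fails: the averaged inequality
        for this density shows that the set is null.\<close>
      define g where "g = (\<lambda>\<omega>. indicator A \<omega> / prob A)"
      have "g \<omega> \<le> 1 / prob A" for \<omega> using P by (auto simp: g_def indicator_def)
      then have g: "bounded_density N g"
        unfolding bounded_density_def using P A by (auto simp: g_def)
      have gS: "integrable N (\<lambda>\<omega>. g \<omega> * S x (Y \<omega>))" "integrable N (\<lambda>\<omega>. g \<omega> * c \<omega>)" "integrable N g"
        using integrable_bounded_density_scaleR[OF g Sxi] integrable_bounded_density_scaleR[OF g ci]
          integrable_bounded_density_scaleR[OF g, of "\<lambda>_. 1 :: real"] by auto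
      have "S x (\<integral>\<omega>. g \<omega> *\<^sub>R Y \<omega> \<partial>N) - S x x / 2 \<le> (\<integral>\<omega>. g \<omega> *\<^sub>R c \<omega> \<partial>N)"
        using below[OF x] g unfolding D_def bar_def by blast
      moreover have "S x (\<integral>\<omega>. g \<omega> *\<^sub>R Y \<omega> \<partial>N) = (\<integral>\<omega>. g \<omega> * S x (Y \<omega>) \<partial>N)"
        unfolding S_eq_inner
        by (subst integral_inner_right[symmetric]) (auto intro!: integrable_bounded_density_scaleR[OF g Yi])
      moreover have "(\<integral>\<omega>. g \<omega> \<partial>N) = 1" using g by (simp add: bounded_density_def)
      moreover have "(\<integral>\<omega>. g \<omega> * w \<omega> \<partial>N) = (\<integral>\<omega>. g \<omega> * c \<omega> - g \<omega> * S x (Y \<omega>) + g \<omega> * (S x x / 2) \<partial>N)"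
        unfolding w_def by (simp add: algebra_simps)
      ultimately have "0 \<le> (\<integral>\<omega>. g \<omega> * w \<omega> \<partial>N)" using gS by simp
      also have "(\<integral>\<omega>. g \<omega> * w \<omega> \<partial>N) = (\<integral>\<omega>. indicator A \<omega> * w \<omega> \<partial>N) / prob A"
        by (simp add: g_def)
      finally show ?thesis using P by (simp add: zero_le_divide_iff)
    qed
    moreover have "0 \<le> (\<integral>\<omega>. - (indicator A \<omega> * w \<omega>) \<partial>N)"
      by (rule integral_nonneg_AE) (auto simp: A_def indicator_def)
    ultimately have "(\<integral>\<omega>. - (indicator A \<omega> * w \<omega>) \<partial>N) = 0" by simp
    then have "AE \<omega> in N. - (indicator A \<omega> * w \<omega>) = 0"
      by (subst (asm) integral_nonneg_eq_0_iff_AE) (use iA in \<open>auto simp: A_def indicator_def\<close>)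
    then show ?thesis
      by (rule AE_mp) (auto intro!: AE_I2 simp: A_def w_def indicator_def split: if_splits)
  qed
  obtain z :: "nat \<Rightarrow> _" where z: "range z \<subseteq> G" "G \<subseteq> closure (range z)"
    by (rule dense_sequence[OF maximal_S_monotone_nonempty[OF G]])
  \<comment> \<open>The null set depends on \<open>x\<close>, so the inequalities are combined along
    a dense sequence of \<open>G\<close> only.\<close>
  have "AE \<omega> in N. \<forall>n. S (z n) (Y \<omega>) - S (z n) (z n) / 2 \<le> c \<omega>"
    unfolding AE_all_countable by (intro allI AEx) (use z(1) in auto)
  then have "AE \<omega> in N. psi G (Y \<omega>) \<le> ereal (c \<omega>)"
    unfolding psi_eq_SUP_sequence[OF z] by (rule eventually_mono) (auto intro!: SUP_least)
  then have "ext_integral N (\<lambda>\<omega>. psi G (Y \<omega>)) \<le> ereal (\<integral>\<omega>. c \<omega> \<partial>N)"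
    unfolding ext_integral_real[OF ci, symmetric] by (rule ext_integral_mono_AE)
  also have "(\<integral>\<omega>. c \<omega> \<partial>N) = (\<integral>\<omega>. S (X \<omega>) (X \<omega>) \<partial>N) / 2"
    unfolding c_def using L2_integrable_S[OF X X] L2_integrable_S[OF X Y] martingale_pair_value[OF m] by simp
  finally show ?thesis using that G by blast
qed

section \<open>Borel selections of a maximal monotone set\<close>

lemma closed_bounded_projection:
  fixes G :: "('a::metric_space \<times> 'b::heine_borel) set"
  assumes "closed G" "compact K"
  shows "closed {r. \<exists>v\<in>K. (r, v) \<in> G}"
  unfolding closed_sequential_limits
proof (intro allI impI, elim conjE)
  fix x l assume x: "\<forall>n. x n \<in> {r. \<exists>v\<in>K. (r, v) \<in> G}" and l: "x \<longlonglongrightarrow> l"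
  then obtain v where v: "\<And>n. v n \<in> K" "\<And>n. (x n, v n) \<in> G" by simp metis
  obtain w \<rho> where w: "w \<in> K" "strict_mono (\<rho> :: nat \<Rightarrow> nat)" "(v \<circ> \<rho>) \<longlonglongrightarrow> w"
    using assms(2) v(1) unfolding compact_def by metis
  have "(\<lambda>n. (x (\<rho> n), v (\<rho> n))) \<longlonglongrightarrow> (l, w)"
    using tendsto_Pair[OF LIMSEQ_subseq_LIMSEQ[OF l w(2)] w(3)] by (simp add: comp_def)
  then have "(l, w) \<in> G" using closed_sequentially[OF assms(1), of "\<lambda>n. (x (\<rho> n), v (\<rho> n))"] v(2) by simp
  then show "l \<in> {r. \<exists>v\<in>K. (r, v) \<in> G}" using w(1) by auto
qed

text \<open>With the base point fixed, each condition of monotone relation is affine in the other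
  coordinate. Convexity makes the element of least norm unique.\<close>

lemma maximal_S_monotone_fibre_convex:
  assumes G: "maximal_S_monotone G" shows "convex {v. (r, v) \<in> G}"
proof (rule convexI, unfold mem_Collect_eq)
  fix x y u v assume xy: "(r, x) \<in> G" "(r, y) \<in> G" and uv: "0 \<le> u" "0 \<le> (v::real)" "u + v = 1"
  show "(r, u *\<^sub>R x + v *\<^sub>R y) \<in> G"
  proof (subst maximal_S_monotone_iff_mem[OF G], intro ballI)
    fix g assume g: "g \<in> G"
    have nn: "0 \<le> (r - fst g) \<bullet> (w - snd g)" if "(r, w) \<in> G" for w
    proof -
      have "0 \<le> S ((r, w) - g) ((r, w) - g)" using maximal_S_monotone_iff_mem[OF G] that g by blast
      then show ?thesis by (simp add: S_def inner_commute)
    qed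
    have "(u *\<^sub>R x + v *\<^sub>R y) - snd g = u *\<^sub>R (x - snd g) + v *\<^sub>R (y - snd g)"
      using uv by (simp add: algebra_simps flip: scaleR_left_distrib)
    then have "0 \<le> (r - fst g) \<bullet> ((u *\<^sub>R x + v *\<^sub>R y) - snd g)"
      using nn[OF xy(1)] nn[OF xy(2)] uv by (simp add: inner_add_right)
    then show "0 \<le> S ((r, u *\<^sub>R x + v *\<^sub>R y) - g) ((r, u *\<^sub>R x + v *\<^sub>R y) - g)"
      by (simp add: S_def inner_commute)
  qed
qed

text \<open>The element of minimal norm of each fibre is a Borel function of the base point, because
  projections of closed sets along bounded sets are closed.\<close>

lemma maximal_S_monotone_selection:
  assumes G: "maximal_S_monotone G" and dom: "{u. \<exists>v. (u, v) \<in> G} = UNIV"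
  obtains s where "s \<in> borel_measurable borel" "\<forall>r. (r, s r) \<in> G"
proof -
  have cG: "closed G" by (rule maximal_S_monotone_closed[OF G])
  define F where "F = (\<lambda>r. {v. (r, v) \<in> G})"
  have Fne: "F r \<noteq> {}" for r using dom unfolding F_def by blast
  have Fcv: "convex (F r)" for r unfolding F_def by (rule maximal_S_monotone_fibre_convex[OF G])
  have Fcl: "closed (F r)" for r
  proof -
    have "F r = Pair r -` G" by (auto simp: F_def)
    then show ?thesis using continuous_closed_vimage[OF cG, of "Pair r"] by (auto intro!: continuous_intros)
  qed
  define s where "s = (\<lambda>r. closest_point (F r) 0)"
  have sF: "s r \<in> F r" for r unfolding s_def by (rule closest_point_in_set[OF Fcl Fne])
  have smin: "norm (s r) \<le> norm v" if "v \<in> F r" for r v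
    using closest_point_le[OF Fcl that, of 0] by (simp add: s_def)
  have suniq: "v = s r" if "v \<in> F r" "norm v \<le> norm (s r)" for r v
    unfolding s_def
    by (rule closest_point_unique[OF Fcv Fcl that(1)]) (use order_trans[OF that(2) smin] in simp)
  define P where "P = (\<lambda>C a. {r. \<exists>v\<in>C \<inter> cball 0 a. (r, v) \<in> G})"
  have Pcl: "closed (P C a)" if "closed C" for C a
    unfolding P_def using that by (intro closed_bounded_projection cG closed_Int_compact) auto
  \<comment> \<open>\<open>s r\<close> lies in \<open>C\<close> iff, for every rational radius, a
    fibre meeting the ball also meets \<open>C\<close> in it. For the converse, the least-norm point
    of \<open>C \<inter> F r\<close> cannot exceed \<open>s r\<close> in norm, as a rational radius
    in between would contradict this, so uniqueness identifies the two.\<close>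
  have eq: "s -` C = (\<Inter>a\<in>\<rat>. (- P UNIV a \<union> P C a))" if C: "closed C" for C
  proof (intro equalityI subsetI)
    fix r assume r: "r \<in> s -` C"
    show "r \<in> (\<Inter>a\<in>\<rat>. (- P UNIV a \<union> P C a))"
    proof
      fix a :: real assume "a \<in> \<rat>"
      have "r \<in> P C a" if "r \<in> P UNIV a"
      proof -
        obtain v where "v \<in> F r" "norm v \<le> a" using \<open>r \<in> P UNIV a\<close> by (auto simp: P_def F_def)
        then have "norm (s r) \<le> a" using smin order_trans by blast
        then show ?thesis using r sF[of r] by (auto simp: P_def F_def)
      qed
      then show "r \<in> - P UNIV a \<union> P C a" by blast
    qed
  next
    fix r assume r: "r \<in> (\<Inter>a\<in>\<rat>. (- P UNIV a \<union> P C a))"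
    have ex: "\<exists>v\<in>C \<inter> F r. norm v \<le> a" if a: "a \<in> \<rat>" "norm (s r) \<le> a" for a
    proof -
      have "r \<in> P UNIV a" using a(2) sF[of r] by (auto simp: P_def F_def)
      then have "r \<in> P C a" using r a(1) by blast
      then show ?thesis by (auto simp: P_def F_def)
    qed
    obtain a0 where "a0 \<in> \<rat>" "norm (s r) < a0" using Rats_dense_in_real[of "norm (s r)" "norm (s r) + 1"] by auto
    then have ne: "C \<inter> F r \<noteq> {}" using ex[of a0] by auto
    have cl: "closed (C \<inter> F r)" using C Fcl by auto
    define v where "v = closest_point (C \<inter> F r) 0"
    have v: "v \<in> C" "v \<in> F r" using closest_point_in_set[OF cl ne, of 0] by (auto simp: v_def)
    have "norm v \<le> norm (s r)"
    proof (rule ccontr)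
      assume "\<not> norm v \<le> norm (s r)"
      then obtain a where a: "a \<in> \<rat>" "norm (s r) < a" "a < norm v" using Rats_dense_in_real[of "norm (s r)" "norm v"] by auto
      then obtain v' where v': "v' \<in> C \<inter> F r" "norm v' \<le> a" using ex[of a] by auto
      have "norm v \<le> norm v'" using closest_point_le[OF cl v'(1), of 0] by (simp add: v_def)
      then show False using a v' by simp
    qed
    then have "v = s r" by (rule suniq[OF v(2)])
    then show "r \<in> s -` C" using v by simp
  qed
  have closed_meas: "s -` C \<in> sets borel" if "closed C" for C
  proof -
    have "- P UNIV a \<union> P C a \<in> sets borel" for a
      by (intro sets.Un borel_comp borel_closed Pcl that closed_UNIV)
    moreover have "\<rat> \<noteq> ({} :: real set)" using Rats_0 by blast
    ultimately show ?thesis unfolding eq[OF that] by (intro sets.countable_INT'[OF countable_rat]) auto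
  qed
  have "s \<in> borel_measurable borel"
  proof (rule borel_measurableI)
    fix T :: "(real^'a) set" assume "open T"
    then have "s -` (- T) \<in> sets borel" by (intro closed_meas) auto
    then have "- (s -` (- T)) \<in> sets borel" by (rule borel_comp)
    then show "s -` T \<inter> space borel \<in> sets borel" by (simp add: vimage_Compl)
  qed
  then show ?thesis using that sF unfolding F_def by blast
qed

section \<open>Equilibria\<close>

lemma Xset_iff:
  assumes "prob_space M" "L2 M Y"
  shows "X \<in> Xset M Y \<longleftrightarrow>
    martingale_pair M X Y \<and> X \<in> measurable (vimage_algebra (space M) Y borel) borel"
proof -
  interpret prob_space M by fact
  have i: "integrable M Z" if "L2 M Z" for Z :: "'a \<Rightarrow> 'b"
    by (rule L2_integrable[OF finite_measure_axioms that])
  have "X \<in> measurable (vimage_algebra (space M) X borel) borel"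
    by (rule measurable_vimage_algebra1) simp
  then show ?thesis
    using assms i[of X] i[of Y]
    unfolding Xset_def martingale_pair_def cond_mean_def cond_exp_eq_def
    by (auto simp: indicator_def)
qed

lemma no_gap_imp_optimal_map:
  assumes M: "prob_space M" and Y: "L2 M Y" and X: "X \<in> Xset M Y" and G: "maximal_S_monotone G"
    and v: "ext_integral M (\<lambda>\<omega>. psi G (Y \<omega>)) \<le> ereal ((\<integral>\<omega>. S (X \<omega>) (X \<omega>) \<partial>M) / 2)"
  shows "optimal_map M Y X"
  unfolding optimal_map_def
proof (intro conjI ballI)
  fix X' assume X': "X' \<in> Xset M Y"
  have m: "martingale_pair M X Y" "martingale_pair M X' Y" using X X' by (auto simp: Xset_iff[OF M Y])
  from order_trans[OF weak_duality[OF m(2) G] v]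
  show "(\<integral>\<omega>. S (X' \<omega>) (Y \<omega>) \<partial>M) / 2 \<le> (\<integral>\<omega>. S (X \<omega>) (Y \<omega>) \<partial>M) / 2"
    unfolding martingale_pair_value[OF m(1)] martingale_pair_value[OF m(2)] by simp
qed fact

lemma ext_integral_psi_distr:
  assumes "Y \<in> borel_measurable N"
  shows "ext_integral (distr N borel Y) (psi G) = ext_integral N (\<lambda>\<omega>. psi G (Y \<omega>))"
  by (rule ext_integral_distr[OF assms borel_measurable_psi])

text \<open>A competing plan is a martingale pair on its own space, so weak duality applies there,
  and the dual value depends on the second marginal alone.\<close>

lemma no_gap_imp_optimal_plan:
  assumes m: "martingale_pair N X Y" and G: "maximal_S_monotone G"
    and v: "ext_integral N (\<lambda>\<omega>. psi G (Y \<omega>)) \<le> ereal ((\<integral>\<omega>. S (X \<omega>) (X \<omega>) \<partial>N) / 2)"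
  shows "optimal_plan (distr N borel Y) (distr N borel (\<lambda>\<omega>. (X \<omega>, Y \<omega>)))"
  unfolding optimal_plan_def
proof (intro conjI ballI)
  show "distr N borel (\<lambda>\<omega>. (X \<omega>, Y \<omega>)) \<in> Gamma (distr N borel Y)"
    by (rule martingale_pair_imp_Gamma[OF m])
  have X: "X \<in> borel_measurable N" and Y: "Y \<in> borel_measurable N" using m by (auto simp: martingale_pair_def L2_def)
  fix \<gamma> assume g: "\<gamma> \<in> Gamma (distr N borel Y)"
  note mg = Gamma_imp_martingale_pair[OF g]
  have "ereal ((\<integral>z. S (fst z) (fst z) \<partial>\<gamma>) / 2) \<le> ext_integral \<gamma> (\<lambda>z. psi G (snd z))"
    by (rule weak_duality[OF mg(1) G])
  also have "\<dots> = ext_integral N (\<lambda>\<omega>. psi G (Y \<omega>))"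
    using ext_integral_psi_distr[of snd \<gamma> G] ext_integral_psi_distr[OF Y, of G] mg
    by (simp add: martingale_pair_def L2_def)
  also note v
  finally show "(\<integral>z. S (fst z) (snd z) \<partial>\<gamma>) / 2 \<le> (\<integral>z. S (fst z) (snd z) \<partial>distr N borel (\<lambda>\<omega>. (X \<omega>, Y \<omega>))) / 2"
    unfolding integral_S_distr[OF X Y] martingale_pair_value[OF m] martingale_pair_value[OF mg(1)] by simp
qed

lemma no_gap_imp_optimal_dual_set:
  assumes m: "martingale_pair N X Y" and G: "maximal_S_monotone G"
    and v: "ext_integral N (\<lambda>\<omega>. psi G (Y \<omega>)) \<le> ereal ((\<integral>\<omega>. S (X \<omega>) (X \<omega>) \<partial>N) / 2)"
  shows "optimal_dual_set (distr N borel Y) G"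
proof -
  have Y: "Y \<in> borel_measurable N" using m by (auto simp: martingale_pair_def L2_def)
  show ?thesis
    unfolding optimal_dual_set_def ext_integral_psi_distr[OF Y]
    using G order_trans[OF v weak_duality[OF m]] by blast
qed

lemma equilibrium_of_no_gap:
  fixes U V :: "'a \<Rightarrow> real^'m"
  assumes M: "prob_space M" and U: "L2 M U" and V: "L2 M V" and Y_def: "Y = (\<lambda>\<omega>. (U \<omega>, V \<omega>))"
    and X: "X \<in> Xset M Y" and G: "maximal_S_monotone G" and dom: "{u. \<exists>v. (u, v) \<in> G} = UNIV"
    and v: "ext_integral M (\<lambda>\<omega>. psi G (Y \<omega>)) \<le> ereal ((\<integral>\<omega>. S (X \<omega>) (X \<omega>) \<partial>M) / 2)"
  obtains R f where "Y_equilibrium M U V R f" "\<forall>r. (r, f r) \<in> G"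
    "optimal_map M Y (\<lambda>\<omega>. (R \<omega>, f (R \<omega>)))"
proof -
  interpret prob_space M by fact
  have Y: "L2 M Y" unfolding Y_def by (rule L2_Pair[OF U V])
  have mX: "martingale_pair M X Y" and XY: "X \<in> measurable (vimage_algebra (space M) Y borel) borel"
    using X by (auto simp: Xset_iff[OF M Y])
  have XL: "L2 M X" using mX by (simp add: martingale_pair_def)
  have Ui: "integrable M U" and Vi: "integrable M V"
    using L2_integrable[OF finite_measure_axioms U] L2_integrable[OF finite_measure_axioms V] by auto
  have Yi: "integrable M Y" and Xi: "integrable M X"
    using L2_integrable[OF finite_measure_axioms Y] L2_integrable[OF finite_measure_axioms XL] by auto
  define R where "R = (\<lambda>\<omega>. fst (X \<omega>))"
  have RL: "L2 M R" unfolding R_def by (rule L2_fst[OF XL])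
  have Rm: "R \<in> borel_measurable M" by (rule L2_D(1)[OF RL])
  have RY: "R \<in> measurable (vimage_algebra (space M) Y borel) borel"
    unfolding R_def by (rule measurable_compose[OF XY borel_measurable_fst_snd(1)])
  \<comment> \<open>\<open>R\<close> is a coordinate of \<open>X\<close>, so conditioning on it
    leaves the first coordinate \<open>R\<close> unchanged; only the second one has to be
    replaced.\<close>
  have condU: "cond_mean M R U (\<lambda>r. r)"
    unfolding cond_mean_def
  proof (intro conjI ballI)
    fix A :: "(real^'m) set" assume A: "A \<in> sets borel"
    let ?A = "fst -` A :: 'm pt set"
    have A': "?A \<in> sets borel" using measurable_sets[OF borel_measurable_fst_snd(1) A] by simp
    have Xm: "X \<in> borel_measurable M" by (rule L2_D(1)[OF XL])
    have "(\<integral>\<omega>. indicator ?A (X \<omega>) *\<^sub>R Y \<omega> \<partial>M) = (\<integral>\<omega>. indicator ?A (X \<omega>) *\<^sub>R X \<omega> \<partial>M)"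
      using mX A' by (simp add: martingale_pair_def cond_mean_def)
    then have "(\<integral>\<omega>. fst (indicator ?A (X \<omega>) *\<^sub>R Y \<omega>) \<partial>M) = (\<integral>\<omega>. fst (indicator ?A (X \<omega>) *\<^sub>R X \<omega>) \<partial>M)"
      unfolding integral_bounded_linear[OF bounded_linear_fst integrable_indicator_comp[OF Yi Xm A']]
        integral_bounded_linear[OF bounded_linear_fst integrable_indicator_comp[OF Xi Xm A']] by simp
    then show "(\<integral>\<omega>. indicator A (R \<omega>) *\<^sub>R U \<omega> \<partial>M) = (\<integral>\<omega>. indicator A (R \<omega>) *\<^sub>R R \<omega> \<partial>M)"
      by (simp add: R_def Y_def indicator_def)
  qed (use RL in auto)
  have pair: "martingale_pair M (\<lambda>\<omega>. (R \<omega>, g (R \<omega>))) Y" if "cond_mean M R V g" for g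
    using martingale_pair_of_cond_mean[OF M Rm Y cond_mean_Pair[OF finite_measure_axioms Rm Ui Vi condU that, folded Y_def]] .
  \<comment> \<open>The value is twice the mean of \<open>R \<bullet> V\<close>, for
    \<open>X\<close> as well as for the modified pair: test the martingale property with
    \<open>(fst x, 0)\<close>.\<close>
  have val: "(\<integral>\<omega>. S (R \<omega>, g (R \<omega>)) (R \<omega>, g (R \<omega>)) \<partial>M) = (\<integral>\<omega>. S (X \<omega>) (X \<omega>) \<partial>M)" if g: "cond_mean M R V g" for g
  proof -
    have gL: "L2 M (\<lambda>\<omega>. g (R \<omega>))" using g by (simp add: cond_mean_def)
    have "(\<integral>\<omega>. R \<omega> \<bullet> g (R \<omega>) \<partial>M) = (\<integral>\<omega>. R \<omega> \<bullet> V \<omega> \<partial>M)"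
      by (rule cond_mean_test[OF M Rm V g, of "\<lambda>r. r", symmetric]) (use RL in auto)
    also have "\<dots> = (\<integral>\<omega>. S (fst (X \<omega>), 0) (Y \<omega>) \<partial>M)" by (simp add: S_def R_def Y_def)
    also have "\<dots> = (\<integral>\<omega>. S (fst (X \<omega>), 0) (X \<omega>) \<partial>M)"
    proof (rule martingale_pair_test[OF mX])
      show "(\<lambda>x. (fst x, 0)) \<in> borel_measurable (borel :: 'm pt measure)"
        by (intro borel_measurable_continuous_onI continuous_intros)
      have "L2 M (\<lambda>\<omega>. 0 :: real^'m)" by (simp add: L2_def)
      then show "L2 M (\<lambda>\<omega>. (fst (X \<omega>), 0 :: real^'m))" by (intro L2_Pair L2_fst XL)
    qed
    finally have *: "(\<integral>\<omega>. R \<omega> \<bullet> g (R \<omega>) \<partial>M) = (\<integral>\<omega>. fst (X \<omega>) \<bullet> snd (X \<omega>) \<partial>M)" by (simp add: S_def)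
    have "(\<integral>\<omega>. S (R \<omega>, g (R \<omega>)) (R \<omega>, g (R \<omega>)) \<partial>M) = (\<integral>\<omega>. 2 * (R \<omega> \<bullet> g (R \<omega>)) \<partial>M)"
      by (simp add: S_def inner_commute)
    also have "\<dots> = (\<integral>\<omega>. 2 * (fst (X \<omega>) \<bullet> snd (X \<omega>)) \<partial>M)" using * by simp
    also have "\<dots> = (\<integral>\<omega>. S (X \<omega>) (X \<omega>) \<partial>M)" by (simp add: S_def inner_commute)
    finally show ?thesis .
  qed
  obtain f0 where f0: "cond_mean M R V f0" by (rule cond_mean_exists[OF M Rm V])
  have f0b: "f0 \<in> borel_measurable borel" using f0 by (simp add: cond_mean_def)
  obtain s :: "real^'m \<Rightarrow> real^'m" where s: "s \<in> borel_measurable borel" "\<forall>r. (r, s r) \<in> G"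
    by (rule maximal_S_monotone_selection[OF G dom])
  \<comment> \<open>\<open>f0\<close> is in the fibre of \<open>G\<close> only almost surely along
    \<open>R\<close>; the equilibrium condition involves all \<open>r\<close>, so the selection
    fills the rest without changing \<open>f (R)\<close> almost surely.\<close>
  define f where "f = (\<lambda>r. if (r, f0 r) \<in> G then f0 r else s r)"
  have fG: "(r, f r) \<in> G" for r using s by (simp add: f_def)
  have "(\<lambda>r. (r, f0 r)) \<in> borel_measurable borel" using f0b by (intro borel_measurable_Pair) auto
  from measurable_sets[OF this borel_closed[OF maximal_S_monotone_closed[OF G]]]
  have "{r \<in> space borel. (r, f0 r) \<in> G} \<in> sets borel" by (simp add: vimage_def)
  then have fb: "f \<in> borel_measurable borel" unfolding f_def by (intro measurable_If f0b s) auto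
  have "AE \<omega> in M. (R \<omega>, f0 (R \<omega>)) \<in> G"
    by (rule no_gap_imp(1)[OF pair[OF f0] G]) (use v val[OF f0] in simp)
  then have "AE \<omega> in M. f (R \<omega>) = f0 (R \<omega>)" by (rule eventually_mono) (simp add: f_def)
  then have f: "cond_mean M R V f" by (rule cond_mean_cong_AE[OF f0 fb Rm])
  have fL: "L2 M (\<lambda>\<omega>. f (R \<omega>))" using f by (simp add: cond_mean_def)
  have v': "ext_integral M (\<lambda>\<omega>. psi G (Y \<omega>)) \<le> ereal ((\<integral>\<omega>. S (R \<omega>, f (R \<omega>)) (R \<omega>, f (R \<omega>)) \<partial>M) / 2)"
    using v val[OF f] by simp
  have "(\<lambda>\<omega>. (R \<omega>, f (R \<omega>))) \<in> measurable (vimage_algebra (space M) Y borel) borel"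
    using RY measurable_compose[OF RY fb] by (rule borel_measurable_Pair)
  then have "(\<lambda>\<omega>. (R \<omega>, f (R \<omega>))) \<in> Xset M Y"
    using pair[OF f] by (simp add: Xset_iff[OF M Y])
  then have om: "optimal_map M Y (\<lambda>\<omega>. (R \<omega>, f (R \<omega>)))"
    by (rule no_gap_imp_optimal_map[OF M Y _ G v'])
  have "AE \<omega> in M. \<forall>r. (r - U \<omega>) \<bullet> (V \<omega> - f r) \<le> (R \<omega> - U \<omega>) \<bullet> (V \<omega> - f (R \<omega>))"
    using no_gap_imp(2)[OF pair[OF f] G v']
  proof eventually_elim
    case (elim \<omega>)
    show ?case
    proof
      fix r
      \<comment> \<open>The tangent value at \<open>(r, f r)\<close> equals
        \<open>(r - U) \<bullet> (V - f r)\<close> plus \<open>U \<bullet> V\<close>, a term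
        independent of \<open>r\<close>.\<close>
      have "ereal (S (r, f r) (Y \<omega>) - S (r, f r) (r, f r) / 2) \<le> psi G (Y \<omega>)" by (rule psi_upper[OF fG])
      also note elim
      finally show "(r - U \<omega>) \<bullet> (V \<omega> - f r) \<le> (R \<omega> - U \<omega>) \<bullet> (V \<omega> - f (R \<omega>))"
        by (simp add: S_def Y_def inner_diff_left inner_diff_right inner_commute)
    qed
  qed
  moreover have "cond_exp_eq M R V (\<lambda>\<omega>. f (R \<omega>))"
    unfolding cond_exp_eq_def
  proof (intro conjI ballI)
    show "integrable M V" "integrable M (\<lambda>\<omega>. f (R \<omega>))" using Vi L2_integrable[OF finite_measure_axioms fL] by auto
    have "R \<in> measurable (vimage_algebra (space M) R borel) borel" by (rule measurable_vimage_algebra1) simp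
    then show "(\<lambda>\<omega>. f (R \<omega>)) \<in> measurable (vimage_algebra (space M) R borel) borel"
      by (rule measurable_compose[OF _ fb])
    show "(\<integral>\<omega>. indicator (R -` A) \<omega> *\<^sub>R V \<omega> \<partial>M) = (\<integral>\<omega>. indicator (R -` A) \<omega> *\<^sub>R f (R \<omega>) \<partial>M)"
      if "A \<in> sets borel" for A
      using f that by (simp add: cond_mean_def indicator_def)
  qed
  ultimately have "Y_equilibrium M U V R f"
    unfolding Y_equilibrium_def using RL RY fb by (simp add: Y_def)
  then show ?thesis using that fG om by blast
qed

text \<open>Moving the base point a little towards \<open>u\<close> replaces a point of \<open>G\<close> by one of the graph of \<open>f\<close>.\<close>

lemma graph_bound_imp_S_bound:
  assumes mono: "S_monotone G" and fG: "\<And>r. (r, f r) \<in> G"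
    and b: "\<And>r. f r \<bullet> u + r \<bullet> v - r \<bullet> f r \<le> b" and x: "x \<in> G"
  shows "S x (u, v) - S x x / 2 \<le> b"
proof -
  obtain r s where rs: "x = (r, s)" by (cases x)
  have "s \<bullet> (u - r) + r \<bullet> v \<le> b"
  proof (rule le_of_small_scale)
    fix t :: real assume t: "0 < t" "t \<le> 1"
    define r' where "r' = r + t *\<^sub>R (u - r)"
    have "0 \<le> S ((r', f r') - (r, s)) ((r', f r') - (r, s))"
      using mono fG x rs unfolding S_monotone_def by blast
    then have "0 \<le> t * ((f r' - s) \<bullet> (u - r))" by (simp add: S_def r'_def inner_commute)
    then have "s \<bullet> (u - r) \<le> f r' \<bullet> (u - r)" using t by (simp add: zero_le_mult_iff inner_diff_left)
    then have "(1 - t) * (s \<bullet> (u - r)) \<le> (1 - t) * (f r' \<bullet> (u - r))" using t by (intro mult_left_mono) auto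
    also have "\<dots> = f r' \<bullet> u - r' \<bullet> f r'"
      by (simp add: r'_def inner_add_left inner_diff_left inner_diff_right inner_commute algebra_simps)
    also have "\<dots> \<le> b - r' \<bullet> v" using b[of r'] by simp
    also have "r' \<bullet> v = r \<bullet> v + t * ((u - r) \<bullet> v)" by (simp add: r'_def inner_add_left)
    finally show "s \<bullet> (u - r) + r \<bullet> v \<le> b + t * (s \<bullet> (u - r) - (u - r) \<bullet> v)"
      by (simp add: algebra_simps)
  qed
  then show ?thesis unfolding rs by (simp add: S_def inner_diff_right inner_commute)
qed

text \<open>The optimal map is \<open>E[Y | R]\<close>; it may differ from \<open>(R, f R)\<close>, e.g. when \<open>f\<close> is constant.\<close>

lemma no_gap_of_equilibrium:
  fixes U V :: "'a \<Rightarrow> real^'m"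
  assumes M: "prob_space M" and U: "L2 M U" and V: "L2 M V" and Y_def: "Y = (\<lambda>\<omega>. (U \<omega>, V \<omega>))"
    and eq: "Y_equilibrium M U V R f" and mono: "monotone_fun f"
  obtains X G where "X \<in> Xset M Y" "maximal_S_monotone G" "{u. \<exists>v. (u, v) \<in> G} = UNIV"
    "ext_integral M (\<lambda>\<omega>. psi G (Y \<omega>)) \<le> ereal ((\<integral>\<omega>. S (X \<omega>) (X \<omega>) \<partial>M) / 2)"
proof -
  interpret prob_space M by fact
  have Y: "L2 M Y" unfolding Y_def by (rule L2_Pair[OF U V])
  have Ui: "integrable M U" and Vi: "integrable M V"
    using L2_integrable[OF finite_measure_axioms U] L2_integrable[OF finite_measure_axioms V] by auto
  have RL: "L2 M R" and RY: "R \<in> measurable (vimage_algebra (space M) Y borel) borel"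
    and fb: "f \<in> borel_measurable borel" and ce: "cond_exp_eq M R V (\<lambda>\<omega>. f (R \<omega>))"
    and argmax: "AE \<omega> in M. \<forall>r. (r - U \<omega>) \<bullet> (V \<omega> - f r) \<le> (R \<omega> - U \<omega>) \<bullet> (V \<omega> - f (R \<omega>))"
    using eq unfolding Y_equilibrium_def Y_def by auto
  have Rm: "R \<in> borel_measurable M" by (rule L2_D(1)[OF RL])
  obtain f2 where f2: "cond_mean M R V f2" by (rule cond_mean_exists[OF M Rm V])
  have "AE \<omega> in M. f (R \<omega>) = f2 (R \<omega>)"
  proof (rule cond_mean_integrable_version[OF M Rm V fb _ _ f2])
    show "integrable M (\<lambda>\<omega>. f (R \<omega>))" using ce by (simp add: cond_exp_eq_def)
    show "(\<integral>\<omega>. indicator A (R \<omega>) *\<^sub>R V \<omega> \<partial>M) = (\<integral>\<omega>. indicator A (R \<omega>) *\<^sub>R f (R \<omega>) \<partial>M)"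
      if "A \<in> sets borel" for A
      using ce that by (simp add: cond_exp_eq_def indicator_def)
  qed
  then have fV: "cond_mean M R V f" by (rule cond_mean_cong_AE[OF f2 fb Rm])
  have fL: "L2 M (\<lambda>\<omega>. f (R \<omega>))" using fV by (simp add: cond_mean_def)
  obtain \<mu> where \<mu>: "cond_mean M R U \<mu>" by (rule cond_mean_exists[OF M Rm U])
  have \<mu>b: "\<mu> \<in> borel_measurable borel" and \<mu>L: "L2 M (\<lambda>\<omega>. \<mu> (R \<omega>))" using \<mu> by (auto simp: cond_mean_def)
  define X where "X = (\<lambda>\<omega>. (\<mu> (R \<omega>), f (R \<omega>)))"
  have mX: "martingale_pair M X Y"
    unfolding X_def
    by (rule martingale_pair_of_cond_mean[OF M Rm Y cond_mean_Pair[OF finite_measure_axioms Rm Ui Vi \<mu> fV, folded Y_def]])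
  have "X \<in> measurable (vimage_algebra (space M) Y borel) borel"
    unfolding X_def using measurable_compose[OF RY \<mu>b] measurable_compose[OF RY fb] by (rule borel_measurable_Pair)
  then have XX: "X \<in> Xset M Y" using mX by (simp add: Xset_iff[OF M Y])
  have "S_monotone (range (\<lambda>r. (r, f r)))"
    using mono unfolding S_monotone_def monotone_fun_def by (auto simp: S_def inner_commute)
  then obtain G where G: "maximal_S_monotone G" "range (\<lambda>r. (r, f r)) \<subseteq> G" by (rule extend_to_maximal_S_monotone)
  have fG: "(r, f r) \<in> G" for r using G(2) by auto
  \<comment> \<open>The tangent of \<open>q\<close> at \<open>(R, f R)\<close>, not at
    \<open>X\<close>, evaluated at \<open>Y\<close>. The equilibrium condition says that it
    dominates the tangents at all points of the graph of \<open>f\<close>.\<close>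
  define h where "h = (\<lambda>\<omega>. f (R \<omega>) \<bullet> U \<omega> + R \<omega> \<bullet> V \<omega> - R \<omega> \<bullet> f (R \<omega>))"
  have i: "integrable M (\<lambda>\<omega>. f (R \<omega>) \<bullet> U \<omega>)" "integrable M (\<lambda>\<omega>. R \<omega> \<bullet> V \<omega>)" "integrable M (\<lambda>\<omega>. R \<omega> \<bullet> f (R \<omega>))"
    by (rule L2_integrable_inner[OF fL U], rule L2_integrable_inner[OF RL V], rule L2_integrable_inner[OF RL fL])
  have hi: "integrable M h" unfolding h_def using i by auto
  have "AE \<omega> in M. psi G (Y \<omega>) \<le> ereal (h \<omega>)"
    using argmax
  proof eventually_elim
    case (elim \<omega>)
    have "f r \<bullet> U \<omega> + r \<bullet> V \<omega> - r \<bullet> f r \<le> h \<omega>" for r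
      using elim[rule_format, of r] unfolding h_def
      by (simp add: inner_diff_left inner_diff_right inner_commute)
    then show ?case
      unfolding psi_def Y_def using G(1) fG
      by (intro SUP_least) (auto simp: maximal_S_monotone_def intro: graph_bound_imp_S_bound)
  qed
  then have "ext_integral M (\<lambda>\<omega>. psi G (Y \<omega>)) \<le> ereal (\<integral>\<omega>. h \<omega> \<partial>M)"
    unfolding ext_integral_real[OF hi, symmetric] by (rule ext_integral_mono_AE)
  \<comment> \<open>The terms with \<open>R\<close> cancel in the mean since E[V | R] =
    \<open>f (R)\<close>; what remains is \<open>f (R) \<bullet> \<mu> (R)\<close>, which is
    \<open>q (X)\<close>.\<close>
  also have "(\<integral>\<omega>. h \<omega> \<partial>M) = (\<integral>\<omega>. f (R \<omega>) \<bullet> \<mu> (R \<omega>) \<partial>M)"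
  proof -
    have "(\<integral>\<omega>. f (R \<omega>) \<bullet> U \<omega> \<partial>M) = (\<integral>\<omega>. f (R \<omega>) \<bullet> \<mu> (R \<omega>) \<partial>M)"
      by (rule cond_mean_test[OF M Rm U \<mu> fb fL])
    moreover have "(\<integral>\<omega>. R \<omega> \<bullet> V \<omega> \<partial>M) = (\<integral>\<omega>. R \<omega> \<bullet> f (R \<omega>) \<partial>M)"
      by (rule cond_mean_test[OF M Rm V fV, of "\<lambda>r. r"]) (use RL in auto)
    ultimately show ?thesis unfolding h_def using i by simp
  qed
  also have "\<dots> = (\<integral>\<omega>. S (X \<omega>) (X \<omega>) / 2 \<partial>M)" by (simp add: X_def S_def inner_commute)
  finally have "ext_integral M (\<lambda>\<omega>. psi G (Y \<omega>)) \<le> ereal ((\<integral>\<omega>. S (X \<omega>) (X \<omega>) \<partial>M) / 2)" by simp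
  moreover have "{u. \<exists>v. (u, v) \<in> G} = UNIV" using fG by blast
  ultimately show ?thesis using that XX G(1) by blast
qed

theorem theorem8:
  fixes M :: "'a measure" and U V :: "'a \<Rightarrow> real^'m"
  assumes "prob_space M" and "L2 M U" and "L2 M V"
  defines "Y \<equiv> (\<lambda>\<omega>. (U \<omega>, V \<omega>))"
  defines "\<nu> \<equiv> distr M borel Y"
  shows "((\<exists>R f. Y_equilibrium M U V R f \<and> monotone_fun f) \<longleftrightarrow>
           (\<exists>X G. optimal_map M Y X \<and> optimal_dual_set \<nu> G \<and>
                  optimal_plan \<nu> (distr M borel (\<lambda>\<omega>. (X \<omega>, Y \<omega>))) \<and>
                  {u. \<exists>v. (u, v) \<in> G} = UNIV))
      \<and> ((\<exists>R f. Y_equilibrium M U V R f \<and> monotone_fun f) \<longrightarrow>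
           (\<forall>G. optimal_dual_set \<nu> G \<and> {u. \<exists>v. (u, v) \<in> G} = UNIV \<longrightarrow>
              (\<exists>R f. Y_equilibrium M U V R f \<and> (\<forall>r. (r, f r) \<in> G) \<and>
                     optimal_map M Y (\<lambda>\<omega>. (R \<omega>, f (R \<omega>))))))"
proof -
  note M = assms(1) and U = assms(2) and V = assms(3)
  have Y_eq: "Y = (\<lambda>\<omega>. (U \<omega>, V \<omega>))" by (simp add: Y_def)
  have Y: "L2 M Y" unfolding Y_def by (rule L2_Pair[OF U V])
  have Ym: "Y \<in> borel_measurable M" by (rule L2_D(1)[OF Y])
  have dual_le: "ext_integral M (\<lambda>\<omega>. psi G (Y \<omega>)) \<le> ext_integral M (\<lambda>\<omega>. psi G' (Y \<omega>))"
    if "optimal_dual_set \<nu> G" "maximal_S_monotone G'" for G G'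
    using that unfolding optimal_dual_set_def \<nu>_def ext_integral_psi_distr[OF Ym] by blast
  have a_b: "\<exists>X G. optimal_map M Y X \<and> optimal_dual_set \<nu> G \<and>
      optimal_plan \<nu> (distr M borel (\<lambda>\<omega>. (X \<omega>, Y \<omega>))) \<and> {u. \<exists>v. (u, v) \<in> G} = UNIV"
    if a: "\<exists>R f. Y_equilibrium M U V R f \<and> monotone_fun f"
  proof -
    obtain R f where Rf: "Y_equilibrium M U V R f" "monotone_fun f" using a by blast
    obtain X G where X: "X \<in> Xset M Y" and G: "maximal_S_monotone G" "{u. \<exists>v. (u, v) \<in> G} = UNIV"
      and v: "ext_integral M (\<lambda>\<omega>. psi G (Y \<omega>)) \<le> ereal ((\<integral>\<omega>. S (X \<omega>) (X \<omega>) \<partial>M) / 2)"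
      by (rule no_gap_of_equilibrium[OF M U V Y_eq Rf])
    have m: "martingale_pair M X Y" using X by (simp add: Xset_iff[OF M Y])
    show ?thesis
      using no_gap_imp_optimal_map[OF M Y X G(1) v] no_gap_imp_optimal_plan[OF m G(1) v]
        no_gap_imp_optimal_dual_set[OF m G(1) v] G(2) unfolding \<nu>_def by blast
  qed
  \<comment> \<open>\<open>G'\<close> witnesses the absence of a gap, \<open>G\<close> has the full
    projection. Optimality of \<open>G\<close> passes the bound from \<open>G'\<close> to
    \<open>G\<close>.\<close>
  have last: "\<exists>R f. Y_equilibrium M U V R f \<and> (\<forall>r. (r, f r) \<in> G) \<and> optimal_map M Y (\<lambda>\<omega>. (R \<omega>, f (R \<omega>)))"
    if X: "X \<in> Xset M Y" and G: "optimal_dual_set \<nu> G" "{u. \<exists>v. (u, v) \<in> G} = UNIV"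
      and G': "maximal_S_monotone G'"
        "ext_integral M (\<lambda>\<omega>. psi G' (Y \<omega>)) \<le> ereal ((\<integral>\<omega>. S (X \<omega>) (X \<omega>) \<partial>M) / 2)" for X G G'
  proof -
    have "maximal_S_monotone G" using G(1) by (simp add: optimal_dual_set_def)
    then obtain R f where "Y_equilibrium M U V R f" "\<forall>r. (r, f r) \<in> G" "optimal_map M Y (\<lambda>\<omega>. (R \<omega>, f (R \<omega>)))"
      by (rule equilibrium_of_no_gap[OF M U V Y_eq X _ G(2) order_trans[OF dual_le[OF G(1) G'(1)] G'(2)]])
    then show ?thesis by blast
  qed
  have b_a: "\<exists>R f. Y_equilibrium M U V R f \<and> monotone_fun f"
    if X: "optimal_map M Y X" and G: "optimal_dual_set \<nu> G" "{u. \<exists>v. (u, v) \<in> G} = UNIV"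
      and plan: "optimal_plan \<nu> (distr M borel (\<lambda>\<omega>. (X \<omega>, Y \<omega>)))" for X G
  proof -
    have XX: "X \<in> Xset M Y" using X by (simp add: optimal_map_def)
    then have m: "martingale_pair M X Y" by (simp add: Xset_iff[OF M Y])
    have Xm: "X \<in> borel_measurable M" using m by (simp add: martingale_pair_def L2_def)
    \<comment> \<open>Optimality among maps would not suffice here: the perturbed competitor is only
      a plan.\<close>
    have opt: "(\<integral>z. S (fst z) (snd z) \<partial>\<gamma>) \<le> (\<integral>\<omega>. S (X \<omega>) (X \<omega>) \<partial>M)" if "\<gamma> \<in> Gamma (distr M borel Y)" for \<gamma>
      using plan that unfolding optimal_plan_def \<nu>_def integral_S_distr[OF Xm Ym] martingale_pair_value[OF m] by simp
    obtain G' where G': "maximal_S_monotone G'"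
      "ext_integral M (\<lambda>\<omega>. psi G' (Y \<omega>)) \<le> ereal ((\<integral>\<omega>. S (X \<omega>) (X \<omega>) \<partial>M) / 2)"
      by (rule strong_duality[OF m opt])
    obtain R f where Rf: "Y_equilibrium M U V R f" "\<forall>r. (r, f r) \<in> G"
      using last[OF XX G G'] by blast
    have "0 \<le> (u - r) \<bullet> (f u - f r)" for u r
    proof -
      have "0 \<le> S ((u, f u) - (r, f r)) ((u, f u) - (r, f r))"
        using G(1) Rf(2) unfolding optimal_dual_set_def maximal_S_monotone_def S_monotone_def by blast
      then show ?thesis by (simp add: S_def inner_commute)
    qed
    then show ?thesis using Rf(1) unfolding monotone_fun_def by blast
  qed
  have a_last: "\<exists>R f. Y_equilibrium M U V R f \<and> (\<forall>r. (r, f r) \<in> G) \<and> optimal_map M Y (\<lambda>\<omega>. (R \<omega>, f (R \<omega>)))"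
    if a: "\<exists>R f. Y_equilibrium M U V R f \<and> monotone_fun f"
      and G: "optimal_dual_set \<nu> G" "{u. \<exists>v. (u, v) \<in> G} = UNIV" for G
  proof -
    obtain R f where Rf: "Y_equilibrium M U V R f" "monotone_fun f" using a by blast
    obtain X G' where "X \<in> Xset M Y" "maximal_S_monotone G'"
      "ext_integral M (\<lambda>\<omega>. psi G' (Y \<omega>)) \<le> ereal ((\<integral>\<omega>. S (X \<omega>) (X \<omega>) \<partial>M) / 2)"
      by (rule no_gap_of_equilibrium[OF M U V Y_eq Rf])
    then show ?thesis using last[OF _ G] by blast
  qed
  show ?thesis using a_b b_a a_last by blast
qed

end
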